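(* Let $1<p<\infty$, $0<q<p$ and $\alpha=\frac1q-\frac1p$. Let $b\in\Lambda_\alpha(\mathbb D)$. Then the operator $\Pi_{1,0}(H_b)$ is bounded from $\mathcal H^q(\mathbb D)$ into $\mathcal H^p(\mathbb D)$.
   Context: $\mathbb N=\{0,1,2,\dots\}$, $\mathbb D$ is the open unit disc and $\mathbb T$ the unit circle (identified with $\mathbb R/2\pi\mathbb Z$). For $r>0$, $\mathcal H^r(\mathbb D)$ is the complex (holomorphic) Hardy space of the disc. For $\alpha>0$, $\Lambda_\alpha(\mathbb T)$ is the usual Lipschitz (Hölder–Zygmund) space of order $\alpha$: with $k$ the smallest integer $>\alpha$ and $\Delta_h g(x)=g(x+h)-g(x)$, it consists of the continuous functions $b$ on $\mathbb T$ with $\|b\|_\infty+\sup_{h\ne0}|h|^{-\alpha}\|\Delta_h^k b\|_\infty<\infty$. $\Lambda_\alpha(\mathbb D)$ is the space of functions holomorphic in $\mathbb D$ whose boundary values are in $\Lambda_\alpha(\mathbb T)$. For $b(\zeta)=\sum_{k\ge0}b_k\zeta^k$, the Hankel operator $H_b$ with symbol $b$ acts on $f(z)=\sum_{n\in\mathbb N}a_nz^n$ by $$H_bf(z)=\frac1{2\pi}\int_{\mathbb T}\frac{b(\zeta)f(\overline\zeta)}{1-\overline\zeta z}\,d\sigma(\zeta)=\sum_{m\in\mathbb N}\Bigl(\sum_{n\in\mathbb N}a_nb_{m+n}\Bigr)z^m,$$ with $\sigma$ the arc-length measure; its matrix has $(m,n)$ entry $b_{m+n}$. The truncation $\Pi_{1,0}(H_b)$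 is the operator whose matrix has $(m,n)$ entry $b_{m+n}$ if $m\ge n$ and $0$ otherwise, i.e. $$\Pi_{1,0}(H_b)f(z)=\sum_{m\in\mathbb N}\Bigl(\sum_{0\le n\le m}a_nb_{m+n}\Bigr)z^m .$$ Boundedness from $\mathcal H^q(\mathbb D)$ into $\mathcal H^p(\mathbb D)$ means that there is a constant $C$ with $\|\Pi_{1,0}(H_b)f\|_{\mathcal H^p(\mathbb D)}\le C\|f\|_{\mathcal H^q(\mathbb D)}$ for all $f\in\mathcal H^q(\mathbb D)$. *)

theory Defs
  imports "HOL-Complex_Analysis.Complex_Analysis"
begin

definition integral_mean :: "real \<Rightarrow> (complex \<Rightarrow> complex) \<Rightarrow> real \<Rightarrow> real" where
  "integral_mean r f s =
     ((1 / (2 * pi)) * integral {0..2 * pi} (\<lambda>t. norm (f (of_real s * cis t)) powr r)) powr (1 / r)"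

definition hardy :: "real \<Rightarrow> (complex \<Rightarrow> complex) set" where
  "hardy r = {f. f holomorphic_on ball 0 1 \<and> bdd_above (integral_mean r f ` {0<..<1})}"

text \<open>Meaningful only for members of \<open>hardy r\<close>, where the supremum is over a bounded set.\<close>

definition hardy_norm :: "real \<Rightarrow> (complex \<Rightarrow> complex) \<Rightarrow> real" where
  "hardy_norm r f = (SUP s\<in>{0<..<1}. integral_mean r f s)"

definition fin_diff :: "real \<Rightarrow> (real \<Rightarrow> complex) \<Rightarrow> real \<Rightarrow> complex" where
  "fin_diff h g = (\<lambda>x. g (x + h) - g x)"

text \<open>Functions on the circle are \<open>2 * pi\<close>-periodic functions on the line. By periodicity,
  letting \<open>h\<close> range over all nonzero reals gives the same supremum as \<open>0 < \<bar>h\<bar> \<le> pi\<close>.\<close>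

definition lipschitz_circle :: "real \<Rightarrow> (real \<Rightarrow> complex) set" where
  "lipschitz_circle \<alpha> = {g.
     (\<forall>x. g (x + 2 * pi) = g x) \<and> continuous_on UNIV g \<and> bounded (range g) \<and>
     (let k = (LEAST k::nat. real k > \<alpha>) in
       bdd_above {\<bar>h\<bar> powr (- \<alpha>) * norm ((fin_diff h ^^ k) g x) | h x. h \<noteq> 0})}"

text \<open>The boundary values are unrestricted limits from inside the disc, so a member extends
  continuously to the closed disc.\<close>

definition lipschitz_disc :: "real \<Rightarrow> (complex \<Rightarrow> complex) set" where
  "lipschitz_disc \<alpha> = {b. b holomorphic_on ball 0 1 \<and>
     (\<exists>g\<in>lipschitz_circle \<alpha>. \<forall>t. (b \<longlongrightarrow> g t) (at (cis t) within ball 0 1))}"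

definition taylor_coeff :: "(complex \<Rightarrow> complex) \<Rightarrow> nat \<Rightarrow> complex" where
  "taylor_coeff f n = (deriv ^^ n) f 0 / fact n"

definition hankel_matrix :: "(complex \<Rightarrow> complex) \<Rightarrow> nat \<Rightarrow> nat \<Rightarrow> complex" where
  "hankel_matrix b m n = taylor_coeff b (m + n)"

definition truncate_1_0 :: "(nat \<Rightarrow> nat \<Rightarrow> complex) \<Rightarrow> nat \<Rightarrow> nat \<Rightarrow> complex" where
  "truncate_1_0 A m n = (if m \<ge> n then A m n else 0)"

definition matrix_op :: "(nat \<Rightarrow> nat \<Rightarrow> complex) \<Rightarrow> (complex \<Rightarrow> complex) \<Rightarrow> complex \<Rightarrow> complex" where
  "matrix_op A f z = (\<Sum>m. (\<Sum>n. A m n * taylor_coeff f n) * z ^ m)"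

text \<open>Convergence of the series in \<open>matrix_op\<close>, at every point of the disc.\<close>

definition matrix_op_defined :: "(nat \<Rightarrow> nat \<Rightarrow> complex) \<Rightarrow> (complex \<Rightarrow> complex) \<Rightarrow> bool" where
  "matrix_op_defined A f \<longleftrightarrow>
     (\<forall>m. summable (\<lambda>n. A m n * taylor_coeff f n)) \<and>
     (\<forall>z\<in>ball 0 1. summable (\<lambda>m. (\<Sum>n. A m n * taylor_coeff f n) * z ^ m))"

definition bounded_matrix_op :: "(nat \<Rightarrow> nat \<Rightarrow> complex) \<Rightarrow> real \<Rightarrow> real \<Rightarrow> bool" where
  "bounded_matrix_op A q p \<longleftrightarrow>
     (\<exists>C. \<forall>f\<in>hardy q. matrix_op_defined A f \<and> matrix_op A f \<in> hardy p \<and>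
        hardy_norm p (matrix_op A f) \<le> C * hardy_norm q f)"

end

theory Submission
  imports Defs "HOL-Probability.Probability_Measure" "HOL-Real_Asymp.Real_Asymp"
begin

text \<open>
  Write \<open>f(z) = \<Sum> a\<^sub>n z\<^sup>n\<close> and \<open>b(z) = \<Sum> b\<^sub>k z\<^sup>k\<close>. The function \<open>h = \<Sum>\<^sub>m (\<Sum>\<^sub>n\<^sub>\<le>\<^sub>m a\<^sub>n b\<^sub>m\<^sub>+\<^sub>n) z\<^sup>m\<close> has to be
  bounded in the Hardy space of exponent \<open>p\<close>. Grouping the terms by \<open>k = m + n\<close> gives
  \<open>h(z) = \<Sum> b\<^sub>k d\<^sub>k\<close>, where the \<open>d\<^sub>k\<close> are the Taylor coefficients in \<open>\<zeta>\<close> of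
  \<open>W(\<zeta>) = f(z \<zeta>\<^sup>2) / (1 - z \<zeta>)\<close>: an entry with \<open>m = n + j\<close> contributes
  \<open>a\<^sub>n (z \<zeta>\<^sup>2)\<^sup>n (z \<zeta>)\<^sup>j\<close>, and the truncation to \<open>n \<le> m\<close> means exactly that \<open>j \<ge> 0\<close>.

  Smoothness of \<open>b\<close> enters through the Euler operator \<open>z d/dz\<close>. If \<open>\<kappa>\<close> is the order of the
  differences that define the Lipschitz class, then the \<open>\<kappa>\<close>-th iterate of that operator on \<open>b\<close> is
  \<open>O(\<bar>z\<bar> (1 - \<bar>z\<bar>)\<^bsup>\<alpha> - \<kappa>\<^esup>)\<close> (\<open>lipschitz_disc_euler_bound\<close>). Its coefficients are \<open>k\<^sup>\<kappa> b\<^sub>k\<close>, and the factor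
  \<open>k\<^sup>\<kappa>\<close> is undone by a logarithmic moment on \<open>(0, 1)\<close>; so \<open>\<Sum> b\<^sub>k d\<^sub>k\<close> is, up to its first term, an
  integral of that iterate against \<open>W\<close>, and \<open>\<bar>h(z)\<bar>\<close> is dominated by the integral of \<open>\<bar>W\<bar>\<close> over the disc
  with weight \<open>(1 - \<bar>\<zeta>\<bar>)\<^bsup>\<alpha> - 1\<^esup>\<close> (\<open>representation_bound\<close>).

  The function \<open>W\<close> is in turn a Poisson integral of \<open>f(c s) / (1 - c' s)\<close> in the variable \<open>s\<close> on the
  circle (\<open>hankel_weight_le\<close>). Pairing \<open>\<bar>h\<bar>\<close> with \<open>G \<ge> 0\<close> on the circle therefore leads to a
  trilinear integral
  of \<open>\<bar>f\<bar>\<close>, the Poisson extension \<open>U\<close> of \<open>G\<close>, and the Cauchy kernel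
  \<open>1 / \<bar>1 - \<omega> e\<^sup>i\<^sup>t\<bar>\<close>. The Cauchy kernel is not uniformly integrable on circles, but it is in every
  \<open>L\<^sup>\<sigma>\<close> with \<open>\<sigma> > 1\<close> with the norm that scaling dictates. Since \<open>q < p\<close>, there is room for
  \<open>max q 1 < s < t < p\<close> with \<open>1 / \<sigma> = 1 - 1 / s + 1 / t\<close>, and no logarithm is lost. A pointwise
  three-term
  version of Young's inequality reduces the trilinear integral to the two embeddings
  \<open>\<integral> \<bar>f\<bar>\<^sup>s (1 - \<bar>z\<bar>)\<^bsup>s/q - 2\<^esup> \<le> C\<close> and \<open>\<integral> U\<^bsup>t'\<^esup> (1 - \<bar>z\<bar>)\<^bsup>t'/p' - 2\<^esup> \<le> C\<close> of Hardy and Littlewood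
  (\<open>trilinear_bound\<close>).

  Both embeddings are instances of one statement on averaging kernels
  (\<open>nn_integral_kernel_avg_scales\<close>), proved by cutting the averaged function at a height that depends
  on the scale. It applies to \<open>f\<close>, for every \<open>q > 0\<close>, because \<open>\<bar>f\<bar>\<^bsup>q/2\<^esup>\<close> is dominated by the
  Poisson integral of its values on a circle (\<open>Poisson_majorant\<close>): remove the zeros
  with Blaschke factors and take a holomorphic power. Finally, \<open>G\<close> is chosen as a multiple of
  \<open>\<bar>h\<bar>\<^bsup>p - 1\<^esup>\<close>, which turns the pairing into the norm of \<open>h\<close>.
\<close>

section \<open>Integration over the circle and the Poisson formula\<close>

text \<open>Arc length on the circle, normalised to total mass one and placed on the whole line, so that
  the circle is seen through periodic functions and measurability never refers to a carrier.\<close>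

definition circ :: "real measure" where
  "circ = uniform_measure lborel {0..2 * pi}"

lemma sets_circ [measurable_cong, simp]: "sets circ = sets borel"
  by (simp add: circ_def)

lemma space_circ [simp]: "space circ = UNIV"
  by (simp add: circ_def)

lemma prob_space_circ: "prob_space circ"
  unfolding circ_def by (rule prob_space_uniform_measure) auto

interpretation circ: prob_space circ
  by (rule prob_space_circ)

lemma nn_integral_circ:
  assumes [measurable]: "g \<in> borel_measurable borel"
  shows "(\<integral>\<^sup>+x. g x \<partial>circ) = (\<integral>\<^sup>+x. g x * indicator {0..2 * pi} x \<partial>lborel) / ennreal (2 * pi)"
  unfolding circ_def by (subst nn_integral_uniform_measure) auto

lemma nn_integral_circ_halfopen:
  assumes [measurable]: "g \<in> borel_measurable borel"
  shows "(\<integral>\<^sup>+x. g x \<partial>circ) = (\<integral>\<^sup>+x. g x * indicator {0..<2 * pi} x \<partial>lborel) / ennreal (2 * pi)"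
proof -
  have "AE x in lborel. x \<noteq> 2 * pi"
    by (rule AE_lborel_singleton)
  hence "(\<integral>\<^sup>+x. g x * indicator {0..2 * pi} x \<partial>lborel) = (\<integral>\<^sup>+x. g x * indicator {0..<2 * pi} x \<partial>lborel)"
    by (intro nn_integral_cong_AE) (auto simp: indicator_def)
  thus ?thesis by (simp add: nn_integral_circ)
qed

lemma nn_integral_shift:
  fixes g :: "real \<Rightarrow> ennreal"
  assumes [measurable]: "g \<in> borel_measurable borel"
  shows "(\<integral>\<^sup>+x. g (x + a) \<partial>lborel) = (\<integral>\<^sup>+x. g x \<partial>lborel)"
  using nn_integral_real_affine[of g 1 a] by (simp add: add.commute)

lemma periodic_2pi_int:
  assumes "\<And>x::real. g (x + 2 * pi) = g x"
  shows "g (x + 2 * pi * of_int k) = g x"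
proof (induction k rule: int_induct[where k=0])
  case base then show ?case by simp
next
  case (step1 i)
  have "g (x + 2 * pi * of_int (i + 1)) = g ((x + 2 * pi * of_int i) + 2 * pi)"
    by (simp add: algebra_simps)
  then show ?case using assms step1 by simp
next
  case (step2 i)
  have "g (x + 2 * pi * of_int i) = g ((x + 2 * pi * of_int (i - 1)) + 2 * pi)"
    by (simp add: algebra_simps)
  then show ?case using assms step2 by simp
qed

text \<open>Reducing the shift modulo the period to \<open>c \<in> [0, 2 * pi)\<close>, the shifted interval is cut at
  \<open>2 * pi\<close> and its right part is moved back by one period.\<close>

lemma nn_integral_circ_translate:
  fixes g :: "real \<Rightarrow> ennreal"
  assumes [measurable]: "g \<in> borel_measurable borel" and per: "\<And>x. g (x + 2 * pi) = g x"
  shows "(\<integral>\<^sup>+x. g (x + a) \<partial>circ) = (\<integral>\<^sup>+x. g x \<partial>circ)"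
proof -
  define k where "k = \<lfloor>a / (2 * pi)\<rfloor>"
  define c where "c = a - 2 * pi * of_int k"
  have "of_int k \<le> a / (2 * pi)" "a / (2 * pi) < of_int k + 1" unfolding k_def by linarith+
  hence c: "0 \<le> c" "c < 2 * pi" by (simp_all add: c_def field_simps)
  have "g (x + a) = g (x + c)" for x
    using periodic_2pi_int[of g "x + c" k, OF per] by (simp add: c_def)
  hence "(\<integral>\<^sup>+x. g (x + a) * indicator {0..<2 * pi} x \<partial>lborel)
       = (\<integral>\<^sup>+x. g (x + c) * indicator {c..<c + 2 * pi} (x + c) \<partial>lborel)"
    by (intro nn_integral_cong) (auto simp: indicator_def)
  also have "\<dots> = (\<integral>\<^sup>+x. g x * indicator {c..<c + 2 * pi} x \<partial>lborel)"
    by (rule nn_integral_shift) simp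
  also have "\<dots> = (\<integral>\<^sup>+x. g x * indicator {c..<2 * pi} x + g x * indicator {2 * pi..<c + 2 * pi} x \<partial>lborel)"
    using c by (intro nn_integral_cong) (auto simp: indicator_def)
  also have "\<dots> = (\<integral>\<^sup>+x. g x * indicator {c..<2 * pi} x \<partial>lborel)
                + (\<integral>\<^sup>+x. g x * indicator {2 * pi..<c + 2 * pi} x \<partial>lborel)"
    by (rule nn_integral_add) auto
  also have "(\<integral>\<^sup>+x. g x * indicator {2 * pi..<c + 2 * pi} x \<partial>lborel)
      = (\<integral>\<^sup>+x. g (x + 2 * pi) * indicator {2 * pi..<c + 2 * pi} (x + 2 * pi) \<partial>lborel)"
    by (rule nn_integral_shift[symmetric]) simp
  also have "\<dots> = (\<integral>\<^sup>+x. g x * indicator {0..<c} x \<partial>lborel)"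
    by (intro nn_integral_cong) (auto simp: indicator_def per)
  also have "(\<integral>\<^sup>+x. g x * indicator {c..<2 * pi} x \<partial>lborel) + (\<integral>\<^sup>+x. g x * indicator {0..<c} x \<partial>lborel)
     = (\<integral>\<^sup>+x. g x * indicator {c..<2 * pi} x + g x * indicator {0..<c} x \<partial>lborel)"
    by (rule nn_integral_add[symmetric]) auto
  also have "\<dots> = (\<integral>\<^sup>+x. g x * indicator {0..<2 * pi} x \<partial>lborel)"
    using c by (intro nn_integral_cong) (auto simp: indicator_def)
  finally show ?thesis by (simp add: nn_integral_circ_halfopen)
qed

text \<open>Doubling the angle runs through two periods at twice the speed.\<close>

lemma nn_integral_circ_double:
  fixes g :: "real \<Rightarrow> ennreal"
  assumes [measurable]: "g \<in> borel_measurable borel" and per: "\<And>x. g (x + 2 * pi) = g x"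
  shows "(\<integral>\<^sup>+x. g (2 * x) \<partial>circ) = (\<integral>\<^sup>+x. g x \<partial>circ)"
proof -
  define J where "J = (\<integral>\<^sup>+x. g x * indicator {0..<2 * pi} x \<partial>lborel)"
  have "J + J = J + (\<integral>\<^sup>+x. g (x + 2 * pi) * indicator {2 * pi..<4 * pi} (x + 2 * pi) \<partial>lborel)"
    unfolding J_def by (intro arg_cong2[where f="(+)"] nn_integral_cong) (auto simp: indicator_def per)
  also have "\<dots> = J + (\<integral>\<^sup>+x. g x * indicator {2 * pi..<4 * pi} x \<partial>lborel)"
    by (subst nn_integral_shift[where g="\<lambda>x. g x * indicator {2 * pi..<4 * pi} x"]) auto
  also have "\<dots> = (\<integral>\<^sup>+x. g x * indicator {0..<2 * pi} x + g x * indicator {2 * pi..<4 * pi} x \<partial>lborel)"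
    unfolding J_def by (rule nn_integral_add[symmetric]) auto
  also have "\<dots> = (\<integral>\<^sup>+x. g x * indicator {0..<4 * pi} x \<partial>lborel)"
    by (intro nn_integral_cong) (auto simp: indicator_def)
  also have "\<dots> = 2 * (\<integral>\<^sup>+x. g (2 * x) * indicator {0..<4 * pi} (2 * x) \<partial>lborel)"
    by (subst nn_integral_real_affine[where c=2 and t=0]) auto
  also have "(\<integral>\<^sup>+x. g (2 * x) * indicator {0..<4 * pi} (2 * x) \<partial>lborel)
     = (\<integral>\<^sup>+x. g (2 * x) * indicator {0..<2 * pi} x \<partial>lborel)"
    by (intro nn_integral_cong) (auto simp: indicator_def)
  finally have "2 * J = 2 * (\<integral>\<^sup>+x. g (2 * x) * indicator {0..<2 * pi} x \<partial>lborel)"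
    by (simp only: mult_2)
  hence "J = (\<integral>\<^sup>+x. g (2 * x) * indicator {0..<2 * pi} x \<partial>lborel)"
    by (subst (asm) ennreal_mult_cancel_left) auto
  thus ?thesis by (simp add: nn_integral_circ_halfopen J_def)
qed

lemma integrable_circ_bounded:
  fixes g :: "real \<Rightarrow> 'a::{banach,second_countable_topology}"
  assumes "g \<in> borel_measurable borel" and "\<And>x. norm (g x) \<le> B"
  shows "integrable circ g"
  using assms by (intro circ.integrable_const_bound[where B=B]) auto

lemma integral_circ:
  fixes g :: "real \<Rightarrow> 'a::euclidean_space"
  assumes "continuous_on UNIV g"
  shows "integral {0..2 * pi} g = (2 * pi) *\<^sub>R (LINT x|circ. g x)"
proof -
  have gm [measurable]: "g \<in> borel_measurable borel"
    using assms by (rule borel_measurable_continuous_onI)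
  have int: "set_integrable lborel {0..2 * pi} g"
    by (intro borel_integrable_atLeastAtMost') (rule continuous_on_subset[OF assms], simp)
  have "(LINT x|circ. g x) = (LINT x|lborel. (indicator {0..2 * pi} x / (2 * pi)) *\<^sub>R g x)"
  proof -
    have "circ = density lborel (\<lambda>x. ennreal (indicator {0..2 * pi} x / (2 * pi)))"
      unfolding circ_def uniform_measure_def
      by (intro density_cong) (auto simp: indicator_def divide_ennreal ennreal_1[symmetric] simp del: ennreal_1)
    hence "(LINT x|circ. g x) = (LINT x|density lborel (\<lambda>x. ennreal (indicator {0..2 * pi} x / (2 * pi))). g x)"
      by simp
    also have "\<dots> = (LINT x|lborel. (indicator {0..2 * pi} x / (2 * pi)) *\<^sub>R g x)"
      by (rule integral_density) auto
    finally show ?thesis .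
  qed
  also have "\<dots> = (1 / (2 * pi)) *\<^sub>R (LINT x:{0..2 * pi}|lborel. g x)"
    unfolding set_lebesgue_integral_def
    by (subst integral_scaleR_right[symmetric]) (auto intro!: Bochner_Integration.integral_cong)
  also have "(LINT x:{0..2 * pi}|lborel. g x) = integral {0..2 * pi} g"
    using int by (rule set_borel_integral_eq_integral)
  finally show ?thesis by simp
qed

definition poisson :: "real \<Rightarrow> real \<Rightarrow> real" where
  "poisson R t = (1 - R\<^sup>2) / (norm (1 - of_real R * cis t))\<^sup>2"

lemma norm_one_minus_cis_ge: "0 \<le> R \<Longrightarrow> 1 - R \<le> norm (1 - complex_of_real R * cis t)"
  using norm_triangle_ineq2[of 1 "complex_of_real R * cis t"] by (simp add: norm_mult)

lemma poisson_nonneg: "\<lbrakk>0 \<le> R; R < 1\<rbrakk> \<Longrightarrow> 0 \<le> poisson R t"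
  by (simp add: poisson_def power_le_one)

lemma poisson_le:
  assumes "0 \<le> R" "R < 1"
  shows "poisson R t \<le> 2 / (1 - R)"
proof -
  have "poisson R t \<le> (1 - R\<^sup>2) / (1 - R)\<^sup>2"
    unfolding poisson_def using assms norm_one_minus_cis_ge[of R t]
    by (intro divide_left_mono power_mono mult_pos_pos) (auto simp: power_le_one)
  also have "\<dots> = (1 + R) / (1 - R)"
    using assms by (simp add: power2_eq_square divide_simps) (simp add: algebra_simps)
  also have "\<dots> \<le> 2 / (1 - R)"
    using assms by (intro divide_right_mono) auto
  finally show ?thesis .
qed

lemma poisson_minus: "poisson R (- t) = poisson R t"
proof -
  have "1 - of_real R * cis (- t) = cnj (1 - of_real R * cis t)" by (simp add: cis_cnj)
  thus ?thesis unfolding poisson_def by (metis complex_mod_cnj)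
qed

lemma poisson_measurable [measurable (raw)]:
  "\<lbrakk>f \<in> borel_measurable M; g \<in> borel_measurable M\<rbrakk> \<Longrightarrow> (\<lambda>x. poisson (f x) (g x)) \<in> borel_measurable M"
  unfolding poisson_def
  by (intro borel_measurable_divide borel_measurable_diff borel_measurable_power borel_measurable_const
      borel_measurable_continuous_Pair[where H="\<lambda>R t. norm (1 - complex_of_real R * cis t)"])
     (auto intro!: continuous_intros)

lemma poisson_periodic: "poisson R (t + 2 * pi) = poisson R t"
  by (simp add: poisson_def cis_mult[symmetric])

text \<open>For \<open>a = R * cis u\<close>, Cauchy's formula at \<open>a\<close> is applied to \<open>g z * (1 - \<bar>a\<bar>\<^sup>2) / (1 - cnj a * z)\<close>, which
  agrees with \<open>g\<close> at \<open>a\<close>; on the circle the product of this factor with the Cauchy kernel is the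
  Poisson kernel.\<close>

lemma Poisson_formula:
  assumes "g holomorphic_on ball 0 S" "1 < S" and R: "0 \<le> R" "R < 1"
  shows "(LINT t|circ. poisson R (t - u) *\<^sub>R g (cis t)) = g (of_real R * cis u)"
proof -
  define a where "a = of_real R * cis u"
  define k where "k = (\<lambda>z. g z * of_real (1 - R\<^sup>2) / (1 - cnj a * z))"
  have na: "norm a = R" using R by (simp add: a_def norm_mult)
  have nz: "1 - cnj a * z \<noteq> 0" if "z \<in> cball 0 1" for z
  proof
    assume "1 - cnj a * z = 0"
    hence "1 = norm (cnj a * z)" by simp
    also have "\<dots> \<le> R * 1" unfolding norm_mult complex_mod_cnj na using that R
      by (intro mult_left_mono) auto
    finally show False using R by simp
  qed
  have hg: "g holomorphic_on cball 0 1"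
    using assms by (auto intro: holomorphic_on_subset)
  have hk: "k holomorphic_on cball 0 1"
    unfolding k_def by (intro holomorphic_intros hg nz)
  have "((\<lambda>w. k w / (w - a)) has_contour_integral 2 * of_real pi * \<i> * k a) (circlepath 0 1)"
    using na R hk
    by (intro Cauchy_integral_circlepath holomorphic_on_imp_continuous_on holomorphic_on_subset[OF hk]) auto
  hence "2 * of_real pi * \<i> * k a = contour_integral (circlepath 0 1) (\<lambda>w. k w / (w - a))"
    by (rule contour_integral_unique[symmetric])
  also have "\<dots> = integral {0..2 * pi} (\<lambda>t. k (cis t) / (cis t - a) * \<i> * cis t)"
    unfolding circlepath_def by (subst contour_integral_part_circlepath_eq) auto
  also have "(\<lambda>t. k (cis t) / (cis t - a) * \<i> * cis t) = (\<lambda>t. \<i> * (poisson R (t - u) *\<^sub>R g (cis t)))"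
  proof
    fix t
    have 1: "cis t - a \<noteq> 0" using na R by (metis norm_cis order_less_irrefl right_minus_eq)
    have 2: "1 - of_real R * cis (u - t) = (cis t - a) * cis (- t)"
      by (simp add: a_def left_diff_distrib mult.assoc cis_mult)
    have 3: "1 - of_real R * cis (t - u) = 1 - cnj a * cis t"
      by (simp add: a_def cis_cnj mult.assoc cis_mult)
    have 4: "complex_of_real ((norm (1 - of_real R * cis (t - u)))\<^sup>2) = (1 - of_real R * cis (u - t)) * (1 - of_real R * cis (t - u))"
      by (subst complex_norm_square) (simp add: cis_cnj mult.commute)
    have 5: "complex_of_real (poisson R (t - u)) = of_real (1 - R\<^sup>2) / ((cis t - a) * cis (- t) * (1 - cnj a * cis t))"
      by (simp only: poisson_def of_real_divide 4) (simp only: 2 3)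
    show "k (cis t) / (cis t - a) * \<i> * cis t = \<i> * (poisson R (t - u) *\<^sub>R g (cis t))"
    proof -
      have 6: "cis t * cis (- t) = 1" by (simp add: cis_mult)
      hence 7: "inverse (cis (- t)) = cis t" by (metis inverse_unique mult.commute)
      show ?thesis
        unfolding scaleR_conv_of_real 5 k_def divide_inverse inverse_mult_distrib 7
        by (simp only: mult_ac)
    qed
  qed
  also have "integral {0..2 * pi} \<dots> = (2 * pi) *\<^sub>R (LINT t|circ. \<i> * (poisson R (t - u) *\<^sub>R g (cis t)))"
  proof (rule integral_circ)
    have "norm (1 - complex_of_real R * cis t) \<noteq> 0" for t
      using norm_one_minus_cis_ge[of R t] R by auto
    moreover have "continuous_on UNIV (\<lambda>t. g (cis t))"
      by (rule continuous_on_compose2[OF holomorphic_on_imp_continuous_on[OF hg]]) (auto intro!: continuous_intros)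
    ultimately show "continuous_on UNIV (\<lambda>t. \<i> * (poisson R (t - u) *\<^sub>R g (cis t)))"
      unfolding poisson_def by (intro continuous_intros) auto
  qed
  also have "\<dots> = 2 * of_real pi * \<i> * (LINT t|circ. poisson R (t - u) *\<^sub>R g (cis t))"
    by (simp add: scaleR_conv_of_real)
  finally have "k a = (LINT t|circ. poisson R (t - u) *\<^sub>R g (cis t))" by simp
  moreover have "k a = g a"
  proof -
    have "cnj a * a = of_real (R\<^sup>2)" using complex_norm_square[of a] na by (simp add: mult.commute)
    moreover have "1 - R\<^sup>2 \<noteq> 0" using R by (simp add: power2_eq_1_iff)
    hence "1 - (complex_of_real R)\<^sup>2 \<noteq> 0" by (metis of_real_power of_real_1 of_real_diff of_real_eq_0_iff)
    ultimately show ?thesis by (simp add: k_def)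
  qed
  ultimately show ?thesis by (simp add: a_def)
qed

lemma integral_poisson:
  assumes "0 \<le> R" "R < 1"
  shows "(LINT t|circ. poisson R (t - u)) = 1"
proof -
  have "(LINT t|circ. poisson R (t - u) *\<^sub>R (1::complex)) = 1"
    using Poisson_formula[of "\<lambda>_. 1" 2 R u] assms by simp
  hence "complex_of_real (LINT t|circ. poisson R (t - u)) = 1"
    by (simp add: scaleR_conv_of_real)
  thus ?thesis using of_real_eq_1_iff by blast
qed

lemma nn_integral_poisson:
  assumes "0 \<le> R" "R < 1"
  shows "(\<integral>\<^sup>+t. poisson R (t - u) \<partial>circ) = 1" "(\<integral>\<^sup>+t. poisson R (u - t) \<partial>circ) = 1"
proof -
  have "integrable circ (\<lambda>t. poisson R (t - u))"
    using poisson_le[OF assms] poisson_nonneg[OF assms]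
    by (intro integrable_circ_bounded[where B="2 / (1 - R)"]) auto
  thus 1: "(\<integral>\<^sup>+t. poisson R (t - u) \<partial>circ) = 1"
    using assms by (subst nn_integral_eq_integral) (auto simp: integral_poisson poisson_nonneg)
  show "(\<integral>\<^sup>+t. poisson R (u - t) \<partial>circ) = 1"
    using 1 poisson_minus[of R "_ - u"] by simp
qed

section \<open>Poisson majorants of powers of holomorphic functions\<close>

text \<open>The difference of the squares is \<open>(1 - \<bar>a\<bar>\<^sup>2) * (1 - \<bar>z\<bar>\<^sup>2)\<close>.\<close>

lemma norm_Blaschke_factor:
  assumes "norm z \<le> 1" "norm a \<le> 1"
  shows "norm (z - a) \<le> norm (1 - cnj a * z)"
proof -
  have "(norm (1 - cnj a * z))\<^sup>2 - (norm (z - a))\<^sup>2 = (1 - (norm a)\<^sup>2) * (1 - (norm z)\<^sup>2)"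
    unfolding cmod_power2 by (simp add: algebra_simps power2_eq_square)
  also have "\<dots> \<ge> 0" using assms by (intro mult_nonneg_nonneg) (auto simp: power_le_one)
  finally have "(norm (z - a))\<^sup>2 \<le> (norm (1 - cnj a * z))\<^sup>2" by simp
  thus ?thesis by (rule power2_le_imp_le) simp
qed

lemma norm_Blaschke_factor_circle:
  assumes "norm z = 1"
  shows "norm (z - a) = norm (1 - cnj a * z)"
proof -
  have "(norm (1 - cnj a * z))\<^sup>2 - (norm (z - a))\<^sup>2 = (1 - (norm a)\<^sup>2) * (1 - (norm z)\<^sup>2)"
    unfolding cmod_power2 by (simp add: algebra_simps power2_eq_square)
  hence "(norm (1 - cnj a * z))\<^sup>2 = (norm (z - a))\<^sup>2" using assms by simp
  from power2_eq_imp_eq[OF this norm_ge_zero norm_ge_zero] show ?thesis by (rule sym)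
qed

text \<open>A zero-free function has a holomorphic logarithm on a slightly larger disc, so its power of
  exponent \<open>c\<close> is the modulus of a holomorphic function, to which the Poisson formula applies.\<close>

lemma Poisson_majorant_nonvanishing:
  assumes g: "g holomorphic_on ball 0 S" "1 < S" and nz: "\<And>z. norm z \<le> 1 \<Longrightarrow> g z \<noteq> 0"
    and R: "0 \<le> R" "R < 1"
  shows "norm (g (of_real R * cis u)) powr c \<le> (LINT t|circ. poisson R (t - u) * norm (g (cis t)) powr c)"
proof -
  have "open (ball 0 S \<inter> g -` (- {0}))"
    using g by (intro continuous_open_preimage holomorphic_on_imp_continuous_on) auto
  moreover have "cball 0 1 \<subseteq> ball 0 S \<inter> g -` (- {0})" using nz g by auto
  ultimately obtain e where e: "e > 0" "(\<Union>x\<in>cball 0 1. ball x e) \<subseteq> ball 0 S \<inter> g -` (- {0})"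
    using compact_subset_open_imp_ball_epsilon_subset[OF compact_cball] by metis
  have sub: "ball 0 (1 + e) \<subseteq> (\<Union>x\<in>cball (0::complex) 1. ball x e)"
  proof
    fix z :: complex assume z: "z \<in> ball 0 (1 + e)"
    show "z \<in> (\<Union>x\<in>cball (0::complex) 1. ball x e)"
    proof (cases "norm z \<le> 1")
      case True thus ?thesis using e(1) by (intro UN_I[where a=z]) auto
    next
      case False
      hence n: "1 < norm z" by simp
      define w where "w = (1 / norm z) *\<^sub>R z"
      have "norm w = 1" using n by (auto simp: w_def)
      have "w - z = (1 / norm z - 1) *\<^sub>R z" by (simp add: w_def scaleR_diff_left)
      hence "dist w z = \<bar>1 / norm z - 1\<bar> * norm z" by (simp add: dist_norm)
      also have "1 / norm z \<le> 1" using n by (simp add: divide_le_eq_1)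
      hence "\<bar>1 / norm z - 1\<bar> = 1 - 1 / norm z" by linarith
      also have "(1 - 1 / norm z) * norm z = norm z - 1" using n by (auto simp: left_diff_distrib)
      finally have "z \<in> ball w e" using z by simp
      moreover have "w \<in> cball 0 1" using \<open>norm w = 1\<close> by simp
      ultimately show ?thesis by (rule UN_I[rotated])
    qed
  qed
  have nz': "g z \<noteq> 0" if "z \<in> ball 0 (1 + e)" for z 
  proof -
    have "z \<in> ball 0 S \<inter> g -` (- {0})" using subset_trans[OF sub e(2)] that by (rule subsetD)
    thus ?thesis by simp
  qed
  have g': "g holomorphic_on ball 0 (1 + e)"
    using subset_trans[OF sub e(2)] by (intro holomorphic_on_subset[OF g(1)]) simp
  obtain l where l: "l holomorphic_on ball 0 (1 + e)" "\<And>z. z \<in> ball 0 (1 + e) \<Longrightarrow> g z = exp (l z)"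
    using contractible_imp_holomorphic_log[OF g' convex_imp_contractible[OF convex_ball] nz'] by blast
  define G where "G = (\<lambda>z. exp (of_real c * l z))"
  have G: "G holomorphic_on ball 0 (1 + e)" unfolding G_def by (intro holomorphic_intros l)
  have nG: "norm (G z) = norm (g z) powr c" if "norm z \<le> 1" for z
  proof -
    have "norm (g z) = exp (Re (l z))" using l(2)[of z] that e(1) by simp
    thus ?thesis by (simp add: G_def powr_def)
  qed
  have "norm (g (of_real R * cis u)) powr c = norm (G (of_real R * cis u))"
    using R by (subst nG) (auto simp: norm_mult)
  also have "G (of_real R * cis u) = (LINT t|circ. poisson R (t - u) *\<^sub>R G (cis t))"
    using Poisson_formula[OF G _ R] e(1) by simp
  also have "norm \<dots> \<le> (LINT t|circ. norm (poisson R (t - u) *\<^sub>R G (cis t)))"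
    by (rule integral_norm_bound)
  also have "\<dots> = (LINT t|circ. poisson R (t - u) * norm (g (cis t)) powr c)"
    using R by (intro Bochner_Integration.integral_cong) (auto simp: nG poisson_nonneg)
  finally show ?thesis .
qed

text \<open>Induction on the number of zeros. Replacing the factors \<open>z - a\<close> of one zero \<open>a\<close> by
  \<open>1 - cnj a * z\<close> leaves the modulus on the circle unchanged, increases it inside, and removes that
  zero from the closed disc.\<close>

lemma Poisson_majorant:
  assumes "g holomorphic_on ball 0 S" "1 < S" and "\<And>z. norm z = 1 \<Longrightarrow> g z \<noteq> 0"
    and "0 \<le> R" "R < 1" and "0 < c"
  shows "norm (g (of_real R * cis u)) powr c \<le> (LINT t|circ. poisson R (t - u) * norm (g (cis t)) powr c)"
proof -
  have nc: "\<not> g constant_on ball 0 S" if "norm a \<le> 1" "g a = 0" "g holomorphic_on ball 0 S" "\<And>z. norm z = 1 \<Longrightarrow> g z \<noteq> 0" for g :: "complex \<Rightarrow> complex" and a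
  proof
    assume "g constant_on ball 0 S"
    then obtain k where k: "\<And>z. z \<in> ball 0 S \<Longrightarrow> g z = k" by (auto simp: constant_on_def)
    have "g 1 = g a" using k[of 1] k[of a] that \<open>1 < S\<close> by simp
    thus False using that by (metis norm_one)
  qed
  have fin: "finite {z \<in> cball 0 1. g z = 0}" if "g holomorphic_on ball 0 S" "\<And>z. norm z = 1 \<Longrightarrow> g z \<noteq> 0" for g :: "complex \<Rightarrow> complex"
  proof (cases "\<exists>a. norm a \<le> 1 \<and> g a = 0")
    case False
    hence "{z \<in> cball 0 1. g z = 0} = {}" by auto
    thus ?thesis by (simp only: finite.emptyI)
  next
    case True
    then obtain a where a: "norm a \<le> 1" "g a = 0" by blast
    show ?thesis
      by (rule holomorphic_compact_finite_zeros[OF that(1)]) (use nc[OF a that] \<open>1 < S\<close> in auto)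
  qed
  have "norm (g (of_real R * cis u)) powr c \<le> (LINT t|circ. poisson R (t - u) * norm (g (cis t)) powr c)"
    if "card {z \<in> cball 0 1. g z = 0} = n" "g holomorphic_on ball 0 S" "\<And>z. norm z = 1 \<Longrightarrow> g z \<noteq> 0" for g :: "complex \<Rightarrow> complex" and n
    using that
  proof (induction n arbitrary: g rule: less_induct)
    case (less n g)
    show ?case
    proof (cases "\<exists>a. norm a \<le> 1 \<and> g a = 0")
      case False
      thus ?thesis using less.prems assms by (intro Poisson_majorant_nonvanishing[where S=S]) auto
    next
      case True
      then obtain a where a: "norm a \<le> 1" "g a = 0" by blast
      with less.prems(3) have a1: "norm a < 1" by force
      have aS: "a \<in> ball 0 S" using a1 \<open>1 < S\<close> by simp
      have nca: "\<not> g constant_on ball 0 S" using nc[OF a less.prems(2)] less.prems(3) by blast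
      obtain gl d k where gl: "0 < (k::nat)" "0 < d" "ball a d \<subseteq> ball 0 S" "gl holomorphic_on ball a d"
        "\<And>w. w \<in> ball a d \<Longrightarrow> g w = (w - a) ^ k * gl w" "\<And>w. w \<in> ball a d \<Longrightarrow> gl w \<noteq> 0"
        by (rule holomorphic_factor_zero_nonconstant[OF less.prems(2) open_ball connected_ball aS a(2) nca]) (rule that)
      define g1 where "g1 = (\<lambda>z. if z = a then gl a else g z / (z - a) ^ k)"
      have eq1: "g1 z = gl z" if "z \<in> ball a d" for z
        using gl(5)[OF that] by (auto simp: g1_def)
      have gf: "g z = (z - a) ^ k * g1 z" if "z \<in> ball 0 S" for z
        using a gl(1) by (auto simp: g1_def power_0_left)
      have "g1 holomorphic_on (ball a d \<union> (ball 0 S - {a}))"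
      proof (rule holomorphic_on_Un)
        show "g1 holomorphic_on ball a d" by (rule holomorphic_transform[OF gl(4)]) (use eq1 in auto)
        have "(\<lambda>z. g z / (z - a) ^ k) holomorphic_on ball 0 S - {a}"
          by (intro holomorphic_intros holomorphic_on_subset[OF less.prems(2)]) auto
        thus "g1 holomorphic_on ball 0 S - {a}"
          by (rule holomorphic_transform) (auto simp: g1_def)
      qed auto
      hence hg1: "g1 holomorphic_on ball 0 S"
        by (rule holomorphic_on_subset) (use gl in auto)
      define h where "h = (\<lambda>z. (1 - cnj a * z) ^ k * g1 z)"
      have hh: "h holomorphic_on ball 0 S" unfolding h_def by (intro holomorphic_intros hg1)
      have le: "norm (g z) \<le> norm (h z)" if "norm z \<le> 1" for z
        using norm_Blaschke_factor[OF that a(1)] gf[of z] that \<open>1 < S\<close>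
        by (auto simp: h_def norm_mult norm_power intro!: mult_right_mono power_mono)
      have eq: "norm (g z) = norm (h z)" if "norm z = 1" for z
        using norm_Blaschke_factor_circle[OF that] gf[of z] that \<open>1 < S\<close>
        by (auto simp: h_def norm_mult norm_power)
      have "1 - cnj a * z \<noteq> 0" if "norm z \<le> 1" for z
      proof
        assume "1 - cnj a * z = 0"
        hence "1 = norm (cnj a * z)" by simp
        also have "\<dots> = norm a * norm z" by (simp add: norm_mult)
        also have "\<dots> \<le> norm a * 1" using that by (intro mult_left_mono) auto
        finally show False using a1 by simp
      qed
      hence h0: "h z = 0 \<longleftrightarrow> g1 z = 0" if "norm z \<le> 1" for z
        using that by (simp add: h_def)
      have "{z \<in> cball 0 1. h z = 0} \<subseteq> {z \<in> cball 0 1. g z = 0} - {a}"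
      proof
        fix z assume z: "z \<in> {z \<in> cball 0 1. h z = 0}"
        hence "g1 z = 0" using h0[of z] by simp
        moreover have "g1 a \<noteq> 0" using gl(2) gl(6)[of a] eq1[of a] by simp
        moreover have "g z = 0" using gf[of z] z \<open>g1 z = 0\<close> \<open>1 < S\<close> by simp
        ultimately show "z \<in> {z \<in> cball 0 1. g z = 0} - {a}" using z by auto
      qed
      also have "\<dots> \<subset> {z \<in> cball 0 1. g z = 0}" using a by auto
      finally have "card {z \<in> cball 0 1. h z = 0} < n"
        using less.prems fin[OF less.prems(2,3)] by (metis (no_types, lifting) psubset_card_mono)
      moreover have "h z \<noteq> 0" if "norm z = 1" for z using eq[OF that] less.prems(3)[OF that] by auto
      ultimately have "norm (h (of_real R * cis u)) powr c
          \<le> (LINT t|circ. poisson R (t - u) * norm (h (cis t)) powr c)"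
        using less.IH[OF _ refl hh] by blast
      moreover have "norm (g (of_real R * cis u)) powr c \<le> norm (h (of_real R * cis u)) powr c"
        using assms by (intro powr_mono2 le) (auto simp: norm_mult)
      ultimately show ?thesis by (simp add: eq)
    qed
  qed
  from this[OF refl assms(1,3)] show ?thesis .
qed

text \<open>Only finitely many zeros lie in a compact disc, so between \<open>r\<close> and one there is a radius \<open>r'\<close>
  whose circle is free of zeros.\<close>

lemma Poisson_majorant_disc:
  assumes f: "f holomorphic_on ball 0 1" and r: "0 < r" "r < 1"
  obtains r' where "r \<le> r'" "r' < 1"
    "\<And>R u c. \<lbrakk>0 \<le> R; R < r'; 0 < c\<rbrakk> \<Longrightarrow> norm (f (of_real R * cis u)) powr c
        \<le> (LINT t|circ. poisson (R / r') (t - u) * norm (f (of_real r' * cis t)) powr c)"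
proof (cases "\<forall>z\<in>ball 0 1. f z = 0")
  case True
  show ?thesis
  proof (rule that[of r])
    fix R u c :: real assume R: "0 \<le> R" "R < r" "0 < c"
    have "norm (of_real R * cis u) < 1" using R r by (simp add: norm_mult)
    hence "f (of_real R * cis u) = 0" using True by simp
    thus "norm (f (of_real R * cis u)) powr c
        \<le> (LINT t|circ. poisson (R / r) (t - u) * norm (f (of_real r * cis t)) powr c)"
      using R by (auto intro!: Bochner_Integration.integral_nonneg mult_nonneg_nonneg poisson_nonneg)
  qed (use r in auto)
next
  case False
  define Z where "Z = {z \<in> cball 0 ((1 + r) / 2). f z = 0}"
  have "finite Z"
  proof (cases "f constant_on ball 0 1")
    case True
    then obtain k where k: "\<And>z. z \<in> ball 0 1 \<Longrightarrow> f z = k" by (auto simp: constant_on_def)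
    have "Z = {}"
    proof (rule ccontr)
      assume "Z \<noteq> {}"
      then obtain z where "norm z \<le> (1 + r) / 2" "f z = 0" by (auto simp: Z_def)
      hence "k = 0" using k[of z] r by simp
      thus False using k False by auto
    qed
    thus ?thesis by simp
  next
    case False
    show ?thesis unfolding Z_def
      by (rule holomorphic_compact_finite_zeros[OF f]) (use r False in auto)
  qed
  hence "infinite ({r<..<(1 + r) / 2} - norm ` Z)"
    using r by (intro Diff_infinite_finite) (auto simp: infinite_Ioo_iff)
  hence "{r<..<(1 + r) / 2} - norm ` Z \<noteq> {}" by (rule infinite_imp_nonempty)
  then obtain r' where "r' \<in> {r<..<(1 + r) / 2} - norm ` Z" by blast
  hence r': "r < r'" "r' < (1 + r) / 2" "r' \<notin> norm ` Z"
    unfolding Diff_iff greaterThanLessThan_iff by blast+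
  define g where "g = (\<lambda>z. f (of_real r' * z))"
  have r'1: "0 < r'" "r' < 1" using r' r by auto
  have g: "g holomorphic_on ball 0 (1 / r')" unfolding g_def
    by (rule holomorphic_on_compose_gen[OF _ f, unfolded o_def])
       (use r'1 in \<open>auto intro!: holomorphic_intros simp: norm_mult field_simps\<close>)
  have gz: "g z \<noteq> 0" if "norm z = 1" for z
  proof
    assume "g z = 0"
    hence "of_real r' * z \<in> Z" using that r' r'1 by (simp add: Z_def g_def norm_mult)
    moreover have "norm (of_real r' * z) = r'" using that r'1 by (simp add: norm_mult)
    ultimately show False using r' by (metis image_eqI)
  qed
  show ?thesis
  proof (rule that[of r'])
    fix R u c :: real assume R: "0 \<le> R" "R < r'" "0 < c"
    have "norm (g (of_real (R / r') * cis u)) powr c \<le> (LINT t|circ. poisson (R / r') (t - u) * norm (g (cis t)) powr c)"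
      using R r'1 gz by (intro Poisson_majorant[OF g]) auto
    moreover have "complex_of_real r' * (of_real (R / r') * cis u) = of_real R * cis u" using r'1 by simp
    ultimately show "norm (f (of_real R * cis u)) powr c
        \<le> (LINT t|circ. poisson (R / r') (t - u) * norm (f (of_real r' * cis t)) powr c)"
      by (simp only: g_def)
  qed (use r' r'1 in auto)
qed

section \<open>Averaging kernels at all scales\<close>

text \<open>Lebesgue measure on \<open>(0, 1)\<close>, placed on the whole line. Its variable \<open>y\<close> is the distance to the
  unit circle.\<close>

definition unit_interval :: "real measure" where
  "unit_interval = uniform_measure lborel {0<..<1}"

lemma sets_unit_interval [measurable_cong, simp]: "sets unit_interval = sets borel"
  by (simp add: unit_interval_def)

lemma space_unit_interval [simp]: "space unit_interval = UNIV"
  by (simp add: unit_interval_def)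

lemma prob_space_unit_interval: "prob_space unit_interval"
  unfolding unit_interval_def by (rule prob_space_uniform_measure) auto

interpretation unit_interval: prob_space unit_interval
  by (rule prob_space_unit_interval)

interpretation circ2: pair_sigma_finite circ circ ..

interpretation circ_unit: pair_sigma_finite circ unit_interval ..

lemma nn_integral_unit:
  assumes [measurable]: "g \<in> borel_measurable borel"
  shows "(\<integral>\<^sup>+y. g y \<partial>unit_interval) = (\<integral>\<^sup>+y. g y * indicator {0<..<1} y \<partial>lborel)"
  unfolding unit_interval_def by (subst nn_integral_uniform_measure) (auto simp: divide_ennreal_def)

lemma AE_unit: "AE y in unit_interval. 0 < y \<and> y < 1"
  unfolding unit_interval_def by (rule AE_uniform_measureI) auto

lemma nn_integral_unit_powr_near_1:
  assumes "\<beta> < -1" "0 < a"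
  shows "(\<integral>\<^sup>+y. ennreal (y powr \<beta>) * indicator {a<..} y \<partial>unit_interval) \<le> ennreal (a powr (\<beta> + 1) / (- (\<beta> + 1)))"
proof -
  have "(\<integral>\<^sup>+y. ennreal (y powr \<beta>) * indicator {a<..} y \<partial>unit_interval)
      \<le> (\<integral>\<^sup>+y. ennreal (y powr \<beta>) * indicator {a..} y \<partial>lborel)"
    by (subst nn_integral_unit) (auto intro!: nn_integral_mono simp: indicator_def)
  also have "\<dots> = ennreal (- (a powr (\<beta> + 1)) / (\<beta> + 1))"
    using assms by (intro nn_integral_has_integral_lebesgue' has_integral_powr_to_inf) auto
  also have "- (a powr (\<beta> + 1)) / (\<beta> + 1) = a powr (\<beta> + 1) / (- (\<beta> + 1))"
    by (simp only: minus_divide_left[symmetric] minus_divide_right)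
  finally show ?thesis .
qed

lemma nn_integral_unit_powr_near_0:
  assumes "-1 < \<beta>" "0 < a"
  shows "(\<integral>\<^sup>+y. ennreal (y powr \<beta>) * indicator {..a} y \<partial>unit_interval) \<le> ennreal (a powr (\<beta> + 1) / (\<beta> + 1))"
proof -
  have "(\<integral>\<^sup>+y. ennreal (y powr \<beta>) * indicator {..a} y \<partial>unit_interval)
      \<le> (\<integral>\<^sup>+y. ennreal (y powr \<beta>) * indicator {0..a} y \<partial>lborel)"
    by (subst nn_integral_unit) (auto intro!: nn_integral_mono simp: indicator_def)
  also have "\<dots> = ennreal (a powr (\<beta> + 1) / (\<beta> + 1))"
    using assms by (intro nn_integral_has_integral_lebesgue' has_integral_powr_from_0) auto
  finally show ?thesis by simp
qed

definition kernel_avg :: "(real \<Rightarrow> real \<Rightarrow> real) \<Rightarrow> (real \<Rightarrow> real) \<Rightarrow> real \<Rightarrow> real" where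
  "kernel_avg K \<phi> x = (LINT t|circ. K x t * \<phi> t)"

text \<open>The properties of a Poisson kernel that the estimates use. A kernel at distance \<open>y\<close> from the
  circle has \<open>M\<close> of order \<open>1 / y\<close>.\<close>

locale averaging_kernel =
  fixes K :: "real \<Rightarrow> real \<Rightarrow> real" and M :: real
  assumes meas [measurable]: "(\<lambda>(x, t). K x t) \<in> borel_measurable (borel \<Otimes>\<^sub>M borel)"
    and nonneg: "\<And>x t. 0 \<le> K x t"
    and le: "\<And>x t. K x t \<le> M"
    and mass1: "\<And>x. (\<integral>\<^sup>+t. K x t \<partial>circ) \<le> 1"
    and mass2: "\<And>t. (\<integral>\<^sup>+x. K x t \<partial>circ) \<le> 1"
begin

lemma kernel_measurable [measurable]: "K x \<in> borel_measurable borel"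
proof -
  have "(\<lambda>t. (\<lambda>(x, t). K x t) (x, t)) \<in> borel_measurable borel" by measurable
  thus ?thesis by simp
qed

lemma integrable:
  assumes [measurable]: "\<phi> \<in> borel_measurable borel" and "\<And>t. 0 \<le> \<phi> t" "\<And>t. \<phi> t \<le> B"
  shows "integrable circ (\<lambda>t. K x t * \<phi> t)"
proof (rule integrable_circ_bounded[where B="M * B"])
  show "norm (K x t * \<phi> t) \<le> M * B" for t
    using assms(2,3)[of t] nonneg[of x t] le[of x t]
    by (auto simp: abs_mult intro!: mult_mono)
qed measurable

lemma nn_integral_eq:
  assumes [measurable]: "\<phi> \<in> borel_measurable borel" and "\<And>t. 0 \<le> \<phi> t" "\<And>t. \<phi> t \<le> B"
  shows "(\<integral>\<^sup>+t. ennreal (K x t * \<phi> t) \<partial>circ) = ennreal (kernel_avg K \<phi> x)"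
  unfolding kernel_avg_def
  using assms(2) nonneg by (intro nn_integral_eq_integral integrable[OF assms]) (auto intro!: AE_I2)

lemma kernel_avg_nonneg: "(\<And>t. 0 \<le> \<phi> t) \<Longrightarrow> 0 \<le> kernel_avg K \<phi> x"
  unfolding kernel_avg_def using nonneg by (intro Bochner_Integration.integral_nonneg) auto

lemma kernel_avg_le_sup:
  assumes [measurable]: "\<phi> \<in> borel_measurable borel" and "\<And>t. 0 \<le> \<phi> t" "\<And>t. \<phi> t \<le> B"
  shows "kernel_avg K \<phi> x \<le> B"
proof -
  have B: "0 \<le> B" using assms(2,3)[of 0] by linarith
  have "ennreal (kernel_avg K \<phi> x) \<le> (\<integral>\<^sup>+t. ennreal B * ennreal (K x t) \<partial>circ)"
    unfolding nn_integral_eq[OF assms, symmetric] using assms nonneg B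
    by (intro nn_integral_mono) (simp add: ennreal_mult'[symmetric] mult.commute mult_left_mono mult_right_mono)
  also have "\<dots> \<le> ennreal B * 1"
    using mass1[of x] by (subst nn_integral_cmult) (auto intro!: mult_left_mono simp del: mult_1_right)
  finally show ?thesis using B by (simp add: ennreal_le_iff)
qed

lemma kernel_avg_le_mean:
  assumes [measurable]: "\<phi> \<in> borel_measurable borel" and "\<And>t. 0 \<le> \<phi> t" "\<And>t. \<phi> t \<le> B"
  shows "ennreal (kernel_avg K \<phi> x) \<le> ennreal M * (\<integral>\<^sup>+t. \<phi> t \<partial>circ)"
proof -
  have "ennreal (kernel_avg K \<phi> x) \<le> (\<integral>\<^sup>+t. ennreal M * ennreal (\<phi> t) \<partial>circ)"
    unfolding nn_integral_eq[OF assms, symmetric] using assms nonneg le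
    by (intro nn_integral_mono) (auto simp: ennreal_mult''[symmetric] intro!: ennreal_leI mult_right_mono)
  also have "\<dots> = ennreal M * (\<integral>\<^sup>+t. \<phi> t \<partial>circ)"
    by (subst nn_integral_cmult) auto
  finally show ?thesis .
qed

lemma kernel_avg_measurable [measurable]:
  assumes [measurable]: "\<phi> \<in> borel_measurable borel"
  shows "kernel_avg K \<phi> \<in> borel_measurable borel"
  unfolding kernel_avg_def by (rule circ.borel_measurable_lebesgue_integral) measurable

text \<open>Integrate Young's inequality \<open>\<phi> t * a\<^bsup>s - 1\<^esup> \<le> \<phi> t\<^sup>s / s + a\<^sup>s (1 - 1 / s)\<close> against the kernel, for \<open>a\<close> equal
  to the average itself.\<close>

lemma Jensen:
  assumes [measurable]: "\<phi> \<in> borel_measurable borel" and \<phi>: "\<And>t. 0 \<le> \<phi> t" "\<And>t. \<phi> t \<le> B"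
    and s: "1 < s"
  shows "kernel_avg K \<phi> x powr s \<le> kernel_avg K (\<lambda>t. \<phi> t powr s) x"
proof -
  define a where "a = kernel_avg K \<phi> x"
  have a0: "0 \<le> a" unfolding a_def by (rule kernel_avg_nonneg[OF \<phi>(1)])
  have pB: "\<phi> t powr s \<le> B powr s" for t using \<phi> s by (intro powr_mono2) auto
  have int: "integrable circ (\<lambda>t. K x t * \<phi> t powr s)"
    by (rule integrable[where B="B powr s"]) (use pB in auto)
  have int1: "integrable circ (K x)"
    by (rule integrable_circ_bounded[where B=M]) (use nonneg le in auto)
  have m: "(LINT t|circ. K x t) \<le> 1"
  proof -
    have "ennreal (LINT t|circ. K x t) \<le> 1"
      using mass1[of x] by (subst (asm) nn_integral_eq_integral[OF int1]) (use nonneg in auto)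
    thus ?thesis by (simp add: ennreal_le_1)
  qed
  show ?thesis
  proof (cases "a = 0")
    case True
    thus ?thesis using s kernel_avg_nonneg[of "\<lambda>t. \<phi> t powr s" x] by (simp add: a_def[symmetric])
  next
    case False
    hence a: "a > 0" using a0 by simp
    define s' where "s' = s / (s - 1)"
    have s': "1 < s'" "1 / s + 1 / s' = 1" using s by (auto simp: s'_def field_simps)
    have "a powr s = a * a powr (s - 1)" using a by (simp add: powr_mult_base)
    also have "\<dots> = (LINT t|circ. K x t * \<phi> t) * a powr (s - 1)" by (simp add: a_def kernel_avg_def)
    also have "\<dots> = (LINT t|circ. K x t * (\<phi> t * a powr (s - 1)))"
      by (simp add: mult.assoc[symmetric])
    also have "\<dots> \<le> (LINT t|circ. K x t * \<phi> t powr s / s + a powr s / s' * K x t)"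
    proof (rule integral_mono)
      show "integrable circ (\<lambda>t. K x t * (\<phi> t * a powr (s - 1)))"
        using integrable[OF assms(1) \<phi>, of x] by (simp add: mult.assoc[symmetric])
      show "integrable circ (\<lambda>t. K x t * \<phi> t powr s / s + a powr s / s' * K x t)"
        using int int1 by auto
      fix t
      have "\<phi> t * a powr (s - 1) \<le> \<phi> t powr s / s + (a powr (s - 1)) powr s' / s'"
        using s s' \<phi> by (intro Youngs_inequality) auto
      also have "(a powr (s - 1)) powr s' = a powr s" using s by (simp add: powr_powr s'_def)
      finally have "K x t * (\<phi> t * a powr (s - 1)) \<le> K x t * (\<phi> t powr s / s + a powr s / s')"
        using nonneg by (rule mult_left_mono)
      thus "K x t * (\<phi> t * a powr (s - 1)) \<le> K x t * \<phi> t powr s / s + a powr s / s' * K x t"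
        by (simp add: algebra_simps)
    qed
    also have "\<dots> = kernel_avg K (\<lambda>t. \<phi> t powr s) x / s + a powr s / s' * (LINT t|circ. K x t)"
      using int int1 by (simp add: kernel_avg_def)
    also have "\<dots> \<le> kernel_avg K (\<lambda>t. \<phi> t powr s) x / s + a powr s / s' * 1"
      using m s' by (intro add_left_mono mult_left_mono) auto
    also have "1 / s' = 1 - 1 / s" using s' by simp
    hence "a powr s * (1 / s') = a powr s * (1 - 1 / s)" by simp
    hence "a powr s / s' * 1 = a powr s - a powr s / s" by (simp add: right_diff_distrib)
    finally have "a powr s / s \<le> kernel_avg K (\<lambda>t. \<phi> t powr s) x / s" by simp
    thus ?thesis using s by (simp add: a_def divide_le_cancel)
  qed
qed

lemma nn_integral_kernel_avg_le:
  assumes [measurable]: "\<phi> \<in> borel_measurable borel" and \<phi>: "\<And>t. 0 \<le> \<phi> t" "\<And>t. \<phi> t \<le> B"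
  shows "(\<integral>\<^sup>+x. kernel_avg K \<phi> x \<partial>circ) \<le> (\<integral>\<^sup>+t. \<phi> t \<partial>circ)"
proof -
  have "(\<integral>\<^sup>+x. kernel_avg K \<phi> x \<partial>circ) = (\<integral>\<^sup>+x. \<integral>\<^sup>+t. ennreal (\<phi> t) * ennreal (K x t) \<partial>circ \<partial>circ)"
    using \<phi> nonneg by (simp add: nn_integral_eq[OF assms, symmetric] ennreal_mult mult.commute)
  also have "\<dots> = (\<integral>\<^sup>+t. \<integral>\<^sup>+x. ennreal (\<phi> t) * ennreal (K x t) \<partial>circ \<partial>circ)"
    by (rule circ2.Fubini') measurable
  also have "\<dots> = (\<integral>\<^sup>+t. ennreal (\<phi> t) * (\<integral>\<^sup>+x. ennreal (K x t) \<partial>circ) \<partial>circ)"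
    by (intro nn_integral_cong nn_integral_cmult) measurable
  also have "\<dots> \<le> (\<integral>\<^sup>+t. ennreal (\<phi> t) * 1 \<partial>circ)"
    by (intro nn_integral_mono mult_left_mono mass2) auto
  finally show ?thesis by simp
qed

lemma nn_integral_kernel_avg_powr_le:
  assumes [measurable]: "\<phi> \<in> borel_measurable borel" and \<phi>: "\<And>t. 0 \<le> \<phi> t" "\<And>t. \<phi> t \<le> B"
    and s: "1 < s"
  shows "(\<integral>\<^sup>+x. kernel_avg K \<phi> x powr s \<partial>circ) \<le> (\<integral>\<^sup>+t. \<phi> t powr s \<partial>circ)"
proof -
  have "(\<integral>\<^sup>+x. kernel_avg K \<phi> x powr s \<partial>circ) \<le> (\<integral>\<^sup>+x. kernel_avg K (\<lambda>t. \<phi> t powr s) x \<partial>circ)"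
    by (intro nn_integral_mono ennreal_leI Jensen[OF assms])
  also have "\<dots> \<le> (\<integral>\<^sup>+t. \<phi> t powr s \<partial>circ)"
    using \<phi> s by (intro nn_integral_kernel_avg_le[where B="B powr s"]) (auto intro!: powr_mono2)
  finally show ?thesis .
qed

lemma kernel_avg_add:
  assumes [measurable]: "\<phi> \<in> borel_measurable borel" "\<psi> \<in> borel_measurable borel"
   and "\<And>t. 0 \<le> \<phi> t" "\<And>t. \<phi> t \<le> B" "\<And>t. 0 \<le> \<psi> t" "\<And>t. \<psi> t \<le> B"
  shows "kernel_avg K (\<lambda>t. \<phi> t + \<psi> t) x = kernel_avg K \<phi> x + kernel_avg K \<psi> x"
  unfolding kernel_avg_def distrib_left
  by (intro Bochner_Integration.integral_add integrable[where B=B] assms)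

end

text \<open>For a function whose \<open>l\<close>-th power has integral at most one, its averages at scale
  \<open>y\<close> are at most a constant times \<open>y powr (- 1 / l)\<close>; the function is cut at this height.\<close>

definition low_part :: "real \<Rightarrow> real \<Rightarrow> (real \<Rightarrow> real) \<Rightarrow> real \<Rightarrow> real" where
  "low_part l y \<phi> t = (if y * \<phi> t powr l \<le> 1 then \<phi> t else 0)"

definition high_part :: "real \<Rightarrow> real \<Rightarrow> (real \<Rightarrow> real) \<Rightarrow> real \<Rightarrow> real" where
  "high_part l y \<phi> t = (if y * \<phi> t powr l \<le> 1 then 0 else \<phi> t)"

lemma low_measurable [measurable (raw)]:
  assumes [measurable]: "\<phi> \<in> borel_measurable borel" "f \<in> borel_measurable N" "g \<in> borel_measurable N"
  shows "(\<lambda>z. low_part l (f z) \<phi> (g z)) \<in> borel_measurable N"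
  unfolding low_part_def by measurable

lemma high_measurable [measurable (raw)]:
  assumes [measurable]: "\<phi> \<in> borel_measurable borel" "f \<in> borel_measurable N" "g \<in> borel_measurable N"
  shows "(\<lambda>z. high_part l (f z) \<phi> (g z)) \<in> borel_measurable N"
  unfolding high_part_def by measurable

lemma low_le:
  assumes "0 < l" "0 < y" "0 \<le> \<phi> t"
  shows "low_part l y \<phi> t \<le> y powr (- 1 / l)"
proof (cases "y * \<phi> t powr l \<le> 1")
  case True
  hence "\<phi> t powr l \<le> y powr (-1)" using assms by (simp add: powr_minus field_simps)
  hence "(\<phi> t powr l) powr (1 / l) \<le> (y powr (-1)) powr (1 / l)"
    using assms by (intro powr_mono2) auto
  moreover have "(y powr (-1)) powr (1 / l) = y powr (- 1 / l)" unfolding powr_powr by simp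
  moreover have "(\<phi> t powr l) powr (1 / l) = \<phi> t" using assms by (simp add: powr_powr)
  ultimately show ?thesis using True by (simp add: low_part_def)
qed (simp add: low_part_def)

lemma high_le:
  assumes "1 < l" "0 < y" "0 \<le> \<phi> t"
  shows "high_part l y \<phi> t \<le> y powr (1 - 1 / l) * \<phi> t powr l"
proof (cases "y * \<phi> t powr l \<le> 1")
  case False
  hence p: "\<phi> t > 0" using assms by (cases "\<phi> t = 0") auto
  have "1 powr (1 - 1 / l) \<le> (y * \<phi> t powr l) powr (1 - 1 / l)"
    using False assms by (intro powr_mono2) auto
  hence "1 \<le> y powr (1 - 1 / l) * \<phi> t powr (l - 1)"
    using assms by (simp add: powr_mult powr_powr algebra_simps)
  hence "\<phi> t * 1 \<le> \<phi> t * (y powr (1 - 1 / l) * \<phi> t powr (l - 1))"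
    using p by (intro mult_left_mono) auto
  also have "\<dots> = y powr (1 - 1 / l) * \<phi> t powr l"
    using p by (simp add: powr_diff)
  finally show ?thesis using False by (simp add: high_part_def)
qed (simp add: high_part_def)

lemma powr_add_le:
  assumes "0 \<le> a" "0 \<le> b" "0 < s"
  shows "(a + b) powr s \<le> 2 powr s * (a powr s + b powr (s::real))"
proof -
  have "(a + b) powr s \<le> (2 * max a b) powr s" using assms by (intro powr_mono2) auto
  also have "\<dots> = 2 powr s * max a b powr s" using assms by (simp add: powr_mult)
  also have "\<dots> \<le> 2 powr s * (a powr s + b powr s)"
    by (intro mult_left_mono) (auto simp: max_def)
  finally show ?thesis .
qed

lemma powr_interpolate:
  fixes a m r s :: real
  assumes "0 \<le> a" "a \<le> m" "0 < r" "r \<le> s"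
  shows "a powr s \<le> m powr (s - r) * a powr r"
proof -
  have "a powr s = a powr (s - r) * a powr r"
    by (simp only: powr_add[symmetric] diff_add_cancel)
  also have "\<dots> \<le> m powr (s - r) * a powr r"
    using assms by (intro mult_right_mono powr_mono2) auto
  finally show ?thesis .
qed

text \<open>A kernel at scale \<open>y\<close> together with a function that is normalised in \<open>L\<^sup>l\<close>. The bound
  \<open>B\<close> makes all averages finite.\<close>

locale averaging_kernel_scale = averaging_kernel K "C / y" for K C y +
  fixes l :: real and \<phi> :: "real \<Rightarrow> real" and B :: real
  assumes y: "0 < y" and C: "0 < C" and l: "1 < l"
    and \<phi>_meas [measurable]: "\<phi> \<in> borel_measurable borel"
    and \<phi>_nonneg: "\<And>t. 0 \<le> \<phi> t" and \<phi>_le: "\<And>t. \<phi> t \<le> B"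
    and \<phi>_norm: "(\<integral>\<^sup>+t. \<phi> t powr l \<partial>circ) \<le> 1"
begin

lemma low_bounds: "0 \<le> low_part l y \<phi> t" "low_part l y \<phi> t \<le> B"
  and high_bounds: "0 \<le> high_part l y \<phi> t" "high_part l y \<phi> t \<le> B"
  using \<phi>_nonneg[of t] \<phi>_le[of t] by (auto simp: low_part_def high_part_def)

lemma kernel_avg_split:
  "kernel_avg K \<phi> x = kernel_avg K (low_part l y \<phi>) x + kernel_avg K (high_part l y \<phi>) x"
proof -
  have "\<phi> = (\<lambda>t. low_part l y \<phi> t + high_part l y \<phi> t)" by (auto simp: low_part_def high_part_def)
  hence "kernel_avg K \<phi> x = kernel_avg K (\<lambda>t. low_part l y \<phi> t + high_part l y \<phi> t) x" by simp
  also have "\<dots> = kernel_avg K (low_part l y \<phi>) x + kernel_avg K (high_part l y \<phi>) x"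
    by (rule kernel_avg_add[where B=B]) (use low_bounds high_bounds in auto)
  finally show ?thesis .
qed

lemma kernel_avg_low_le: "kernel_avg K (low_part l y \<phi>) x \<le> y powr (- 1 / l)"
  using l y \<phi>_nonneg low_bounds by (intro kernel_avg_le_sup low_le) auto

lemma kernel_avg_high_le: "kernel_avg K (high_part l y \<phi>) x \<le> C * y powr (- 1 / l)"
proof -
  have "ennreal (kernel_avg K (high_part l y \<phi>) x) \<le> ennreal (C / y) * (\<integral>\<^sup>+t. high_part l y \<phi> t \<partial>circ)"
    using high_bounds by (intro kernel_avg_le_mean[where B=B]) auto
  also have "(\<integral>\<^sup>+t. high_part l y \<phi> t \<partial>circ) \<le> (\<integral>\<^sup>+t. ennreal (y powr (1 - 1 / l)) * ennreal (\<phi> t powr l) \<partial>circ)"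
    using high_le[OF l y] \<phi>_nonneg by (intro nn_integral_mono) (auto simp: ennreal_mult[symmetric] intro!: ennreal_leI)
  also have "\<dots> = ennreal (y powr (1 - 1 / l)) * (\<integral>\<^sup>+t. ennreal (\<phi> t powr l) \<partial>circ)"
    by (rule nn_integral_cmult) auto
  also have "\<dots> \<le> ennreal (y powr (1 - 1 / l)) * 1"
    using \<phi>_norm by (intro mult_left_mono) auto
  finally have "ennreal (kernel_avg K (high_part l y \<phi>) x) \<le> ennreal (C / y) * ennreal (y powr (1 - 1 / l))"
    by (simp add: mult_left_mono)
  also have "\<dots> = ennreal (C * y powr (- 1 / l))"
    using y C by (simp add: ennreal_mult'[symmetric] powr_diff powr_minus field_simps)
  finally show ?thesis using C by (simp add: ennreal_le_iff)
qed

lemma kernel_avg_sup: "kernel_avg K \<phi> x \<le> (C + 1) * y powr (- 1 / l)"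
  using kernel_avg_low_le[of x] kernel_avg_high_le[of x] unfolding kernel_avg_split by (simp add: algebra_simps)

text \<open>Interpolation between the supremum bound and the contraction property on \<open>L\<^sup>l\<close>.\<close>

lemma kernel_avg_norm_le:
  assumes s: "l < s"
  shows "(\<integral>\<^sup>+x. kernel_avg K \<phi> x powr s \<partial>circ) \<le> ennreal ((C + 1) powr (s - l) * y powr (1 - s / l))"
proof -
  define m where "m = (C + 1) * y powr (- 1 / l)"
  have "(\<integral>\<^sup>+x. kernel_avg K \<phi> x powr s \<partial>circ) \<le> (\<integral>\<^sup>+x. ennreal (m powr (s - l)) * ennreal (kernel_avg K \<phi> x powr l) \<partial>circ)"
    using l s kernel_avg_sup kernel_avg_nonneg[OF \<phi>_nonneg]
    by (intro nn_integral_mono) (auto simp: ennreal_mult'[symmetric] m_def intro!: ennreal_leI powr_interpolate)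
  also have "\<dots> = ennreal (m powr (s - l)) * (\<integral>\<^sup>+x. ennreal (kernel_avg K \<phi> x powr l) \<partial>circ)"
    by (rule nn_integral_cmult) auto
  also have "\<dots> \<le> ennreal (m powr (s - l)) * 1"
    using order_trans[OF nn_integral_kernel_avg_powr_le[OF \<phi>_meas \<phi>_nonneg \<phi>_le l] \<phi>_norm]
    by (intro mult_left_mono) auto
  also have "m powr (s - l) = (C + 1) powr (s - l) * y powr (1 - s / l)"
  proof -
    have "m powr (s - l) = (C + 1) powr (s - l) * y powr ((- 1 / l) * (s - l))"
      using C by (simp only: m_def powr_mult powr_powr powr_ge_zero less_imp_le add_nonneg_nonneg zero_le_one)
    also have "(- 1 / l) * (s - l) = 1 - s / l" using l by (simp add: field_simps)
    finally show ?thesis .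
  qed
  finally show ?thesis by simp
qed

text \<open>The low part is estimated by Jensen's inequality. For the high part the supremum bound is used on all
  but one factor, which leaves its \<open>L\<^sup>1\<close> norm.\<close>

lemma kernel_avg_split_le:
  assumes s: "l < s"
  shows "(\<integral>\<^sup>+x. kernel_avg K \<phi> x powr s \<partial>circ) \<le> ennreal (2 powr s) *
    ((\<integral>\<^sup>+t. low_part l y \<phi> t powr s \<partial>circ) + ennreal (C powr (s - 1) * y powr (- (s - 1) / l)) * (\<integral>\<^sup>+t. high_part l y \<phi> t \<partial>circ))"
proof -
  define m where "m = C * y powr (- 1 / l)"
  have m: "m powr (s - 1) = C powr (s - 1) * y powr (- (s - 1) / l)"
  proof -
    have "m powr (s - 1) = C powr (s - 1) * y powr ((- 1 / l) * (s - 1))"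
      using C by (simp only: m_def powr_mult powr_powr powr_ge_zero less_imp_le)
    also have "(- 1 / l) * (s - 1) = - (s - 1) / l" using l by (simp add: field_simps)
    finally show ?thesis .
  qed
  have "(\<integral>\<^sup>+x. kernel_avg K \<phi> x powr s \<partial>circ) \<le>
    (\<integral>\<^sup>+x. ennreal (2 powr s) * (ennreal (kernel_avg K (low_part l y \<phi>) x powr s) + ennreal (m powr (s - 1)) * ennreal (kernel_avg K (high_part l y \<phi>) x)) \<partial>circ)"
  proof (rule nn_integral_mono)
    fix x
    have nn: "0 \<le> kernel_avg K (low_part l y \<phi>) x" "0 \<le> kernel_avg K (high_part l y \<phi>) x"
      using low_bounds high_bounds by (auto intro!: kernel_avg_nonneg)
    have "kernel_avg K \<phi> x powr s \<le> 2 powr s * (kernel_avg K (low_part l y \<phi>) x powr s + kernel_avg K (high_part l y \<phi>) x powr s)"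
      unfolding kernel_avg_split using nn s l by (intro powr_add_le) auto
    also have "kernel_avg K (high_part l y \<phi>) x powr s \<le> m powr (s - 1) * kernel_avg K (high_part l y \<phi>) x powr 1"
      using nn s l kernel_avg_high_le by (intro powr_interpolate) (auto simp: m_def)
    finally have "kernel_avg K \<phi> x powr s \<le> 2 powr s * (kernel_avg K (low_part l y \<phi>) x powr s + m powr (s - 1) * kernel_avg K (high_part l y \<phi>) x)"
      using nn by (simp add: mult_left_mono)
    thus "ennreal (kernel_avg K \<phi> x powr s) \<le> ennreal (2 powr s) * (ennreal (kernel_avg K (low_part l y \<phi>) x powr s) + ennreal (m powr (s - 1)) * ennreal (kernel_avg K (high_part l y \<phi>) x))"
      using nn by (simp add: ennreal_mult'[symmetric] ennreal_plus[symmetric] del: ennreal_plus)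
  qed
  also have "\<dots> = ennreal (2 powr s) * ((\<integral>\<^sup>+x. kernel_avg K (low_part l y \<phi>) x powr s \<partial>circ) + ennreal (m powr (s - 1)) * (\<integral>\<^sup>+x. kernel_avg K (high_part l y \<phi>) x \<partial>circ))"
    by (simp add: nn_integral_cmult nn_integral_add)
  also have "\<dots> \<le> ennreal (2 powr s) * ((\<integral>\<^sup>+t. low_part l y \<phi> t powr s \<partial>circ) + ennreal (m powr (s - 1)) * (\<integral>\<^sup>+t. high_part l y \<phi> t \<partial>circ))"
    using s l low_bounds high_bounds
    by (intro mult_left_mono add_mono nn_integral_kernel_avg_powr_le[where B=B] nn_integral_kernel_avg_le[where B=B]) auto
  finally show ?thesis unfolding m .
qed

end

text \<open>For fixed \<open>t\<close> the low part at scale \<open>y\<close> is present exactly for \<open>y \<le> \<phi> t powr (- l)\<close>, and there the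
  power of \<open>y\<close> is integrable at zero because \<open>l < s\<close>.\<close>

lemma nn_integral_low:
  assumes l: "1 < l" "l < s" and [measurable]: "\<phi> \<in> borel_measurable borel" and \<phi>: "0 \<le> \<phi> t"
  shows "(\<integral>\<^sup>+y. ennreal (y powr (s / l - 2)) * ennreal (low_part l y \<phi> t powr s) \<partial>unit_interval) \<le> ennreal (\<phi> t powr l / (s / l - 1))"
proof (cases "\<phi> t = 0")
  case True thus ?thesis using l by (simp add: low_part_def)
next
  case False
  define a where "a = \<phi> t powr (- l)"
  have p: "\<phi> t > 0" using False \<phi> by simp
  have eq: "low_part l y \<phi> t powr s = \<phi> t powr s * indicator {..a} y" for y
    using p l by (auto simp: low_part_def a_def indicator_def powr_minus field_simps)
  have "(\<integral>\<^sup>+y. ennreal (y powr (s / l - 2)) * ennreal (low_part l y \<phi> t powr s) \<partial>unit_interval)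
      = (\<integral>\<^sup>+y. ennreal (\<phi> t powr s) * (ennreal (y powr (s / l - 2)) * indicator {..a} y) \<partial>unit_interval)"
    unfolding eq by (intro nn_integral_cong) (auto simp: indicator_def mult.commute)
  also have "\<dots> = ennreal (\<phi> t powr s) * (\<integral>\<^sup>+y. (ennreal (y powr (s / l - 2)) * indicator {..a} y) \<partial>unit_interval)"
    by (rule nn_integral_cmult) auto
  also have "\<dots> \<le> ennreal (\<phi> t powr s) * ennreal (a powr (s / l - 2 + 1) / (s / l - 2 + 1))"
    using l p by (intro mult_left_mono nn_integral_unit_powr_near_0) (auto simp: a_def field_simps)
  also have "\<dots> = ennreal (\<phi> t powr l / (s / l - 1))"
  proof -
    have "\<phi> t powr s * a powr (s / l - 1) = \<phi> t powr (s + (- l) * (s / l - 1))"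
      unfolding a_def powr_powr powr_add ..
    also have "s + (- l) * (s / l - 1) = l" using l by (simp add: field_simps)
    finally show ?thesis using l by (simp add: ennreal_mult'[symmetric])
  qed
  finally show ?thesis .
qed

text \<open>Here the condition is \<open>y > \<phi> t powr (- l)\<close>, and the power of \<open>y\<close> has exponent below \<open>- 1\<close>.\<close>

lemma nn_integral_high:
  assumes l: "1 < l" and [measurable]: "\<phi> \<in> borel_measurable borel" and \<phi>: "0 \<le> \<phi> t"
  shows "(\<integral>\<^sup>+y. ennreal (y powr (1 / l - 2)) * ennreal (high_part l y \<phi> t) \<partial>unit_interval) \<le> ennreal (\<phi> t powr l / (1 - 1 / l))"
proof (cases "\<phi> t = 0")
  case True thus ?thesis using l by (simp add: high_part_def)
next
  case False
  define a where "a = \<phi> t powr (- l)"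
  have p: "\<phi> t > 0" using False \<phi> by simp
  have eq: "high_part l y \<phi> t = \<phi> t * indicator {a<..} y" for y
    using p l by (auto simp: high_part_def a_def indicator_def powr_minus field_simps)
  have "(\<integral>\<^sup>+y. ennreal (y powr (1 / l - 2)) * ennreal (high_part l y \<phi> t) \<partial>unit_interval)
      = (\<integral>\<^sup>+y. ennreal (\<phi> t) * (ennreal (y powr (1 / l - 2)) * indicator {a<..} y) \<partial>unit_interval)"
    unfolding eq by (intro nn_integral_cong) (auto simp: indicator_def mult.commute)
  also have "\<dots> = ennreal (\<phi> t) * (\<integral>\<^sup>+y. (ennreal (y powr (1 / l - 2)) * indicator {a<..} y) \<partial>unit_interval)"
    by (rule nn_integral_cmult) auto
  also have "\<dots> \<le> ennreal (\<phi> t) * ennreal (a powr (1 / l - 2 + 1) / (- (1 / l - 2 + 1)))"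
    using l p by (intro mult_left_mono nn_integral_unit_powr_near_1) (auto simp: a_def field_simps)
  also have "\<dots> = ennreal (\<phi> t powr l / (1 - 1 / l))"
  proof -
    have "\<phi> t * a powr (1 / l - 1) = \<phi> t powr 1 * \<phi> t powr ((- l) * (1 / l - 1))"
      using p unfolding a_def powr_powr by simp
    also have "\<dots> = \<phi> t powr (1 + (- l) * (1 / l - 1))" by (simp only: powr_add)
    also have "1 + (- l) * (1 / l - 1) = l" using l by (simp add: field_simps)
    finally show ?thesis using l p by (simp add: ennreal_mult'[symmetric])
  qed
  finally show ?thesis .
qed

text \<open>The weighted embedding of Hardy and Littlewood: averages of an \<open>L\<^sup>l\<close> function, taken over all
  scales, lie in \<open>L\<^sup>s\<close> for the weight \<open>y\<^bsup>s/l - 2\<^esup>\<close>. After the cut at height \<open>y powr (- 1 / l)\<close>, the order of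
  integration is exchanged so that the integral over the scales comes first; both parts then give a
  multiple of \<open>\<phi> t powr l\<close>.\<close>

lemma nn_integral_kernel_avg_scales:
  assumes ker: "\<And>y. \<lbrakk>0 < y; y < 1\<rbrakk> \<Longrightarrow> averaging_kernel (K y) (C / y)" and C: "0 < C"
    and l: "1 < l" "l < s"
    and [measurable]: "\<phi> \<in> borel_measurable borel"
    and \<phi>: "\<And>t. 0 \<le> \<phi> t" "\<And>t. \<phi> t \<le> B" "(\<integral>\<^sup>+t. \<phi> t powr l \<partial>circ) \<le> 1"
  shows "(\<integral>\<^sup>+y. ennreal (y powr (s / l - 2)) * (\<integral>\<^sup>+x. kernel_avg (K y) \<phi> x powr s \<partial>circ) \<partial>unit_interval)
     \<le> ennreal (2 powr s * (1 / (s / l - 1) + C powr (s - 1) / (1 - 1 / l)))"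
proof -
  define c where "c = C powr (s - 1)"
  have c: "0 \<le> c" by (simp add: c_def)
  have "(\<integral>\<^sup>+y. ennreal (y powr (s / l - 2)) * (\<integral>\<^sup>+x. kernel_avg (K y) \<phi> x powr s \<partial>circ) \<partial>unit_interval)
    \<le> (\<integral>\<^sup>+y. ennreal (2 powr s) * ((\<integral>\<^sup>+t. ennreal (y powr (s / l - 2)) * ennreal (low_part l y \<phi> t powr s) \<partial>circ)
         + ennreal c * (\<integral>\<^sup>+t. ennreal (y powr (1 / l - 2)) * ennreal (high_part l y \<phi> t) \<partial>circ)) \<partial>unit_interval)"
  proof (rule nn_integral_mono_AE)
    show "AE y in unit_interval. ennreal (y powr (s / l - 2)) * (\<integral>\<^sup>+x. kernel_avg (K y) \<phi> x powr s \<partial>circ) \<le>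
       ennreal (2 powr s) * ((\<integral>\<^sup>+t. ennreal (y powr (s / l - 2)) * ennreal (low_part l y \<phi> t powr s) \<partial>circ)
         + ennreal c * (\<integral>\<^sup>+t. ennreal (y powr (1 / l - 2)) * ennreal (high_part l y \<phi> t) \<partial>circ))"
      using AE_unit
    proof eventually_elim
      case (elim y)
      interpret averaging_kernel "K y" "C / y" using ker elim by blast
      interpret averaging_kernel_scale "K y" C y l \<phi> B
        by unfold_locales (use elim C l \<phi> in auto)
      have e: "y powr (s / l - 2) * (C powr (s - 1) * y powr (- (s - 1) / l)) = c * y powr (1 / l - 2)"
        using elim l by (simp add: c_def powr_add[symmetric] field_simps)
      have "ennreal (y powr (s / l - 2)) * (\<integral>\<^sup>+x. kernel_avg (K y) \<phi> x powr s \<partial>circ) \<le>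
         ennreal (y powr (s / l - 2)) * (ennreal (2 powr s) *
          ((\<integral>\<^sup>+t. low_part l y \<phi> t powr s \<partial>circ) + ennreal (C powr (s - 1) * y powr (- (s - 1) / l)) * (\<integral>\<^sup>+t. high_part l y \<phi> t \<partial>circ)))"
        by (intro mult_left_mono kernel_avg_split_le \<open>l < s\<close>) auto
      also have "\<dots> = ennreal (2 powr s) * (ennreal (y powr (s / l - 2)) * (\<integral>\<^sup>+t. low_part l y \<phi> t powr s \<partial>circ)
          + (ennreal (y powr (s / l - 2)) * ennreal (C powr (s - 1) * y powr (- (s - 1) / l))) * (\<integral>\<^sup>+t. high_part l y \<phi> t \<partial>circ))"
        by (simp add: algebra_simps)
      also have "ennreal (y powr (s / l - 2)) * ennreal (C powr (s - 1) * y powr (- (s - 1) / l)) = ennreal c * ennreal (y powr (1 / l - 2))"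
        using c by (simp only: ennreal_mult'[symmetric] powr_ge_zero e)
      finally show ?case by (simp add: nn_integral_cmult mult.assoc)
    qed
  qed
  also have "\<dots> = ennreal (2 powr s) * ((\<integral>\<^sup>+y. \<integral>\<^sup>+t. ennreal (y powr (s / l - 2)) * ennreal (low_part l y \<phi> t powr s) \<partial>circ \<partial>unit_interval)
         + ennreal c * (\<integral>\<^sup>+y. \<integral>\<^sup>+t. ennreal (y powr (1 / l - 2)) * ennreal (high_part l y \<phi> t) \<partial>circ \<partial>unit_interval))"
    by (simp add: nn_integral_cmult nn_integral_add)
  also have "(\<integral>\<^sup>+y. \<integral>\<^sup>+t. ennreal (y powr (s / l - 2)) * ennreal (low_part l y \<phi> t powr s) \<partial>circ \<partial>unit_interval)
     = (\<integral>\<^sup>+t. \<integral>\<^sup>+y. ennreal (y powr (s / l - 2)) * ennreal (low_part l y \<phi> t powr s) \<partial>unit_interval \<partial>circ)"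
    by (rule circ_unit.Fubini') measurable
  also have "(\<integral>\<^sup>+y. \<integral>\<^sup>+t. ennreal (y powr (1 / l - 2)) * ennreal (high_part l y \<phi> t) \<partial>circ \<partial>unit_interval)
     = (\<integral>\<^sup>+t. \<integral>\<^sup>+y. ennreal (y powr (1 / l - 2)) * ennreal (high_part l y \<phi> t) \<partial>unit_interval \<partial>circ)"
    by (rule circ_unit.Fubini') measurable
  also have "(\<integral>\<^sup>+t. \<integral>\<^sup>+y. ennreal (y powr (s / l - 2)) * ennreal (low_part l y \<phi> t powr s) \<partial>unit_interval \<partial>circ)
     \<le> (\<integral>\<^sup>+t. ennreal (1 / (s / l - 1)) * ennreal (\<phi> t powr l) \<partial>circ)"
    using l \<phi> by (intro nn_integral_mono order_trans[OF nn_integral_low]) (auto simp: ennreal_mult'[symmetric])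
  also have "(\<integral>\<^sup>+t. \<integral>\<^sup>+y. ennreal (y powr (1 / l - 2)) * ennreal (high_part l y \<phi> t) \<partial>unit_interval \<partial>circ)
     \<le> (\<integral>\<^sup>+t. ennreal (1 / (1 - 1 / l)) * ennreal (\<phi> t powr l) \<partial>circ)"
    using l \<phi> by (intro nn_integral_mono order_trans[OF nn_integral_high]) (auto simp: ennreal_mult'[symmetric])
  also have "(\<integral>\<^sup>+t. ennreal (1 / (s / l - 1)) * ennreal (\<phi> t powr l) \<partial>circ) \<le> ennreal (1 / (s / l - 1)) * 1"
    using \<phi>(3) by (subst nn_integral_cmult) (auto intro!: mult_left_mono simp del: mult_1_right)
  also have "(\<integral>\<^sup>+t. ennreal (1 / (1 - 1 / l)) * ennreal (\<phi> t powr l) \<partial>circ) \<le> ennreal (1 / (1 - 1 / l)) * 1"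
    using \<phi>(3) by (subst nn_integral_cmult) (auto intro!: mult_left_mono simp del: mult_1_right)
  finally have "(\<integral>\<^sup>+y. ennreal (y powr (s / l - 2)) * (\<integral>\<^sup>+x. kernel_avg (K y) \<phi> x powr s \<partial>circ) \<partial>unit_interval)
     \<le> ennreal (2 powr s) * (ennreal (1 / (s / l - 1)) * 1 + ennreal c * (ennreal (1 / (1 - 1 / l)) * 1))"
    by (auto intro!: mult_left_mono add_mono simp: mult_left_mono add_mono)
  also have "\<dots> = ennreal (2 powr s * (1 / (s / l - 1) + c / (1 - 1 / l)))"
    using l c by (simp add: ennreal_mult'[symmetric] ennreal_plus[symmetric] del: ennreal_plus)
  finally show ?thesis by (simp add: c_def)
qed

section \<open>Lipschitz functions and the Euler operator\<close>

lemma norm_fin_diff_le: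
  fixes v :: "real \<Rightarrow> complex"
  assumes v: "\<And>x. (v has_vector_derivative v' x) (at x)" and M: "\<And>x. norm (v' x) \<le> M" and h: "0 \<le> h"
  shows "norm (fin_diff h v x) \<le> h * M"
proof -
  have "norm (v (x + h) - v x) \<le> M * norm (x + h - x)"
  proof (rule differentiable_bound[where S=UNIV and f'="\<lambda>y t. t *\<^sub>R v' y"])
    show "(v has_derivative (\<lambda>t. t *\<^sub>R v' y)) (at y within UNIV)" for y
      using v[of y] by (simp add: has_vector_derivative_def)
    show "onorm (\<lambda>t. t *\<^sub>R v' y) \<le> M" for y
      using M[of y] by (intro onorm_le) (simp add: mult.commute[of M] mult_left_mono)
  qed auto
  thus ?thesis using h by (simp add: fin_diff_def mult.commute)
qed

lemma norm_fin_diff_linear_le: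
  fixes v :: "real \<Rightarrow> complex"
  assumes v: "\<And>x. (v has_vector_derivative v' x) (at x)"
    and v': "\<And>x. (v' has_vector_derivative v'' x) (at x)" and M: "\<And>x. norm (v'' x) \<le> M" and h: "0 \<le> h"
  shows "norm (fin_diff h v x - h *\<^sub>R v' x) \<le> h\<^sup>2 * M"
proof -
  have M0: "0 \<le> M" using M[of 0] norm_ge_zero order_trans by blast
  have "norm (v (x + h) - v x - (x + h - x) *\<^sub>R v' x) \<le> norm (x + h - x) * (h * M)"
  proof (rule vector_differentiable_bound_linearization[where S="{x..x + h}"])
    show "(v has_vector_derivative v' y) (at y within {x..x + h})" for y
      using v by (rule has_vector_derivative_at_within)
    fix y assume y: "y \<in> {x..x + h}"
    have "norm (v' y - v' x) \<le> (y - x) * M"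
      using norm_fin_diff_le[OF v' M, of "y - x" x] y by (simp add: fin_diff_def)
    also have "\<dots> \<le> h * M" using y M0 by (intro mult_right_mono) auto
    finally show "norm (v' y - v' x) \<le> h * M" .
  qed (use h in \<open>auto simp: closed_segment_eq_real_ivl\<close>)
  thus ?thesis using h by (simp add: fin_diff_def power2_eq_square mult.assoc)
qed

lemma has_vector_derivative_fin_diff:
  assumes "\<And>x. (v has_vector_derivative v' x) (at x)"
  shows "(fin_diff h v has_vector_derivative fin_diff h v' x) (at x)"
proof -
  have "((\<lambda>x. v (x + h)) has_vector_derivative 1 *\<^sub>R v' (x + h)) (at x)"
  proof -
    have "((\<lambda>x. x + h) has_vector_derivative 1) (at x)"
      by (auto intro!: derivative_eq_intros simp flip: has_real_derivative_iff_has_vector_derivative)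
    from vector_diff_chain_at[OF this assms] show ?thesis by (simp add: o_def)
  qed
  thus ?thesis unfolding fin_diff_def using assms by (auto intro!: derivative_eq_intros)
qed

text \<open>Here \<open>u j\<close> is the \<open>j\<close>-th derivative of \<open>u 0\<close>: up to an error of order \<open>h\<^bsup>k + 1\<^esup>\<close>, the \<open>k\<close>-th
  difference is \<open>h\<^sup>k\<close> times the \<open>k\<close>-th derivative. The induction passes from \<open>u\<close> to its first difference.\<close>

lemma norm_fin_diff_power_le:
  fixes u :: "nat \<Rightarrow> real \<Rightarrow> complex"
  assumes "\<And>j x. (u j has_vector_derivative u (Suc j) x) (at x)"
    and "\<And>x. norm (u (Suc k) x) \<le> M" and h: "0 \<le> h"
  shows "norm ((fin_diff h ^^ k) (u 0) x - h ^ k *\<^sub>R u k x) \<le> k * h ^ Suc k * M"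
  using assms(1,2)
proof (induction k arbitrary: u M x)
  case (Suc k u M x)
  define w where "w = (\<lambda>j. fin_diff h (u j))"
  have w: "(w j has_vector_derivative w (Suc j) x) (at x)" for j x
    unfolding w_def by (intro has_vector_derivative_fin_diff Suc.prems)
  have "norm (w (Suc k) x) \<le> h * M" for x
    unfolding w_def by (rule norm_fin_diff_le[OF Suc.prems h])
  from Suc.IH[OF w this]
  have 1: "norm ((fin_diff h ^^ k) (w 0) x - h ^ k *\<^sub>R w k x) \<le> k * h ^ Suc k * (h * M)" .
  have "norm (fin_diff h (u k) x - h *\<^sub>R u (Suc k) x) \<le> h\<^sup>2 * M"
    by (rule norm_fin_diff_linear_le[OF Suc.prems(1) Suc.prems h])
  hence *: "h ^ k * norm (fin_diff h (u k) x - h *\<^sub>R u (Suc k) x) \<le> h ^ k * (h\<^sup>2 * M)"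
    using h by (intro mult_left_mono) auto
  hence 2: "norm (h ^ k *\<^sub>R w k x - h ^ Suc k *\<^sub>R u (Suc k) x) \<le> h ^ k * (h\<^sup>2 * M)"
  proof -
    have "h ^ k *\<^sub>R w k x - h ^ Suc k *\<^sub>R u (Suc k) x = h ^ k *\<^sub>R (fin_diff h (u k) x - h *\<^sub>R u (Suc k) x)"
      by (simp add: w_def scaleR_diff_right mult.commute)
    thus ?thesis using * h by simp
  qed
  have "norm ((fin_diff h ^^ Suc k) (u 0) x - h ^ Suc k *\<^sub>R u (Suc k) x)
      = norm (((fin_diff h ^^ k) (w 0) x - h ^ k *\<^sub>R w k x) + (h ^ k *\<^sub>R w k x - h ^ Suc k *\<^sub>R u (Suc k) x))"
    by (simp add: w_def funpow_swap1)
  also have "\<dots> \<le> k * h ^ Suc k * (h * M) + h ^ k * (h\<^sup>2 * M)"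
    by (rule order_trans[OF norm_triangle_ineq add_mono[OF 1 2]])
  also have "\<dots> = Suc k * h ^ Suc (Suc k) * M" by (simp add: power2_eq_square algebra_simps)
  finally show ?case .
qed simp

text \<open>The derivative along circles is \<open>\<i>\<close> times this operator, and on Taylor coefficients it multiplies by
  the index.\<close>

definition euler :: "(complex \<Rightarrow> complex) \<Rightarrow> complex \<Rightarrow> complex" where
  "euler F = (\<lambda>z. z * deriv F z)"

lemma holomorphic_euler: "F holomorphic_on ball 0 R \<Longrightarrow> euler F holomorphic_on ball 0 R"
  unfolding euler_def by (intro holomorphic_intros) auto

lemma holomorphic_euler_power: "F holomorphic_on ball 0 R \<Longrightarrow> (euler ^^ k) F holomorphic_on ball 0 R"
  by (induction k) (auto intro: holomorphic_euler)

lemma has_vector_derivative_euler_circle: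
  assumes F: "F holomorphic_on ball 0 1" and s: "0 \<le> s" "s < 1"
  shows "((\<lambda>t. \<i> ^ j * (euler ^^ j) F (of_real s * cis t)) has_vector_derivative
     \<i> ^ Suc j * (euler ^^ Suc j) F (of_real s * cis x)) (at x)"
proof -
  have "norm (of_real s * cis x) < 1" using s by (simp add: norm_mult)
  hence "((euler ^^ j) F has_field_derivative deriv ((euler ^^ j) F) (of_real s * cis x)) (at (of_real s * cis x))"
    using holomorphic_derivI[OF holomorphic_euler_power[OF F] open_ball] by simp
  moreover have "((\<lambda>t. of_real s * cis t) has_vector_derivative of_real s * (\<i> * cis x)) (at x)"
    unfolding cis_conv_exp
    by (rule has_vector_derivative_real_field) (auto intro!: derivative_eq_intros)
  ultimately have "((\<lambda>t. (euler ^^ j) F (of_real s * cis t)) has_vector_derivative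
       of_real s * (\<i> * cis x) * deriv ((euler ^^ j) F) (of_real s * cis x)) (at x)"
    using field_vector_diff_chain_at[of "\<lambda>t. of_real s * cis t" _ x "(euler ^^ j) F"] by (simp add: o_def)
  hence "((\<lambda>t. \<i> ^ j * (euler ^^ j) F (of_real s * cis t)) has_vector_derivative
     \<i> ^ j * (of_real s * (\<i> * cis x) * deriv ((euler ^^ j) F) (of_real s * cis x))) (at x)"
    by (rule has_vector_derivative_mult_right)
  moreover have "\<i> ^ j * (of_real s * (\<i> * cis x) * deriv ((euler ^^ j) F) (of_real s * cis x)) =
     \<i> ^ Suc j * (euler ^^ Suc j) F (of_real s * cis x)"
    by (simp add: euler_def mult_ac)
  ultimately show ?thesis by simp
qed

text \<open>By the maximum principle on circles of radii tending to one, some points \<open>w n\<close> on these circles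
  satisfy \<open>\<bar>F z\<bar> \<le> \<bar>F (w n)\<bar>\<close>; a subsequence tends to a boundary point, where the limit of \<open>F\<close> is known.\<close>

lemma maximum_modulus_boundary_limits:
  assumes F: "F holomorphic_on ball 0 1"
    and lim: "\<And>t. (F \<longlongrightarrow> g t) (at (cis t) within ball 0 1)" and g: "\<And>t. norm (g t) \<le> K"
    and z: "norm z < 1"
  shows "norm (F z) \<le> K"
proof -
  define s where "s = (\<lambda>n::nat. 1 - (1 - norm z) / (n + 2))"
  have s: "norm z \<le> s n" "s n < 1" "0 < s n" for n
  proof -
    have *: "(1 - norm z) / (real n + 2) \<le> (1 - norm z) / 2" using z by (intro divide_left_mono) auto
    show "norm z \<le> s n" "0 < s n" using z * norm_ge_zero[of z] unfolding s_def by argo+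
    show "s n < 1" unfolding s_def using z by simp
  qed
  have "\<exists>w. norm w = s n \<and> norm (F z) \<le> norm (F w)" for n
  proof (rule ccontr)
    assume "\<not> ?thesis"
    hence less: "norm (F w) < norm (F z)" if "norm w = s n" for w using that by force
    have sub: "cball 0 (s n) \<subseteq> ball (0::complex) 1" using s(2)[of n] by auto
    have cont: "continuous_on (cball 0 (s n)) F"
      using holomorphic_on_imp_continuous_on[OF F] sub continuous_on_subset by blast
    have "continuous_on (sphere 0 (s n)) (\<lambda>w. norm (F w))"
      by (intro continuous_on_norm continuous_on_subset[OF cont]) auto
    moreover have "sphere (0::complex) (s n) \<noteq> {}" using s(3)[of n] by (simp add: less_imp_le)
    ultimately obtain w0 where w0: "w0 \<in> sphere 0 (s n)" "\<And>w. w \<in> sphere 0 (s n) \<Longrightarrow> norm (F w) \<le> norm (F w0)"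
      using continuous_attains_sup[OF compact_sphere] by metis
    have "norm (F z) \<le> norm (F w0)"
    proof (rule maximum_modulus_frontier[where S="cball 0 (s n)" and f=F and \<xi>=z and B="norm (F w0)"])
      show "F holomorphic_on interior (cball 0 (s n))"
        using F sub interior_subset by (meson holomorphic_on_subset subset_trans)
      show "z \<in> cball 0 (s n)" using s by simp
    qed (use cont w0 in auto)
    thus False using less[of w0] w0 by simp
  qed
  then obtain w where w: "\<And>n. norm (w n) = s n" "\<And>n. norm (F z) \<le> norm (F (w n))" by metis
  have "seq_compact (cball (0::complex) 1)"
    using compact_cball compact_imp_seq_compact by blast
  moreover have "w n \<in> cball 0 1" for n using w(1)[of n] s(2)[of n] by simp
  ultimately obtain l r where l: "strict_mono (r :: nat \<Rightarrow> nat)" "(w \<circ> r) \<longlonglongrightarrow> l"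
    unfolding seq_compact_def by metis
  have "s \<longlonglongrightarrow> 1" unfolding s_def by real_asymp
  hence "(\<lambda>n. norm ((w \<circ> r) n)) \<longlonglongrightarrow> 1"
    using LIMSEQ_subseq_LIMSEQ[OF _ l(1)] w(1) by (simp add: o_def)
  hence "norm l = 1" using tendsto_norm[OF l(2)] LIMSEQ_unique by blast
  hence "l = cis (Arg2pi l)" using complex_norm_eq_1_exp[of l] by (simp add: cis_conv_exp)
  then obtain t where t: "l = cis t" by blast
  have "filterlim (w \<circ> r) (at l within ball 0 1) sequentially"
    unfolding filterlim_at using l(2) w(1) s(2) \<open>norm l = 1\<close>
    by (auto intro!: always_eventually) (metis less_irrefl)
  hence "(\<lambda>n. F ((w \<circ> r) n)) \<longlonglongrightarrow> g t"
    using lim[of t] unfolding t by (rule filterlim_compose[rotated])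
  hence "(\<lambda>n. norm (F ((w \<circ> r) n))) \<longlonglongrightarrow> norm (g t)" by (rule tendsto_norm)
  hence "norm (F z) \<le> norm (g t)" by (rule Lim_bounded2) (use w(2) in auto)
  thus ?thesis using g[of t] by simp
qed

text \<open>The holomorphic counterpart of \<open>fin_diff\<close>: a difference along the circle through \<open>z\<close>.\<close>

definition rot_diff :: "real \<Rightarrow> (complex \<Rightarrow> complex) \<Rightarrow> complex \<Rightarrow> complex" where
  "rot_diff h F = (\<lambda>z. F (z * cis h) - F z)"

lemma rot_diff_power_circle:
  "(rot_diff h ^^ k) F (of_real s * cis x) = (fin_diff h ^^ k) (\<lambda>t. F (of_real s * cis t)) x"
proof (induction k arbitrary: x)
  case (Suc k)
  have "(rot_diff h ^^ Suc k) F (of_real s * cis x) = (rot_diff h ^^ k) F (of_real s * cis (x + h)) - (rot_diff h ^^ k) F (of_real s * cis x)"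
    by (simp add: rot_diff_def cis_mult mult.assoc)
  thus ?case by (simp add: Suc fin_diff_def)
qed simp

lemma rot_diff_power_holomorphic:
  assumes "F holomorphic_on ball 0 1"
  shows "(rot_diff h ^^ k) F holomorphic_on ball 0 1"
proof (induction k)
  case (Suc k)
  have "((rot_diff h ^^ k) F \<circ> (\<lambda>z. z * cis h)) holomorphic_on ball 0 1"
    by (rule holomorphic_on_compose_gen[OF _ Suc]) (auto intro!: holomorphic_intros simp: norm_mult)
  moreover have "(rot_diff h ^^ Suc k) F = (\<lambda>z. (rot_diff h ^^ k) F (z * cis h) - (rot_diff h ^^ k) F z)"
    by (simp add: rot_diff_def)
  ultimately show ?case using Suc by (simp only: o_def holomorphic_on_diff)
qed (use assms in simp)

lemma rot_diff_power_limit: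
  assumes "\<And>t. (F \<longlongrightarrow> g t) (at (cis t) within ball 0 1)"
  shows "((rot_diff h ^^ k) F \<longlongrightarrow> (fin_diff h ^^ k) g t) (at (cis t) within ball 0 1)"
proof (induction k arbitrary: t)
  case (Suc k)
  have "filterlim (\<lambda>z. z * cis h) (at (cis (t + h)) within ball 0 1) (at (cis t) within ball 0 1)"
    unfolding filterlim_at
  proof
    show "\<forall>\<^sub>F z in at (cis t) within ball 0 1. z * cis h \<in> ball 0 1 \<and> z * cis h \<noteq> cis (t + h)"
      unfolding eventually_at_filter by (auto simp: norm_mult cis_mult[symmetric])
    have "((\<lambda>z. z * cis h) \<longlongrightarrow> cis t * cis h) (at (cis t) within ball 0 1)"
      by (intro tendsto_intros)
    thus "((\<lambda>z. z * cis h) \<longlongrightarrow> cis (t + h)) (at (cis t) within ball 0 1)"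
      by (simp add: cis_mult)
  qed
  hence "((\<lambda>z. (rot_diff h ^^ k) F (z * cis h)) \<longlongrightarrow> (fin_diff h ^^ k) g (t + h)) (at (cis t) within ball 0 1)"
    using Suc by (rule filterlim_compose[rotated])
  moreover have "(rot_diff h ^^ Suc k) F = (\<lambda>z. (rot_diff h ^^ k) F (z * cis h) - (rot_diff h ^^ k) F z)"
    "(fin_diff h ^^ Suc k) g t = (fin_diff h ^^ k) g (t + h) - (fin_diff h ^^ k) g t"
    by (simp_all add: rot_diff_def fin_diff_def)
  ultimately show ?case using Suc by (simp only: tendsto_diff)
qed (use assms in simp)

text \<open>Let \<open>A\<close> be the smallest constant for which the bound holds on the disc of radius \<open>R < 1\<close>, with \<open>R\<close> in
  place of one; it is finite. At a point at distance \<open>y\<close> from that circle, the \<open>k\<close>-th difference with step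
  \<open>h = \<epsilon> * y\<close> gives the \<open>k\<close>-th power of the Euler operator up to an error of one more derivative, which
  Cauchy's inequality estimates by a multiple of \<open>\<epsilon> * A\<close>. For small \<open>\<epsilon>\<close> this is \<open>A / 2\<close> and is absorbed, so
  that the bound on \<open>A\<close> does not depend on \<open>R\<close>.\<close>

lemma euler_power_bound_absorb:
  fixes \<alpha> :: real
  assumes F: "F holomorphic_on ball 0 1" and k: "\<alpha> < real k" "0 < k"
    and D: "\<And>z h. \<lbrakk>norm z < 1; 0 < h\<rbrakk> \<Longrightarrow> norm ((rot_diff h ^^ k) F z) \<le> C0 * h powr \<alpha>"
  shows "\<exists>C. \<forall>z. norm z < 1 \<longrightarrow> norm ((euler ^^ k) F z) \<le> C * (1 - norm z) powr (\<alpha> - k)"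
proof -
  define e where "e = (euler ^^ k) F"
  have e: "e holomorphic_on ball 0 1" unfolding e_def by (rule holomorphic_euler_power[OF F])
  define \<gamma> where "\<gamma> = real k - \<alpha>"
  have \<gamma>: "\<gamma> > 0" using k by (simp add: \<gamma>_def)
  \<comment> \<open>this value makes the error term in the step below equal to \<open>A / 2\<close>\<close>
  define \<epsilon> where "\<epsilon> = 1 / (2 * (k * 2 * 2 powr \<gamma>))"
  have \<epsilon>: "\<epsilon> > 0" using k by (simp add: \<epsilon>_def)
  define C1 where "C1 = C0 * \<epsilon> powr (- \<gamma>)"
  have main: "norm (e z) * (R - norm z) powr \<gamma> \<le> 2 * C1" if R: "0 < R" "R < 1" and z: "norm z < R" for z R
  proof -
    define V where "V = (\<lambda>z. norm (e z) * (R - norm z) powr \<gamma>) ` ball 0 R"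
    define A where "A = Sup V"
    have ce: "continuous_on (cball 0 R) e"
      by (rule continuous_on_subset[OF holomorphic_on_imp_continuous_on[OF e]]) (use R in auto)
    have "compact (e ` cball 0 R)" by (intro compact_continuous_image ce compact_cball)
    hence "bounded (e ` cball 0 R)" by (rule compact_imp_bounded)
    then obtain B where "\<forall>x\<in>e ` cball 0 R. norm x \<le> B" unfolding bounded_iff by blast
    hence B: "\<And>z. norm z \<le> R \<Longrightarrow> norm (e z) \<le> B" by simp
    have bdd: "bdd_above V"
    proof (rule bdd_aboveI)
      fix v assume "v \<in> V"
      then obtain z where z: "norm z < R" "v = norm (e z) * (R - norm z) powr \<gamma>" by (auto simp: V_def)
      have "(R - norm z) powr \<gamma> \<le> 1 powr \<gamma>"
      proof (rule powr_mono2)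
        show "0 \<le> \<gamma>" "0 \<le> R - norm z" using \<gamma> z by auto
        show "R - norm z \<le> 1" using R norm_ge_zero[of z] by linarith
      qed
      thus "v \<le> B * 1" unfolding z(2) using B[of z] z order_trans[OF norm_ge_zero B[of z]]
        by (intro mult_mono) auto
    qed
    have le_A: "norm (e z) * (R - norm z) powr \<gamma> \<le> A" if "norm z < R" for z
      unfolding A_def by (rule cSup_upper[OF _ bdd]) (use that in \<open>auto simp: V_def\<close>)
    have A0: "0 \<le> A" using order_trans[OF _ le_A[of 0]] R by simp
    have step: "norm (e z) * (R - norm z) powr \<gamma> \<le> C1 + A / 2" if z: "norm z < R" for z
    proof -
      define y where "y = R - norm z"
      have y: "y > 0" using z by (simp add: y_def)
      define h where "h = \<epsilon> * y"
      have h: "h > 0" using \<epsilon> y by (simp add: h_def)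
      define M where "M = A * (y / 2) powr (- \<gamma>) / (y / 2)"
      have M: "norm ((euler ^^ Suc k) F w) \<le> M" if w: "norm w = norm z" for w
      proof -
        have wle: "norm w \<le> 1" using w z R by simp
        have "norm ((deriv ^^ 1) e w) \<le> fact 1 * (A * (y / 2) powr (- \<gamma>)) / (y / 2) ^ 1"
        proof (rule Cauchy_inequality)
          have "cball w (y / 2) \<subseteq> ball 0 1"
          proof
            fix x assume "x \<in> cball w (y / 2)"
            hence "norm x \<le> norm w + y / 2" using norm_triangle_ineq[of w "x - w"] by (simp add: dist_norm norm_minus_commute)
            hence "norm x < 1" using w y R unfolding y_def by argo
            thus "x \<in> ball 0 1" by simp
          qed
          thus "continuous_on (cball w (y / 2)) e" "e holomorphic_on ball w (y / 2)"
            by (rule continuous_on_subset[OF holomorphic_on_imp_continuous_on[OF e]],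
                intro holomorphic_on_subset[OF e] subset_trans[OF ball_subset_cball])
          show "0 < y / 2" using y by simp
          fix x assume "norm (w - x) = y / 2"
          hence x: "norm x \<le> norm w + y / 2" using norm_triangle_ineq[of w "x - w"] by (simp add: norm_minus_commute)
          hence xR: "norm x < R" "y / 2 \<le> R - norm x" using w y unfolding y_def by argo+
          have "norm (e x) * (y / 2) powr \<gamma> \<le> norm (e x) * (R - norm x) powr \<gamma>"
            using xR y \<gamma> by (intro mult_left_mono powr_mono2) auto
          also have "\<dots> \<le> A" by (rule le_A[OF xR(1)])
          finally show "norm (e x) \<le> A * (y / 2) powr (- \<gamma>)" using y by (simp add: powr_minus field_simps)
        qed
        hence "norm (deriv e w) \<le> M" by (simp add: M_def)
        moreover have "norm ((euler ^^ Suc k) F w) = norm w * norm (deriv e w)"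
          by (simp add: euler_def e_def norm_mult)
        ultimately show ?thesis using wle mult_mono[of "norm w" 1 "norm (deriv e w)" M] by simp
      qed
      define s where "s = norm z"
      have s: "0 \<le> s" "s < 1" using z R by (auto simp: s_def)
      obtain x where x: "z = of_real s * cis x" using rcis_cmod_Arg[of z] by (metis rcis_def s_def)
      define u where "u = (\<lambda>j t. \<i> ^ j * (euler ^^ j) F (of_real s * cis t))"
      have "norm ((fin_diff h ^^ k) (u 0) x - h ^ k *\<^sub>R u k x) \<le> k * h ^ Suc k * M"
      proof (rule norm_fin_diff_power_le)
        show "(u j has_vector_derivative u (Suc j) t) (at t)" for j t
          unfolding u_def by (rule has_vector_derivative_euler_circle[OF F s])
        show "norm (u (Suc k) t) \<le> M" for t
          using M[of "of_real s * cis t"] by (simp add: u_def norm_mult norm_power s_def del: funpow.simps)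
      qed (use h in simp)
      moreover have "norm ((fin_diff h ^^ k) (u 0) x) \<le> C0 * h powr \<alpha>"
        using D[of z h] z R h rot_diff_power_circle[where s=s and x=x and F=F and h=h and k=k] by (simp add: u_def x)
      ultimately have "norm (h ^ k *\<^sub>R u k x) \<le> C0 * h powr \<alpha> + k * h ^ Suc k * M"
        using norm_triangle_ineq4[of "(fin_diff h ^^ k) (u 0) x" "(fin_diff h ^^ k) (u 0) x - h ^ k *\<^sub>R u k x"]
        by simp
      moreover have "norm (u k x) = norm (e z)" by (simp add: u_def e_def norm_mult norm_power x)
      ultimately have "h ^ k * norm (e z) \<le> C0 * h powr \<alpha> + k * h ^ Suc k * M" using h by simp
      moreover have "h powr \<alpha> = h ^ k * h powr (- \<gamma>)"
        using h by (simp add: powr_realpow[symmetric] powr_add[symmetric] \<gamma>_def)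
      ultimately have "h ^ k * norm (e z) \<le> h ^ k * (C0 * h powr (- \<gamma>) + k * h * M)"
        by (simp add: algebra_simps)
      hence "norm (e z) \<le> C0 * h powr (- \<gamma>) + k * h * M" using h by simp
      hence "norm (e z) * y powr \<gamma> \<le> (C0 * h powr (- \<gamma>) + k * h * M) * y powr \<gamma>"
        by (intro mult_right_mono) auto
      also have "\<dots> = C0 * (h powr (- \<gamma>) * y powr \<gamma>) + k * h * (M * y powr \<gamma>)" by (simp add: algebra_simps)
      also have "h powr (- \<gamma>) * y powr \<gamma> = \<epsilon> powr (- \<gamma>)"
        using \<epsilon> y by (simp add: h_def powr_mult powr_minus)
      also have "M * y powr \<gamma> = A * 2 powr \<gamma> * 2 / y"
        using y by (simp add: M_def powr_divide powr_minus)
      also have "k * h * (A * 2 powr \<gamma> * 2 / y) = A / 2"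
        using y k by (simp add: h_def \<epsilon>_def)
      finally show ?thesis by (simp add: C1_def y_def)
    qed
    have "A \<le> C1 + A / 2"
      unfolding A_def by (rule cSup_least) (use step R in \<open>auto simp: V_def A_def\<close>)
    hence "A \<le> 2 * C1" by simp
    thus ?thesis using le_A[OF z] by simp
  qed
  show ?thesis
  proof (intro exI allI impI)
    fix z :: complex assume z: "norm z < 1"
    have "norm (e z) * (1 - norm z) powr \<gamma> \<le> 2 * C1"
    proof (rule tendsto_upperbound)
      show "((\<lambda>R. norm (e z) * (R - norm z) powr \<gamma>) \<longlongrightarrow> norm (e z) * (1 - norm z) powr \<gamma>) (at_left 1)"
        using z by (intro tendsto_intros) auto
      show "\<forall>\<^sub>F R in at_left 1. norm (e z) * (R - norm z) powr \<gamma> \<le> 2 * C1"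
        using eventually_at_left_real[OF z]
      proof eventually_elim
        case (elim R)
        moreover have "0 < R" using le_less_trans[OF norm_ge_zero[of z], of R] elim by simp
        ultimately show ?case using main[of R z] by auto
      qed
    qed auto
    thus "norm ((euler ^^ k) F z) \<le> 2 * C1 * (1 - norm z) powr (\<alpha> - k)"
      using z by (simp add: e_def[symmetric] \<gamma>_def powr_diff field_simps)
  qed
qed

text \<open>The boundary values have differences of order \<open>k\<close> bounded by \<open>\<bar>h\<bar> powr \<alpha>\<close>; by the maximum principle
  the same bound holds inside. The factor \<open>\<bar>z\<bar>\<close>, which matters near the centre only, comes from
  the zero of the Euler operator at the origin; it will balance the pole of the logarithmic weight
  there.\<close>

lemma lipschitz_disc_euler_bound:
  assumes b: "b \<in> lipschitz_disc \<alpha>" and \<alpha>: "0 < \<alpha>"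
  obtains k C where "0 < (k::nat)" "\<alpha> < k" "0 < C"
    "\<And>z. norm z < 1 \<Longrightarrow> norm ((euler ^^ k) b z) \<le> C * norm z * (1 - norm z) powr (\<alpha> - k)"
proof -
  obtain g where hol: "b holomorphic_on ball 0 1" and g: "g \<in> lipschitz_circle \<alpha>"
    and lim: "\<And>t. (b \<longlongrightarrow> g t) (at (cis t) within ball 0 1)"
    using b by (auto simp: lipschitz_disc_def)
  define k where "k = (LEAST k::nat. real k > \<alpha>)"
  have k: "real k > \<alpha>" unfolding k_def by (rule LeastI_ex) (rule reals_Archimedean2)
  hence k0: "0 < k" using \<alpha> by (cases k) auto
  have "bdd_above {\<bar>h\<bar> powr (- \<alpha>) * norm ((fin_diff h ^^ k) g x) | h x. h \<noteq> 0}"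
    using g unfolding lipschitz_circle_def Let_def k_def mem_Collect_eq by (elim conjE)
  then obtain C0 where C0: "\<And>h x. h \<noteq> 0 \<Longrightarrow> \<bar>h\<bar> powr (- \<alpha>) * norm ((fin_diff h ^^ k) g x) \<le> C0"
    unfolding bdd_above_def by blast
  have "norm ((rot_diff h ^^ k) b z) \<le> C0 * h powr \<alpha>" if "norm z < 1" "0 < h" for z h
  proof (rule maximum_modulus_boundary_limits[OF rot_diff_power_holomorphic[OF hol] rot_diff_power_limit[OF lim] _ that(1)])
    show "norm ((fin_diff h ^^ k) g t) \<le> C0 * h powr \<alpha>" for t
      using C0[of h t] that by (simp add: powr_minus field_simps)
  qed
  from euler_power_bound_absorb[OF hol k k0 this]
  obtain C1 where C1: "\<And>z. norm z < 1 \<Longrightarrow> norm ((euler ^^ k) b z) \<le> C1 * (1 - norm z) powr (\<alpha> - k)"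
    by blast
  obtain j where j: "k = Suc j" using k0 gr0_implies_Suc by blast
  define d where "d = deriv ((euler ^^ j) b)"
  have d: "(euler ^^ k) b z = z * d z" for z by (simp add: j d_def euler_def)
  have "d holomorphic_on ball 0 1" unfolding d_def
    by (intro holomorphic_deriv holomorphic_euler_power hol) auto
  hence "continuous_on (cball 0 (1/2)) d"
    by (intro holomorphic_on_imp_continuous_on) (auto intro: holomorphic_on_subset)
  hence "compact (d ` cball 0 (1/2))" by (intro compact_continuous_image compact_cball)
  hence "bounded (d ` cball 0 (1/2))" by (rule compact_imp_bounded)
  then obtain B where "\<forall>x\<in>d ` cball 0 (1/2). norm x \<le> B" unfolding bounded_iff by blast
  hence B: "\<And>z. norm z \<le> 1/2 \<Longrightarrow> norm (d z) \<le> B" by simp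
  have B0: "0 \<le> B" using order_trans[OF norm_ge_zero B[of 0]] by simp
  have C10: "0 \<le> C1" using order_trans[OF norm_ge_zero C1[of 0]] by simp
  show ?thesis
  proof (rule that[OF k0 k, of "B + 2 * C1 + 1"])
    show "0 < B + 2 * C1 + 1" using B0 C10 by simp
    fix z :: complex assume z: "norm z < 1"
    have p: "1 \<le> (1 - norm z) powr (\<alpha> - k)"
    proof -
      have "(1 - norm z) powr (k - \<alpha>) \<le> 1 powr (k - \<alpha>)" using z k by (intro powr_mono2) auto
      thus ?thesis using z by (simp add: powr_diff field_simps)
    qed
    show "norm ((euler ^^ k) b z) \<le> (B + 2 * C1 + 1) * norm z * (1 - norm z) powr (\<alpha> - k)"
    proof (cases "norm z \<le> 1/2")
      case True
      have "norm ((euler ^^ k) b z) = norm z * norm (d z)" by (simp add: d norm_mult)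
      also have "\<dots> \<le> norm z * B" using B[OF True] by (intro mult_left_mono) auto
      also have "\<dots> \<le> (B + 2 * C1 + 1) * norm z * 1" using C10 by (simp add: algebra_simps)
      also have "\<dots> \<le> (B + 2 * C1 + 1) * norm z * (1 - norm z) powr (\<alpha> - k)"
        using p B0 C10 by (intro mult_left_mono) auto
      finally show ?thesis .
    next
      case False
      have "C1 * 1 \<le> C1 * (2 * norm z)" using False C10 by (intro mult_left_mono) auto
      also have "\<dots> \<le> (B + 2 * C1 + 1) * norm z" using B0 by (simp add: algebra_simps)
      finally have "C1 * (1 - norm z) powr (\<alpha> - k) \<le> (B + 2 * C1 + 1) * norm z * (1 - norm z) powr (\<alpha> - k)"
        by (intro mult_right_mono) auto
      thus ?thesis using C1[OF z] by simp
    qed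
  qed
qed

lemma lipschitz_disc_bounded:
  assumes "b \<in> lipschitz_disc \<alpha>"
  obtains B where "\<And>z. norm z < 1 \<Longrightarrow> norm (b z) \<le> B"
proof -
  obtain g where hol: "b holomorphic_on ball 0 1" and g: "g \<in> lipschitz_circle \<alpha>"
    and lim: "\<And>t. (b \<longlongrightarrow> g t) (at (cis t) within ball 0 1)"
    using assms by (auto simp: lipschitz_disc_def)
  obtain B where "\<And>t. norm (g t) \<le> B"
    using g unfolding lipschitz_circle_def bounded_iff by auto
  with maximum_modulus_boundary_limits[OF hol lim] that show ?thesis by blast
qed

section \<open>The truncated Hankel series\<close>

text \<open>The index \<open>(n, j)\<close> stands for the matrix entry in column \<open>n\<close> and row \<open>m = n + j\<close>: this
  parametrises the entries that the truncation keeps.\<close>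

definition hankel_term :: "(complex \<Rightarrow> complex) \<Rightarrow> complex \<Rightarrow> nat \<times> nat \<Rightarrow> complex" where
  "hankel_term f z = (\<lambda>(n, j). taylor_coeff f n * z ^ (n + j))"

text \<open>The function of \<open>\<zeta>\<close> that is obtained from the truncated Hankel series when \<open>b\<^sub>k\<close> is replaced by \<open>\<zeta>\<^sup>k\<close>.\<close>

definition hankel_weight :: "(complex \<Rightarrow> complex) \<Rightarrow> complex \<Rightarrow> complex \<Rightarrow> complex" where
  "hankel_weight f z \<zeta> = f (z * \<zeta>\<^sup>2) / (1 - z * \<zeta>)"

text \<open>The integral of \<open>\<bar>hankel_weight f z \<zeta>\<bar>\<close> over the disc in the coordinates \<open>\<bar>\<zeta>\<bar> = (1 - y)\<^sup>2\<close>. The square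
  keeps the weights bounded near the centre and lets the Cauchy kernel and the Poisson kernel in
  \<open>hankel_weight_le\<close> each use the radius \<open>1 - y\<close>.\<close>

definition hankel_mass :: "real \<Rightarrow> (complex \<Rightarrow> complex) \<Rightarrow> complex \<Rightarrow> ennreal" where
  "hankel_mass \<beta> f z = (\<integral>\<^sup>+y. ennreal (y powr \<beta>) *
     (\<integral>\<^sup>+x. norm (hankel_weight f z (of_real ((1 - y)\<^sup>2) * cis (- x))) \<partial>circ) \<partial>unit_interval)"

lemma taylor_has_sum:
  assumes f: "f holomorphic_on ball 0 1" and z: "norm z < 1"
  shows "summable (\<lambda>n. norm (taylor_coeff f n * z ^ n))" "((\<lambda>n. taylor_coeff f n * z ^ n) has_sum f z) UNIV"
proof -
  have sums: "(\<lambda>n. taylor_coeff f n * w ^ n) sums f w" if "norm w < 1" for w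
    using holomorphic_power_series[OF f, of w] that by (simp add: taylor_coeff_def)
  obtain R where R: "norm z < R" "R < 1" using dense z by blast
  have R0: "0 < R" using le_less_trans[OF norm_ge_zero R(1)] .
  hence "summable (\<lambda>n. taylor_coeff f n * of_real R ^ n)"
    using sums[of "of_real R"] R by (auto simp: sums_iff)
  thus *: "summable (\<lambda>n. norm (taylor_coeff f n * z ^ n))"
    by (rule powser_insidea) (use R R0 in simp)
  show "((\<lambda>n. taylor_coeff f n * z ^ n) has_sum f z) UNIV"
    by (rule norm_summable_imp_has_sum[OF * sums[OF z]])
qed

lemma geometric_has_sum:
  fixes z :: "'a :: {real_normed_field, banach}"
  assumes "norm z < 1"
  shows "((\<lambda>j. z ^ j) has_sum (1 / (1 - z))) UNIV"
  using assms by (intro norm_summable_imp_has_sum geometric_sums) (simp add: norm_power summable_geometric)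

lemma hankel_term_abs_summable:
  assumes f: "f holomorphic_on ball 0 1" and z: "norm z < 1"
  shows "(\<lambda>p. norm (hankel_term f z p)) summable_on UNIV"
proof -
  have inner: "((\<lambda>j. norm (hankel_term f z (n, j))) has_sum (norm (taylor_coeff f n * z ^ n) * (1 / (1 - norm z)))) UNIV" for n
  proof -
    have "((\<lambda>j. norm (taylor_coeff f n * z ^ n) * norm z ^ j) has_sum (norm (taylor_coeff f n * z ^ n) * (1 / (1 - norm z)))) UNIV"
      using z by (intro has_sum_cmult_right geometric_has_sum) simp
    thus ?thesis by (simp add: hankel_term_def norm_mult norm_power power_add mult.assoc)
  qed
  have "(\<lambda>p. norm (hankel_term f z p)) summable_on (SIGMA n:UNIV. UNIV)"
  proof (subst Infinite_Sum.abs_summable_on_Sigma_iff, intro conjI ballI)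
    show "(\<lambda>j. norm (hankel_term f z (n, j))) summable_on UNIV" for n
      using inner[of n] by (auto simp: summable_on_def)
    have "infsum (\<lambda>j. norm (hankel_term f z (n, j))) UNIV = norm (taylor_coeff f n * z ^ n) * (1 / (1 - norm z))" for n
      using inner[of n] by (rule infsumI)
    moreover have "summable (\<lambda>n. norm (norm (taylor_coeff f n * z ^ n) * (1 / (1 - norm z))))"
      using summable_mult2[OF taylor_has_sum(1)[OF f z], of "1 / (1 - norm z)"] z by (simp add: norm_mult norm_power)
    ultimately show "(\<lambda>n. norm (infsum (\<lambda>j. norm (hankel_term f z (n, j))) UNIV)) summable_on UNIV"
      by (simp add: norm_summable_imp_summable_on)
  qed
  thus ?thesis by simp
qed

lemma sums_prod_decode:
  assumes "(F has_sum S) UNIV"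
  shows "(\<lambda>i. F (prod_decode i)) sums S"
  using has_sum_reindex_bij_betw[OF bij_prod_decode, of F S] assms by (intro has_sum_imp_sums) simp

lemma hankel_weight_sums:
  assumes f: "f holomorphic_on ball 0 1" and z: "norm z < 1" and \<zeta>: "norm \<zeta> \<le> 1"
  shows "(\<lambda>i. case prod_decode i of (n, j) \<Rightarrow> hankel_term f z (n, j) * \<zeta> ^ (2 * n + j)) sums hankel_weight f z \<zeta>"
proof -
  define F where "F = (\<lambda>(n, j). hankel_term f z (n, j) * \<zeta> ^ (2 * n + j))"
  have zz: "norm (z * \<zeta>) < 1" "norm (z * \<zeta>\<^sup>2) < 1"
    using z \<zeta> mult_mono[of "norm z" "norm z" "norm \<zeta>" 1] mult_mono[of "norm z" "norm z" "norm \<zeta> ^ 2" 1]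
    by (auto simp: norm_mult norm_power power_le_one)
  have "F summable_on UNIV"
  proof (rule abs_summable_summable, rule Infinite_Sum.abs_summable_on_comparison_test)
    show "(\<lambda>p. norm (hankel_term f z p)) summable_on UNIV" by (rule hankel_term_abs_summable[OF f z])
    show "norm (F p) \<le> norm (hankel_term f z p)" for p
      using \<zeta> by (cases p) (auto simp: F_def norm_mult norm_power power_le_one intro!: mult_left_le)
  qed
  moreover have "((\<lambda>j. F (n, j)) has_sum (taylor_coeff f n * (z * \<zeta>\<^sup>2) ^ n * (1 / (1 - z * \<zeta>)))) UNIV" for n
  proof -
    have "((\<lambda>j. taylor_coeff f n * (z * \<zeta>\<^sup>2) ^ n * (z * \<zeta>) ^ j) has_sum (taylor_coeff f n * (z * \<zeta>\<^sup>2) ^ n * (1 / (1 - z * \<zeta>)))) UNIV"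
      by (intro has_sum_cmult_right geometric_has_sum zz)
    moreover have "F (n, j) = taylor_coeff f n * (z * \<zeta>\<^sup>2) ^ n * (z * \<zeta>) ^ j" for j
    proof -
      have e: "\<zeta> ^ (2 * n + j) = (\<zeta>\<^sup>2) ^ n * \<zeta> ^ j" by (simp only: power_add power_mult)
      show ?thesis
        by (simp only: F_def hankel_term_def prod.case e) (simp only: power_mult_distrib power_add mult_ac)
    qed
    ultimately show ?thesis by simp
  qed
  moreover have "((\<lambda>n. taylor_coeff f n * (z * \<zeta>\<^sup>2) ^ n * (1 / (1 - z * \<zeta>))) has_sum (f (z * \<zeta>\<^sup>2) * (1 / (1 - z * \<zeta>)))) UNIV"
    by (intro has_sum_cmult_left taylor_has_sum(2) f zz)
  ultimately have "(F has_sum (f (z * \<zeta>\<^sup>2) * (1 / (1 - z * \<zeta>)))) (SIGMA n:UNIV. UNIV)"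
    by (intro has_sum_SigmaI[where g="\<lambda>n. taylor_coeff f n * (z * \<zeta>\<^sup>2) ^ n * (1 / (1 - z * \<zeta>))"]) auto
  hence "(F has_sum hankel_weight f z \<zeta>) UNIV" by (simp add: hankel_weight_def)
  from sums_prod_decode[OF this] show ?thesis by (simp add: F_def)
qed

lemma truncated_row_sum:
  "(\<lambda>n. truncate_1_0 (hankel_matrix b) m n * a n) sums (\<Sum>n\<le>m. taylor_coeff b (m + n) * a n)"
proof -
  have "(\<lambda>n. truncate_1_0 (hankel_matrix b) m n * a n) sums (\<Sum>n\<le>m. truncate_1_0 (hankel_matrix b) m n * a n)"
    by (rule sums_finite) (auto simp: truncate_1_0_def)
  also have "(\<Sum>n\<le>m. truncate_1_0 (hankel_matrix b) m n * a n) = (\<Sum>n\<le>m. taylor_coeff b (m + n) * a n)"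
    by (intro sum.cong) (auto simp: truncate_1_0_def hankel_matrix_def)
  finally show ?thesis .
qed

text \<open>Both sides sum the same absolutely convergent family over the pairs \<open>(n, j)\<close>, once by rows \<open>m = n + j\<close>
  and once in the enumeration \<open>prod_decode\<close>, which turns the double series into a single one.\<close>

lemma hankel_series:
  assumes f: "f holomorphic_on ball 0 1" and z: "norm z < 1" and B: "\<And>k. norm (taylor_coeff b k) \<le> B"
  shows "summable (\<lambda>m. (\<Sum>n\<le>m. taylor_coeff b (m + n) * taylor_coeff f n) * z ^ m)"
    and "(\<lambda>i. case prod_decode i of (n, j) \<Rightarrow> hankel_term f z (n, j) * taylor_coeff b (2 * n + j))
      sums (\<Sum>m. (\<Sum>n\<le>m. taylor_coeff b (m + n) * taylor_coeff f n) * z ^ m)"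
proof -
  define F where "F = (\<lambda>(n, j). hankel_term f z (n, j) * taylor_coeff b (2 * n + j))"
  have "F summable_on UNIV"
  proof (rule abs_summable_summable, rule Infinite_Sum.abs_summable_on_comparison_test)
    have "(\<lambda>p. B * norm (hankel_term f z p)) summable_on UNIV"
      by (intro summable_on_cmult_right hankel_term_abs_summable[OF f z])
    moreover have "0 \<le> B" using order_trans[OF norm_ge_zero B] .
    ultimately show "(\<lambda>p. norm (of_real B * hankel_term f z p)) summable_on UNIV" by (simp add: norm_mult)
    show "norm (F p) \<le> norm (of_real B * hankel_term f z p)" for p
    proof (cases p)
      case (Pair n j)
      show ?thesis using B[of "2 * n + j"] \<open>0 \<le> B\<close>
        by (simp add: Pair F_def norm_mult mult.commute[of B] mult_left_mono)
    qed
  qed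
  then obtain S where S: "(F has_sum S) UNIV" by (auto simp: summable_on_def)
  have "((\<lambda>(m, n). F (n, m - n)) has_sum S) (SIGMA m:UNIV. {..m})"
  proof (subst has_sum_reindex_bij_witness[where j="\<lambda>(m, n). (n, m - n)" and i="\<lambda>(n, j). (n + j, n)" and h=F and T=UNIV])
    show "(F has_sum S) UNIV" by (rule S)
  qed auto
  moreover have "((\<lambda>n. case (m, n) of (m, n) \<Rightarrow> F (n, m - n)) has_sum
      ((\<Sum>n\<le>m. taylor_coeff b (m + n) * taylor_coeff f n) * z ^ m)) {..m}" for m
  proof -
    have "((\<lambda>n. F (n, m - n)) has_sum (\<Sum>n\<le>m. F (n, m - n))) {..m}" by (rule has_sum_finite) simp
    also have "(\<Sum>n\<le>m. F (n, m - n)) = (\<Sum>n\<le>m. taylor_coeff b (m + n) * taylor_coeff f n) * z ^ m"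
      unfolding sum_distrib_right
      by (intro sum.cong) (auto simp: F_def hankel_term_def mult_2 add.assoc add.commute mult_ac)
    finally show ?thesis by simp
  qed
  ultimately have "((\<lambda>m. (\<Sum>n\<le>m. taylor_coeff b (m + n) * taylor_coeff f n) * z ^ m) has_sum S) UNIV"
    by (rule has_sum_Sigma')
  hence sums: "(\<lambda>m. (\<Sum>n\<le>m. taylor_coeff b (m + n) * taylor_coeff f n) * z ^ m) sums S"
    by (rule has_sum_imp_sums)
  thus "summable (\<lambda>m. (\<Sum>n\<le>m. taylor_coeff b (m + n) * taylor_coeff f n) * z ^ m)" by (rule sums_summable)
  show "(\<lambda>i. case prod_decode i of (n, j) \<Rightarrow> hankel_term f z (n, j) * taylor_coeff b (2 * n + j))
      sums (\<Sum>m. (\<Sum>n\<le>m. taylor_coeff b (m + n) * taylor_coeff f n) * z ^ m)"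
    using sums_prod_decode[OF S] sums_unique[OF sums] by (simp add: F_def)
qed

section \<open>Taylor coefficients and logarithmic moments\<close>

lemma taylor_coeff_circle:
  assumes F: "F holomorphic_on ball 0 1" and R: "0 < R" "R < 1"
  shows "(LINT x|circ. F (of_real R * cis x) * (of_real R * cis (- x)) ^ k) = taylor_coeff F k * of_real R ^ (2 * k)"
proof -
  have sub: "cball 0 R \<subseteq> ball (0::complex) 1" using R by auto
  have cont: "continuous_on (cball 0 R) F"
    by (rule continuous_on_subset[OF holomorphic_on_imp_continuous_on[OF F] sub])
  have "((\<lambda>u. F u / (u - 0) ^ Suc k) has_contour_integral 2 * pi * \<i> / fact k * (deriv ^^ k) F 0) (circlepath 0 R)"
    by (rule Cauchy_has_contour_integral_higher_derivative_circlepath[OF cont])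
       (use R holomorphic_on_subset[OF F subset_trans[OF ball_subset_cball sub]] in auto)
  hence "2 * pi * \<i> * taylor_coeff F k = contour_integral (circlepath 0 R) (\<lambda>u. F u / u ^ Suc k)"
    using contour_integral_unique by (fastforce simp: taylor_coeff_def)
  also have "\<dots> = integral {0..2 * pi} (\<lambda>x. F (of_real R * cis x) / (of_real R * cis x) ^ Suc k * of_real R * \<i> * cis x)"
    unfolding circlepath_def by (subst contour_integral_part_circlepath_eq) auto
  also have "(\<lambda>x. F (of_real R * cis x) / (of_real R * cis x) ^ Suc k * of_real R * \<i> * cis x)
    = (\<lambda>x. \<i> / of_real R ^ (2 * k) * (F (of_real R * cis x) * (of_real R * cis (- x)) ^ k))"
  proof
    fix x
    define c where "c = cis x"
    have c: "c \<noteq> 0" "cis (- x) = inverse c" by (auto simp: c_def)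
    show "F (of_real R * cis x) / (of_real R * cis x) ^ Suc k * of_real R * \<i> * cis x
       = \<i> / of_real R ^ (2 * k) * (F (of_real R * cis x) * (of_real R * cis (- x)) ^ k)"
      using R c(1) unfolding c(2) c_def[symmetric]
      by (simp add: field_simps power_mult_distrib power_inverse power_mult power2_eq_square)
  qed
  also have "integral {0..2 * pi} \<dots> = (2 * pi) *\<^sub>R (LINT x|circ. \<i> / of_real R ^ (2 * k) * (F (of_real R * cis x) * (of_real R * cis (- x)) ^ k))"
  proof (rule integral_circ)
    have "continuous_on UNIV (\<lambda>x. F (of_real R * cis x))"
      by (rule continuous_on_compose2[OF cont]) (use R in \<open>auto intro!: continuous_intros simp: norm_mult\<close>)
    thus "continuous_on UNIV (\<lambda>x. \<i> / of_real R ^ (2 * k) * (F (of_real R * cis x) * (of_real R * cis (- x)) ^ k))"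
      by (intro continuous_intros)
  qed
  also have "\<dots> = 2 * pi * \<i> * ((LINT x|circ. F (of_real R * cis x) * (of_real R * cis (- x)) ^ k) / of_real R ^ (2 * k))"
    by (simp add: scaleR_conv_of_real)
  finally have eq: "2 * pi * \<i> * taylor_coeff F k = 2 * pi * \<i> * ((LINT x|circ. F (of_real R * cis x) * (of_real R * cis (- x)) ^ k) / of_real R ^ (2 * k))" .
  have ne: "complex_of_real (2 * pi) * \<i> \<noteq> 0" by simp
  from iffD1[OF mult_left_cancel[OF ne] eq]
  have "taylor_coeff F k = (LINT x|circ. F (of_real R * cis x) * (of_real R * cis (- x)) ^ k) / of_real R ^ (2 * k)"
    .
  thus ?thesis using R by (simp add: field_simps)
qed

lemma taylor_coeff_euler:
  assumes F: "F holomorphic_on ball 0 1"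
  shows "taylor_coeff (euler F) k = of_nat k * taylor_coeff F k"
proof (cases k)
  case 0 thus ?thesis by (simp add: taylor_coeff_def euler_def)
next
  case (Suc j)
  have dF: "deriv F holomorphic_on ball 0 1" using F by (intro holomorphic_deriv) auto
  have "(deriv ^^ k) (euler F) 0 = (\<Sum>i = 0..k. of_nat (k choose i) * (deriv ^^ i) (\<lambda>w. w) 0 * (deriv ^^ (k - i)) (deriv F) 0)"
    unfolding euler_def using dF by (intro higher_deriv_mult[where S="ball 0 1"]) auto
  also have "\<dots> = (\<Sum>i\<in>{1}. of_nat (k choose i) * (deriv ^^ i) (\<lambda>w. w) 0 * (deriv ^^ (k - i)) (deriv F) 0)"
    by (rule sum.mono_neutral_right) (auto simp: Suc)
  also have "\<dots> = of_nat k * (deriv ^^ k) F 0"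
    by (simp add: Suc funpow_swap1 del: funpow.simps) (simp add: funpow_swap1)
  finally show ?thesis by (simp add: taylor_coeff_def)
qed

lemma taylor_coeff_euler_power:
  assumes F: "F holomorphic_on ball 0 1"
  shows "taylor_coeff ((euler ^^ m) F) k = of_nat k ^ m * taylor_coeff F k"
  by (induction m) (auto simp: taylor_coeff_euler holomorphic_euler_power[OF F])

lemma taylor_coeff_bounded:
  assumes F: "F holomorphic_on ball 0 1" and B: "\<And>z. norm z < 1 \<Longrightarrow> norm (F z) \<le> B"
  shows "norm (taylor_coeff F k) \<le> B"
proof -
  have "norm (taylor_coeff F k) * R ^ k \<le> B" if R: "0 < R" "R < 1" for R
  proof -
    have sub: "cball 0 R \<subseteq> ball (0::complex) 1" using R by auto
    have "norm ((deriv ^^ k) F 0) \<le> fact k * B / R ^ k"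
    proof (rule Cauchy_inequality)
      show "F holomorphic_on ball 0 R" by (rule holomorphic_on_subset[OF F subset_trans[OF ball_subset_cball sub]])
      show "continuous_on (cball 0 R) F"
        by (rule continuous_on_subset[OF holomorphic_on_imp_continuous_on[OF F] sub])
      show "norm (F x) \<le> B" if "norm (0 - x) = R" for x using that R by (intro B) simp
    qed (use R in auto)
    thus ?thesis using R by (simp add: taylor_coeff_def norm_divide field_simps)
  qed
  note main = this
  show ?thesis
  proof (rule tendsto_upperbound)
    have "((\<lambda>R. norm (taylor_coeff F k) * R ^ k) \<longlongrightarrow> norm (taylor_coeff F k) * 1 ^ k) (at_left (1::real))"
      by (intro tendsto_intros)
    thus "((\<lambda>R. norm (taylor_coeff F k) * R ^ k) \<longlongrightarrow> norm (taylor_coeff F k)) (at_left (1::real))" by simp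
    show "\<forall>\<^sub>F R in at_left 1. norm (taylor_coeff F k) * R ^ k \<le> B"
      using eventually_at_left_real[of 0 "1::real"] by (rule eventually_mono) (auto intro: main)
  qed auto
qed

text \<open>Integration by parts lowers the power of the logarithm: the derivative of
  \<open>(1 - y)\<^sup>s (- ln (1 - y))\<^bsup>j + 1\<^esup>\<close> combines the two integrands, and this function vanishes at both
  ends.\<close>

lemma log_moment_has_integral:
  fixes s j :: nat
  assumes s: "1 \<le> s"
  shows "((\<lambda>y::real. (1 - y) ^ (s - 1) * (- ln (1 - y)) ^ j) has_integral (fact j / real s ^ Suc j)) {0..1}"
proof (induction j)
  case 0
  have "((\<lambda>y::real. (1 - y) ^ (s - 1)) has_integral (- ((1 - 1) ^ s / s) - (- ((1 - 0) ^ s / s)))) {0..1}"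
    using s by (intro fundamental_theorem_of_calculus)
      (auto intro!: derivative_eq_intros simp flip: has_real_derivative_iff_has_vector_derivative)
  thus ?case using s by (simp add: power_0_left)
next
  case (Suc j)
  define F where "F = (\<lambda>y::real. (1 - y) ^ s * (- ln (1 - y)) ^ Suc j)"
  define G where "G = (\<lambda>y::real. - (real s * ((1 - y) ^ (s - 1) * (- ln (1 - y)) ^ Suc j)) + Suc j * ((1 - y) ^ (s - 1) * (- ln (1 - y)) ^ j))"
  have "(G has_integral (F 1 - F 0)) {0..1}"
  proof (rule fundamental_theorem_of_calculus_interior)
    have cont: "F \<midarrow>y\<rightarrow> F y" if "y < 1" for y
      using that unfolding F_def by (intro isContD continuous_intros) auto
    moreover have "(F \<longlongrightarrow> F 1) (at_left 1)"
    proof -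
      have "(F \<longlongrightarrow> 0) (at_left 1)" unfolding F_def using s by real_asymp
      thus ?thesis by (simp add: F_def)
    qed
    ultimately show "continuous_on {0..1} F"
    proof (intro continuous_on_IccI)
      show "(F \<longlongrightarrow> F 0) (at_right 0)"
        by (rule filterlim_mono[OF cont[of 0] order_refl at_le]) auto
    qed (use cont in auto)
    fix y :: real assume y: "y \<in> {0<..<1}"
    have "((\<lambda>y. - ln (1 - y)) has_real_derivative 1 / (1 - y)) (at y)"
      using y by (auto intro!: derivative_eq_intros)
    from DERIV_power[OF this, of "Suc j"]
    have d2: "((\<lambda>y. (- ln (1 - y)) ^ Suc j) has_real_derivative Suc j * (1 / (1 - y) * (- ln (1 - y)) ^ j)) (at y)"
      by simp
    have d1: "((\<lambda>y. (1 - y) ^ s) has_real_derivative - (real s * (1 - y) ^ (s - 1))) (at y)"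
      by (auto intro!: derivative_eq_intros)
    have "(1 - y) ^ s = (1 - y) * (1 - y) ^ (s - 1)" using s by (metis Suc_diff_1 less_eq_Suc_le One_nat_def power_Suc)
    hence "1 / (1 - y) * (1 - y) ^ s = (1 - y) ^ (s - 1)" using y by simp
    hence "Suc j * (1 / (1 - y) * (- ln (1 - y)) ^ j) * (1 - y) ^ s = Suc j * ((1 - y) ^ (s - 1) * (- ln (1 - y)) ^ j)"
      by (metis mult.assoc mult.commute)
    with DERIV_mult[OF d1 d2] have "(F has_real_derivative G y) (at y)"
      by (simp add: F_def G_def mult_ac)
    thus "(F has_vector_derivative G y) (at y)" by (simp add: has_real_derivative_iff_has_vector_derivative)
  qed auto
  hence "(G has_integral 0) {0..1}" using s by (simp add: F_def power_0_left)
  from has_integral_diff[OF has_integral_mult_right[OF Suc, of "Suc j"] this]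
  have "((\<lambda>y. real s * ((1 - y) ^ (s - 1) * (- ln (1 - y)) ^ Suc j)) has_integral (Suc j * (fact j / real s ^ Suc j))) {0..1}"
    by (simp add: G_def)
  from has_integral_mult_right[OF this, of "1 / real s"] show ?case using s by (simp add: field_simps)
qed

section \<open>Integral representation of the truncated Hankel operator\<close>

lemma log_le_times:
  fixes \<omega> :: real
  assumes "0 < \<omega>" "\<omega> < 1"
  shows "- ln \<omega> \<le> (1 - \<omega>) * (1 - ln \<omega>)"
proof -
  have "1 - ln \<omega> \<le> exp (- ln \<omega>)" using exp_ge_add_one_self[of "- ln \<omega>"] by simp
  also have "\<dots> = 1 / \<omega>" using assms by (simp add: exp_minus divide_inverse)
  finally have "\<omega> * (1 - ln \<omega>) \<le> 1" using assms by (simp add: field_simps)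
  thus ?thesis by (simp add: algebra_simps)
qed

text \<open>The weight from the logarithmic moments is comparable with a power of \<open>y\<close>. The factor \<open>1 - y\<close>
  compensates the logarithm near \<open>y = 1\<close>: with \<open>t = - ln (1 - y)\<close> one has \<open>t \<le> y * (1 + t)\<close>, and
  \<open>(1 + t)\<^sup>k \<le> k\<^sup>k * exp t\<close>.\<close>

lemma log_power_le:
  fixes y :: real
  assumes y: "0 < y" "y < 1" and k: "0 < k"
  shows "(1 - y) * (- ln (1 - y)) ^ (k - 1) \<le> real k ^ k * y ^ (k - 1)"
proof -
  define t where "t = - ln (1 - y)"
  have t: "0 \<le> t" "t \<le> y * (1 + t)" using log_le_times[of "1 - y"] y by (auto simp: t_def)
  have "1 + t \<le> real k * (1 + t / k)" using k t by (simp add: field_simps)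
  also have "\<dots> \<le> real k * exp (t / k)" by (intro mult_left_mono exp_ge_add_one_self) auto
  finally have "(1 + t) ^ k \<le> (real k * exp (t / k)) ^ k" using t by (intro power_mono) auto
  also have "\<dots> = real k ^ k * exp t" using k by (simp add: power_mult_distrib exp_of_nat_mult[symmetric])
  finally have 1: "(1 + t) ^ k \<le> real k ^ k * exp t" .
  have "(1 - y) * t ^ (k - 1) \<le> (1 - y) * (y * (1 + t)) ^ (k - 1)"
    using t y by (intro mult_left_mono power_mono) auto
  also have "\<dots> = (1 - y) * (y ^ (k - 1) * (1 + t) ^ (k - 1))" by (simp add: power_mult_distrib)
  also have "\<dots> \<le> (1 - y) * (y ^ (k - 1) * (1 + t) ^ k)"
    using t y by (intro mult_left_mono power_increasing) auto
  also have "\<dots> \<le> (1 - y) * (y ^ (k - 1) * (real k ^ k * exp t))"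
    using 1 y by (intro mult_left_mono) auto
  also have "exp t = 1 / (1 - y)" using y by (simp add: t_def exp_minus divide_inverse)
  finally show ?thesis using y by (simp add: t_def mult.commute)
qed

text \<open>A holomorphic function on the disc may be arbitrary outside; this version is Borel measurable.\<close>

definition zero_ext :: "(complex \<Rightarrow> complex) \<Rightarrow> complex \<Rightarrow> complex" where
  "zero_ext F = (\<lambda>z. indicator (ball 0 1) z *\<^sub>R F z)"

lemma zero_ext_eq: "norm z < 1 \<Longrightarrow> zero_ext F z = F z"
  by (simp add: zero_ext_def)

lemma zero_ext_measurable:
  assumes "F holomorphic_on ball 0 1"
  shows "zero_ext F \<in> borel_measurable borel"
  unfolding zero_ext_def
  by (intro borel_measurable_continuous_on_indicator holomorphic_on_imp_continuous_on[OF assms]) auto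

lemma cis_measurable [measurable (raw)]:
  "f \<in> borel_measurable M \<Longrightarrow> (\<lambda>x. cis (f x)) \<in> borel_measurable M"
  by (rule borel_measurable_continuous_on[where f=cis]) (auto intro!: continuous_intros)

interpretation unit_circ: pair_sigma_finite unit_interval circ ..

lemma norm_scaled_cis: "0 \<le> R \<Longrightarrow> norm (of_real R * cis x) = R"
  by (simp add: norm_mult)

text \<open>For \<open>i \<ge> 1\<close>, integrating the \<open>k\<close>-th power of the Euler operator of \<open>b\<close> at \<open>(1 - y)\<^sup>2 * cis x\<close> against the
  power \<open>((1 - y)\<^sup>2 * cis (- x))\<^sup>i\<close> over the circle, and then against a logarithmic weight in \<open>y\<close>, gives
  \<open>\<gamma>\<close> times the Taylor coefficient of \<open>b\<close> with index \<open>i\<close>, where \<open>\<gamma> = (k - 1)! / 4\<^sup>k\<close>. Summing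
  these identities over all terms of the truncated Hankel series replaces the powers by \<open>hankel_weight\<close>.
  The term of index zero is killed by the Euler operator and appears separately as \<open>B * norm (f 0)\<close>.\<close>

lemma representation_bound:
  fixes b :: "complex \<Rightarrow> complex"
  assumes b: "b holomorphic_on ball 0 1" and B: "\<And>z. norm z < 1 \<Longrightarrow> norm (b z) \<le> B"
    and k: "0 < k" and \<alpha>: "0 < \<alpha>" "\<alpha> < real k" and C: "0 < C"
    and e: "\<And>z. norm z < 1 \<Longrightarrow> norm ((euler ^^ k) b z) \<le> C * norm z * (1 - norm z) powr (\<alpha> - k)"
  obtains C' where "0 < C'" "\<And>f z. \<lbrakk>f holomorphic_on ball 0 1; norm z < 1\<rbrakk> \<Longrightarrow>
     ennreal (norm (\<Sum>m. (\<Sum>n\<le>m. taylor_coeff b (m + n) * taylor_coeff f n) * z ^ m)) \<le>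
       ennreal (B * norm (f 0)) + ennreal C' * hankel_mass (\<alpha> - 1) f z"
proof -
  define E where "E = zero_ext ((euler ^^ k) b)"
  have hol: "(euler ^^ k) b holomorphic_on ball 0 1" by (rule holomorphic_euler_power[OF b])
  have [measurable]: "E \<in> borel_measurable borel" unfolding E_def by (rule zero_ext_measurable[OF hol])
  \<comment> \<open>the logarithmic weight whose integral against \<open>(1 - y) ^ (4 * i)\<close> is \<open>(k - 1)! / (4 * i)\<^sup>k\<close>\<close>
  define w where "w = (\<lambda>y::real. (- ln (1 - y)) ^ (k - 1) / (1 - y))"
  have [measurable]: "w \<in> borel_measurable borel" unfolding w_def by measurable
  define \<zeta> where "\<zeta> = (\<lambda>y x. complex_of_real ((1 - y)\<^sup>2) * cis (- x))"
  have \<zeta>_norm: "norm (\<zeta> y x) \<le> 1" if "0 < y" "y < 1" for y x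
    unfolding \<zeta>_def norm_scaled_cis[OF zero_le_power2] using that by (intro power_le_one) auto
  define \<Psi> where "\<Psi> = (\<lambda>i (y, x). complex_of_real (w y) * E (of_real ((1 - y)\<^sup>2) * cis x) * \<zeta> y x ^ i)"
  have [measurable]: "\<Psi> i \<in> borel_measurable (unit_interval \<Otimes>\<^sub>M circ)" for i
    unfolding \<Psi>_def \<zeta>_def by measurable
  define K where "K = C * real k ^ k"
  have K: "0 < K" using C k by (simp add: K_def)
  have w0: "0 \<le> w y" if "0 < y" "y < 1" for y using that by (simp add: w_def)
  have wE: "w y * norm (E (of_real ((1 - y)\<^sup>2) * cis x)) \<le> K * y powr (\<alpha> - 1)" if y: "0 < y" "y < 1" for y x
  proof -
    have n: "norm (complex_of_real ((1 - y)\<^sup>2) * cis x) = (1 - y)\<^sup>2" by (rule norm_scaled_cis) simp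
    have lt: "(1 - y)\<^sup>2 < 1" using power_strict_mono[of "1 - y" 1 2] y by simp
    have ge: "y \<le> 1 - (1 - y)\<^sup>2" using y by (simp add: power2_eq_square algebra_simps mult_left_le)
    have "norm (E (of_real ((1 - y)\<^sup>2) * cis x)) \<le> C * (1 - y)\<^sup>2 * (1 - (1 - y)\<^sup>2) powr (\<alpha> - k)"
      using e[of "of_real ((1 - y)\<^sup>2) * cis x"] lt unfolding E_def by (subst zero_ext_eq) (simp_all only: n)
    also have "\<dots> \<le> C * (1 - y)\<^sup>2 * y powr (\<alpha> - k)"
      using ge y \<alpha> C by (intro mult_left_mono powr_mono2') auto
    finally have "w y * norm (E (of_real ((1 - y)\<^sup>2) * cis x)) \<le> w y * (C * (1 - y)\<^sup>2 * y powr (\<alpha> - k))"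
      using w0[OF y] by (intro mult_left_mono) auto
    also have "\<dots> = C * y powr (\<alpha> - k) * ((1 - y) * (- ln (1 - y)) ^ (k - 1))"
      using y by (simp add: w_def power2_eq_square)
    also have "\<dots> \<le> C * y powr (\<alpha> - k) * (real k ^ k * y ^ (k - 1))"
      using log_power_le[OF y k] C by (intro mult_left_mono) auto
    also have "y ^ (k - 1) = y powr (k - 1)" using y k powr_realpow[of y "k - 1"] by (simp add: of_nat_diff)
    also have "C * y powr (\<alpha> - k) * (real k ^ k * y powr (k - 1)) = K * (y powr (\<alpha> - k) * y powr (k - 1))"
      by (simp add: K_def)
    also have "y powr (\<alpha> - k) * y powr (k - 1) = y powr (\<alpha> - 1)"
      using k by (simp add: powr_add[symmetric] of_nat_diff)
    finally show ?thesis .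
  qed
  have AEp: "AE p in unit_interval \<Otimes>\<^sub>M circ. 0 < fst p \<and> fst p < 1"
  proof (rule unit_circ.AE_pair_measure)
    show "AE y in unit_interval. AE x in circ. 0 < fst (y, x) \<and> fst (y, x) < 1"
      using AE_unit by eventually_elim simp
  qed measurable
  have pw: "(\<integral>\<^sup>+y. ennreal (y powr (\<alpha> - 1)) \<partial>unit_interval) \<le> ennreal (1 / \<alpha>)"
  proof -
    have "(\<integral>\<^sup>+y. ennreal (y powr (\<alpha> - 1)) \<partial>unit_interval) = (\<integral>\<^sup>+y. ennreal (y powr (\<alpha> - 1)) * indicator {..1} y \<partial>unit_interval)"
      by (intro nn_integral_cong_AE, rule eventually_mono[OF AE_unit]) auto
    also have "\<dots> \<le> ennreal (1 powr (\<alpha> - 1 + 1) / (\<alpha> - 1 + 1))"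
      using \<alpha> by (intro nn_integral_unit_powr_near_0) auto
    finally show ?thesis by simp
  qed
  have nnw: "(\<integral>\<^sup>+p. ennreal (K * fst p powr (\<alpha> - 1)) \<partial>(unit_interval \<Otimes>\<^sub>M circ)) \<le> ennreal (K / \<alpha>)"
  proof -
    have "(\<integral>\<^sup>+p. ennreal (K * fst p powr (\<alpha> - 1)) \<partial>(unit_interval \<Otimes>\<^sub>M circ)) = (\<integral>\<^sup>+y. \<integral>\<^sup>+x. ennreal (K * y powr (\<alpha> - 1)) \<partial>circ \<partial>unit_interval)"
      by (subst circ.nn_integral_fst[symmetric]) auto
    also have "\<dots> = (\<integral>\<^sup>+y. ennreal K * ennreal (y powr (\<alpha> - 1)) \<partial>unit_interval)"
      using K by (simp add: circ.emeasure_space_1[simplified] ennreal_mult')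
    also have "\<dots> = ennreal K * (\<integral>\<^sup>+y. ennreal (y powr (\<alpha> - 1)) \<partial>unit_interval)"
      by (rule nn_integral_cmult) auto
    also have "\<dots> \<le> ennreal K * ennreal (1 / \<alpha>)" by (intro mult_left_mono pw) auto
    also have "\<dots> = ennreal (K / \<alpha>)" using K by (simp add: ennreal_mult'[symmetric])
    finally show ?thesis .
  qed
  have norm_\<Psi>: "norm (\<Psi> i p) \<le> K * fst p powr (\<alpha> - 1)" if "0 < fst p" "fst p < 1" for i p
  proof -
    obtain y x where p: "p = (y, x)" by force
    have "norm (\<Psi> i p) = w y * norm (E (of_real ((1 - y)\<^sup>2) * cis x)) * norm (\<zeta> y x) ^ i"
      using w0[of y] that by (simp add: p \<Psi>_def norm_mult norm_power)
    also have "\<dots> \<le> K * y powr (\<alpha> - 1) * 1"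
    proof (rule mult_mono)
      show "w y * norm (E (of_real ((1 - y)\<^sup>2) * cis x)) \<le> K * y powr (\<alpha> - 1)"
        using wE that by (simp only: p fst_conv)
      show "norm (\<zeta> y x) ^ i \<le> 1"
        using \<zeta>_norm[of y x] that by (intro power_le_one) (auto simp: p)
    qed (use K in auto)
    finally show ?thesis by (simp add: p)
  qed
  have int_w: "integrable (unit_interval \<Otimes>\<^sub>M circ) (\<lambda>p. K * fst p powr (\<alpha> - 1))"
  proof (rule integrableI_bounded)
    have "(\<integral>\<^sup>+p. ennreal (norm (K * fst p powr (\<alpha> - 1))) \<partial>(unit_interval \<Otimes>\<^sub>M circ)) \<le> ennreal (K / \<alpha>)"
      using nnw K by (simp add: abs_mult)
    thus "(\<integral>\<^sup>+p. ennreal (norm (K * fst p powr (\<alpha> - 1))) \<partial>(unit_interval \<Otimes>\<^sub>M circ)) < \<infinity>"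
      by (rule le_less_trans) simp
  qed measurable
  have int_\<Psi>: "integrable (unit_interval \<Otimes>\<^sub>M circ) (\<Psi> i)" for i
  proof (rule Bochner_Integration.integrable_bound[OF int_w])
    show "AE p in unit_interval \<Otimes>\<^sub>M circ. norm (\<Psi> i p) \<le> norm (K * fst p powr (\<alpha> - 1))"
      using AEp by (rule eventually_mono) (use norm_\<Psi> K in \<open>auto simp: abs_mult\<close>)
  qed measurable
  have norm_int_\<Psi>: "(LINT p|(unit_interval \<Otimes>\<^sub>M circ). norm (\<Psi> i p)) \<le> (LINT p|(unit_interval \<Otimes>\<^sub>M circ). K * fst p powr (\<alpha> - 1))" for i
  proof (rule integral_mono_AE)
    show "AE p in unit_interval \<Otimes>\<^sub>M circ. norm (\<Psi> i p) \<le> K * fst p powr (\<alpha> - 1)"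
      using AEp by (rule eventually_mono) (use norm_\<Psi> in auto)
  qed (use int_w int_\<Psi> in auto)
  define \<gamma> where "\<gamma> = fact (k - 1) / (4::real) ^ k"
  have \<gamma>: "0 < \<gamma>" by (simp add: \<gamma>_def)
  \<comment> \<open>the reproducing identity for single powers\<close>
  have val: "(LINT p|(unit_interval \<Otimes>\<^sub>M circ). \<Psi> i p) = (if i = 0 then 0 else of_real \<gamma> * taylor_coeff b i)" for i
  proof -
    have "(LINT p|(unit_interval \<Otimes>\<^sub>M circ). \<Psi> i p) = (LINT y|unit_interval. LINT x|circ. \<Psi> i (y, x))"
      by (rule unit_circ.integral_fst'[symmetric, OF int_\<Psi>])
    also have "\<dots> = (LINT y|unit_interval. of_real (w y * (1 - y) ^ (4 * i)) * (of_nat i ^ k * taylor_coeff b i))"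
    proof (rule integral_cong_AE)
      show "AE y in unit_interval. (LINT x|circ. \<Psi> i (y, x)) = of_real (w y * (1 - y) ^ (4 * i)) * (of_nat i ^ k * taylor_coeff b i)"
        using AE_unit
      proof eventually_elim
        case (elim y)
        have lt: "0 < (1 - y)\<^sup>2" "(1 - y)\<^sup>2 < 1" using power_strict_mono[of "1 - y" 1 2] elim by auto
        have "(LINT x|circ. \<Psi> i (y, x)) = (LINT x|circ. of_real (w y) * ((euler ^^ k) b (of_real ((1 - y)\<^sup>2) * cis x) * (of_real ((1 - y)\<^sup>2) * cis (- x)) ^ i))"
        proof (rule Bochner_Integration.integral_cong)
          fix x
          have "E (of_real ((1 - y)\<^sup>2) * cis x) = (euler ^^ k) b (of_real ((1 - y)\<^sup>2) * cis x)"
            unfolding E_def by (rule zero_ext_eq) (use lt norm_scaled_cis[of "(1-y)\<^sup>2" x] in simp)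
          thus "\<Psi> i (y, x) = of_real (w y) * ((euler ^^ k) b (of_real ((1 - y)\<^sup>2) * cis x) * (of_real ((1 - y)\<^sup>2) * cis (- x)) ^ i)"
            unfolding \<Psi>_def \<zeta>_def prod.case by (simp only: mult.assoc)
        qed simp
        also have "\<dots> = of_real (w y) * (LINT x|circ. (euler ^^ k) b (of_real ((1 - y)\<^sup>2) * cis x) * (of_real ((1 - y)\<^sup>2) * cis (- x)) ^ i)"
          by (rule integral_mult_right_zero)
        also have "\<dots> = of_real (w y) * (of_nat i ^ k * taylor_coeff b i * of_real ((1 - y)\<^sup>2) ^ (2 * i))"
          by (subst taylor_coeff_circle[OF hol lt]) (simp add: taylor_coeff_euler_power[OF b])
        also have "of_real ((1 - y)\<^sup>2) ^ (2 * i) = complex_of_real ((1 - y) ^ (4 * i))"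
          by (simp flip: power_mult of_real_power)
        finally show ?case by simp
      qed
    qed measurable
    also have "\<dots> = of_real (LINT y|unit_interval. w y * (1 - y) ^ (4 * i)) * (of_nat i ^ k * taylor_coeff b i)"
      by (simp only: integral_mult_left_zero integral_complex_of_real)
    also have "\<dots> = (if i = 0 then 0 else of_real \<gamma> * taylor_coeff b i)"
    proof (cases "i = 0")
      case False
      define g where "g = (\<lambda>y::real. (1 - y) ^ (4 * i - 1) * (- ln (1 - y)) ^ (k - 1))"
      have g0: "0 \<le> g y" if "0 \<le> y" "y \<le> 1" for y
        using that by (cases "y = 1") (auto simp: g_def)
      have [measurable]: "g \<in> borel_measurable borel" unfolding g_def by measurable
      have "(\<integral>\<^sup>+y. ennreal (g y) \<partial>unit_interval) = (\<integral>\<^sup>+y. ennreal (g y) * indicator {0..1} y \<partial>lborel)"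
      proof -
        have "AE y in lborel. y \<noteq> 0 \<and> y \<noteq> (1::real)" by (intro AE_conjI AE_lborel_singleton)
        hence "AE y in lborel. ennreal (g y) * indicator {0<..<1} y = ennreal (g y) * indicator {0..1} y"
          by (rule eventually_mono) (auto simp: indicator_def)
        thus ?thesis by (subst nn_integral_unit) (auto intro: nn_integral_cong_AE)
      qed
      also have "\<dots> = ennreal (fact (k - 1) / real (4 * i) ^ Suc (k - 1))"
        unfolding g_def by (intro nn_integral_has_integral_lebesgue' log_moment_has_integral)
          (use False g0 in \<open>auto simp: g_def\<close>)
      also have "Suc (k - 1) = k" using k by simp
      finally have nn: "(\<integral>\<^sup>+y. ennreal (g y) \<partial>unit_interval) = ennreal (fact (k - 1) / real (4 * i) ^ k)" .
      have "(LINT y|unit_interval. w y * (1 - y) ^ (4 * i)) = (LINT y|unit_interval. g y)"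
      proof (rule integral_cong_AE)
        show "AE y in unit_interval. w y * (1 - y) ^ (4 * i) = g y"
          using AE_unit
        proof eventually_elim
          case (elim y)
          have "(1 - y) ^ (4 * i) = (1 - y) * (1 - y) ^ (4 * i - 1)"
            using False by (metis Suc_diff_1 mult_pos_pos neq0_conv power_Suc zero_less_numeral)
          thus ?case using elim by (simp add: w_def g_def)
        qed
      qed measurable
      also have "\<dots> = fact (k - 1) / real (4 * i) ^ k"
      proof (subst integral_eq_nn_integral)
        show "AE y in unit_interval. 0 \<le> g y" using AE_unit by (rule eventually_mono) (use g0 in auto)
      qed (simp_all add: nn)
      finally show ?thesis using False by (simp add: \<gamma>_def power_mult_distrib)
    qed (use k in simp)
    finally show ?thesis .
  qed
  show ?thesis
  proof (rule that[of "K / \<gamma>"])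
    show "0 < K / \<gamma>" using K \<gamma> by simp
    fix f :: "complex \<Rightarrow> complex" and z :: complex
    assume f: "f holomorphic_on ball 0 1" and z: "norm z < 1"
    define S where "S = (\<Sum>m. (\<Sum>n\<le>m. taylor_coeff b (m + n) * taylor_coeff f n) * z ^ m)"
    define c where "c = (\<lambda>i. hankel_term f z (prod_decode i))"
    define d where "d = (\<lambda>i. case prod_decode i of (n, j) \<Rightarrow> 2 * n + j)"
    have d0: "d i = 0 \<longleftrightarrow> i = 0" for i
    proof -
      have "d i = 0 \<longleftrightarrow> prod_decode i = (0, 0)" by (auto simp: d_def split: prod.splits)
      also have "\<dots> \<longleftrightarrow> i = prod_encode (0, 0)" by (metis prod_decode_inverse prod_encode_inverse)
      finally show ?thesis by (simp add: prod_encode_def)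
    qed
    have c_sum: "summable (\<lambda>i. norm (c i))"
    proof -
      obtain s where "((\<lambda>p. norm (hankel_term f z p)) has_sum s) UNIV"
        using hankel_term_abs_summable[OF f z] by (auto simp: summable_on_def)
      from sums_prod_decode[OF this] show ?thesis by (simp add: c_def sums_iff)
    qed
    have S: "(\<lambda>i. c i * taylor_coeff b (d i)) sums S"
      using hankel_series(2)[OF f z taylor_coeff_bounded[OF b B]] by (simp add: c_def d_def S_def case_prod_beta)
    have W: "(\<lambda>i. c i * \<zeta> y x ^ d i) sums hankel_weight f z (\<zeta> y x)" if "0 < y" "y < 1" for y x
      using hankel_weight_sums[OF f z \<zeta>_norm[OF that]] by (simp add: c_def d_def case_prod_beta)
    have int_c: "integrable (unit_interval \<Otimes>\<^sub>M circ) (\<lambda>p. c i * \<Psi> (d i) p)" for i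
      by (intro integrable_mult_right int_\<Psi>)
    \<comment> \<open>absolute convergence that allows summation under the integral\<close>
    have AEs: "AE p in unit_interval \<Otimes>\<^sub>M circ. summable (\<lambda>i. norm (c i * \<Psi> (d i) p))"
      using AEp
    proof eventually_elim
      case (elim p)
      show ?case
      proof (rule summable_comparison_test')
        show "summable (\<lambda>i. norm (c i) * (K * fst p powr (\<alpha> - 1)))" by (intro summable_mult2 c_sum)
        show "norm (norm (c i * \<Psi> (d i) p)) \<le> norm (c i) * (K * fst p powr (\<alpha> - 1))" for i
          using norm_\<Psi>[of p "d i"] elim by (simp add: norm_mult mult_left_mono)
      qed
    qed
    have sumI: "summable (\<lambda>i. LINT p|(unit_interval \<Otimes>\<^sub>M circ). norm (c i * \<Psi> (d i) p))"
    proof (rule summable_comparison_test')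
      show "summable (\<lambda>i. norm (c i) * (LINT p|(unit_interval \<Otimes>\<^sub>M circ). K * fst p powr (\<alpha> - 1)))" by (intro summable_mult2 c_sum)
      show "norm (LINT p|(unit_interval \<Otimes>\<^sub>M circ). norm (c i * \<Psi> (d i) p)) \<le> norm (c i) * (LINT p|(unit_interval \<Otimes>\<^sub>M circ). K * fst p powr (\<alpha> - 1))" for i
        using norm_int_\<Psi>[of "d i"] by (simp add: norm_mult abs_mult mult_left_mono)
    qed
    define I where "I = (LINT p|(unit_interval \<Otimes>\<^sub>M circ). (\<Sum>i. c i * \<Psi> (d i) p))"
    have "(\<lambda>i. LINT p|(unit_interval \<Otimes>\<^sub>M circ). c i * \<Psi> (d i) p) sums I"
      unfolding I_def by (rule sums_integral[OF int_c AEs sumI])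
    moreover have "(LINT p|(unit_interval \<Otimes>\<^sub>M circ). c i * \<Psi> (d i) p) = of_real \<gamma> * (c i * taylor_coeff b (d i)) - (if i = 0 then of_real \<gamma> * (f 0 * b 0) else 0)" for i
    proof (cases "i = 0")
      case True
      have "c 0 = f 0" by (simp add: c_def hankel_term_def prod_decode_def prod_decode_aux.simps taylor_coeff_def)
      thus ?thesis using True d0[of 0] by (simp add: val taylor_coeff_def)
    qed (simp add: val d0)
    ultimately have "(\<lambda>i. of_real \<gamma> * (c i * taylor_coeff b (d i)) - (if i = 0 then of_real \<gamma> * (f 0 * b 0) else 0)) sums I"
      by simp
    moreover have "(\<lambda>i. of_real \<gamma> * (c i * taylor_coeff b (d i)) - (if i = 0 then of_real \<gamma> * (f 0 * b 0) else 0)) sums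
       (of_real \<gamma> * S - of_real \<gamma> * (f 0 * b 0))"
      using sums_single[of 0 "\<lambda>_. of_real \<gamma> * (f 0 * b 0)"] by (intro sums_diff sums_mult S) simp
    ultimately have "I = of_real \<gamma> * S - of_real \<gamma> * (f 0 * b 0)" by (rule sums_unique2)
    hence "S = f 0 * b 0 + I / of_real \<gamma>" using \<gamma> by (simp add: field_simps)
    hence "norm S \<le> norm (f 0) * norm (b 0) + norm I / \<gamma>"
      using norm_triangle_ineq[of "f 0 * b 0" "I / of_real \<gamma>"] \<gamma> by (simp add: norm_mult norm_divide)
    also have "\<dots> \<le> B * norm (f 0) + norm I / \<gamma>"
      using B[of 0] by (simp add: mult.commute[of B] mult_left_mono)
    finally have S_le: "norm S \<le> B * norm (f 0) + norm I / \<gamma>" .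
    have "ennreal (norm I) \<le> (\<integral>\<^sup>+p. norm (\<Sum>i. c i * \<Psi> (d i) p) \<partial>(unit_interval \<Otimes>\<^sub>M circ))"
      unfolding I_def by (rule integral_norm_bound_ennreal) (rule integrable_suminf[OF int_c AEs sumI])
    also have "\<dots> = (\<integral>\<^sup>+y. \<integral>\<^sup>+x. norm (\<Sum>i. c i * \<Psi> (d i) (y, x)) \<partial>circ \<partial>unit_interval)"
      by (subst circ.nn_integral_fst[symmetric]) measurable
    also have "\<dots> \<le> (\<integral>\<^sup>+y. ennreal K * (ennreal (y powr (\<alpha> - 1)) * (\<integral>\<^sup>+x. norm (hankel_weight f z (\<zeta> y x)) \<partial>circ)) \<partial>unit_interval)"
    proof (rule nn_integral_mono_AE)
      show "AE y in unit_interval. (\<integral>\<^sup>+x. norm (\<Sum>i. c i * \<Psi> (d i) (y, x)) \<partial>circ) \<le>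
        ennreal K * (ennreal (y powr (\<alpha> - 1)) * (\<integral>\<^sup>+x. norm (hankel_weight f z (\<zeta> y x)) \<partial>circ))"
        using AE_unit
      proof eventually_elim
        case (elim y)
        have [measurable]: "(\<lambda>x. hankel_weight f z (\<zeta> y x)) \<in> borel_measurable borel"
          by (rule borel_measurable_LIMSEQ_metric[where f="\<lambda>n x. \<Sum>i<n. c i * \<zeta> y x ^ d i"])
             (use W elim in \<open>auto simp: sums_def \<zeta>_def\<close>)
        have "norm (\<Sum>i. c i * \<Psi> (d i) (y, x)) \<le> K * y powr (\<alpha> - 1) * norm (hankel_weight f z (\<zeta> y x))" for x
        proof -
          have "(\<lambda>i. of_real (w y) * E (of_real ((1 - y)\<^sup>2) * cis x) * (c i * \<zeta> y x ^ d i)) sums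
             (of_real (w y) * E (of_real ((1 - y)\<^sup>2) * cis x) * hankel_weight f z (\<zeta> y x))"
            using W[of y x] elim by (intro sums_mult) auto
          hence "(\<lambda>i. c i * \<Psi> (d i) (y, x)) sums
             (of_real (w y) * E (of_real ((1 - y)\<^sup>2) * cis x) * hankel_weight f z (\<zeta> y x))"
            by (simp add: \<Psi>_def mult_ac)
          hence "norm (\<Sum>i. c i * \<Psi> (d i) (y, x)) = w y * norm (E (of_real ((1 - y)\<^sup>2) * cis x)) * norm (hankel_weight f z (\<zeta> y x))"
            using w0[of y] elim by (simp add: sums_iff norm_mult)
          also have "\<dots> \<le> K * y powr (\<alpha> - 1) * norm (hankel_weight f z (\<zeta> y x))"
            using wE[of y x] elim by (intro mult_right_mono) auto
          finally show ?thesis .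
        qed
        hence "(\<integral>\<^sup>+x. norm (\<Sum>i. c i * \<Psi> (d i) (y, x)) \<partial>circ) \<le>
           (\<integral>\<^sup>+x. ennreal (K * y powr (\<alpha> - 1)) * ennreal (norm (hankel_weight f z (\<zeta> y x))) \<partial>circ)"
          by (intro nn_integral_mono) (auto simp: ennreal_mult''[symmetric] intro!: ennreal_leI)
        also have "\<dots> = ennreal (K * y powr (\<alpha> - 1)) * (\<integral>\<^sup>+x. norm (hankel_weight f z (\<zeta> y x)) \<partial>circ)"
          by (rule nn_integral_cmult) measurable
        finally show ?case using K by (simp add: ennreal_mult' mult.assoc)
      qed
    qed
    also have "\<dots> = ennreal K * (\<integral>\<^sup>+y. ennreal (y powr (\<alpha> - 1)) * (\<integral>\<^sup>+x. norm (hankel_weight f z (\<zeta> y x)) \<partial>circ) \<partial>unit_interval)"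
    proof -
      define J where "J = (\<lambda>y. ennreal (y powr (\<alpha> - 1)) * (\<integral>\<^sup>+x. norm (hankel_weight (zero_ext f) z (\<zeta> y x)) \<partial>circ))"
      have [measurable]: "zero_ext f \<in> borel_measurable borel" by (rule zero_ext_measurable[OF f])
      have [measurable]: "J \<in> borel_measurable borel"
        unfolding J_def hankel_weight_def \<zeta>_def by measurable
      have J: "AE y in unit_interval. ennreal (y powr (\<alpha> - 1)) * (\<integral>\<^sup>+x. norm (hankel_weight f z (\<zeta> y x)) \<partial>circ) = J y"
        using AE_unit
      proof eventually_elim
        case (elim y)
        have "zero_ext f (z * (\<zeta> y x)\<^sup>2) = f (z * (\<zeta> y x)\<^sup>2)" for x
        proof (rule zero_ext_eq)
          have "norm (z * (\<zeta> y x)\<^sup>2) \<le> norm z * 1"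
            unfolding norm_mult norm_power using \<zeta>_norm[of y x] elim
            by (intro mult_left_mono power_le_one) auto
          thus "norm (z * (\<zeta> y x)\<^sup>2) < 1" using z by simp
        qed
        thus ?case by (simp add: J_def hankel_weight_def)
      qed
      have "(\<integral>\<^sup>+y. ennreal K * (ennreal (y powr (\<alpha> - 1)) * (\<integral>\<^sup>+x. norm (hankel_weight f z (\<zeta> y x)) \<partial>circ)) \<partial>unit_interval)
          = (\<integral>\<^sup>+y. ennreal K * J y \<partial>unit_interval)"
        by (intro nn_integral_cong_AE, rule eventually_mono[OF J]) simp
      also have "\<dots> = ennreal K * (\<integral>\<^sup>+y. J y \<partial>unit_interval)" by (rule nn_integral_cmult) measurable
      also have "(\<integral>\<^sup>+y. J y \<partial>unit_interval) = (\<integral>\<^sup>+y. ennreal (y powr (\<alpha> - 1)) * (\<integral>\<^sup>+x. norm (hankel_weight f z (\<zeta> y x)) \<partial>circ) \<partial>unit_interval)"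
        by (intro nn_integral_cong_AE, rule eventually_mono[OF J]) simp
      finally show ?thesis .
    qed
    finally have I_le: "ennreal (norm I) \<le> ennreal K * (\<integral>\<^sup>+y. ennreal (y powr (\<alpha> - 1)) * (\<integral>\<^sup>+x. norm (hankel_weight f z (\<zeta> y x)) \<partial>circ) \<partial>unit_interval)" .
    have "ennreal (norm S) \<le> ennreal (B * norm (f 0)) + ennreal (1 / \<gamma>) * ennreal (norm I)"
    proof -
      have "0 \<le> B" using order_trans[OF norm_ge_zero B[of 0]] by simp
      thus ?thesis using S_le \<gamma> by (simp add: ennreal_plus[symmetric] ennreal_mult'[symmetric] ennreal_leI del: ennreal_plus)
    qed
    also have "\<dots> \<le> ennreal (B * norm (f 0)) + ennreal (1 / \<gamma>) * (ennreal K * (\<integral>\<^sup>+y. ennreal (y powr (\<alpha> - 1)) * (\<integral>\<^sup>+x. norm (hankel_weight f z (\<zeta> y x)) \<partial>circ) \<partial>unit_interval))"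
      by (intro add_left_mono mult_left_mono I_le) auto
    also have "ennreal (1 / \<gamma>) * (ennreal K * J) = ennreal (K / \<gamma>) * J" for J
      using \<gamma> K by (simp add: mult.assoc[symmetric] ennreal_mult'[symmetric])
    finally show "ennreal (norm (\<Sum>m. (\<Sum>n\<le>m. taylor_coeff b (m + n) * taylor_coeff f n) * z ^ m)) \<le>
       ennreal (B * norm (f 0)) + ennreal (K / \<gamma>) * hankel_mass (\<alpha> - 1) f z"
      by (simp add: S_def \<zeta>_def hankel_mass_def)
  qed
qed

section \<open>The Cauchy kernel and convolutions on the circle\<close>

lemma sin_ge_third:
  assumes "0 \<le> x" "x \<le> (2::real)"
  shows "x / 3 \<le> sin x"
proof -
  have "\<bar>sin x - (\<Sum>m<3. sin_coeff m * x ^ m)\<bar> \<le> inverse (fact 3) * \<bar>x\<bar> ^ 3"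
    by (rule Maclaurin_sin_bound)
  hence "x - x ^ 3 / 6 \<le> sin x"
    using assms by (simp add: eval_nat_numeral sin_coeff_def abs_if field_simps split: if_splits)
  moreover have "x * x\<^sup>2 \<le> x * 2\<^sup>2" using assms by (intro mult_left_mono power_mono) auto
  hence "x ^ 3 / 6 \<le> 2 * x / 3" by (simp add: power3_eq_cube power2_eq_square)
  ultimately show ?thesis by argo
qed

text \<open>The distance is at least \<open>1 - R \<ge> y\<close>, and at least half of the chord \<open>2 * sin (t / 2)\<close>.\<close>

lemma norm_one_minus_cis_lower:
  assumes R: "0 \<le> R" "R \<le> 1 - y" and y: "0 < y" and t: "0 \<le> t" "t \<le> pi"
  shows "(y + t) / 12 \<le> norm (1 - complex_of_real R * cis t)"
proof -
  have "(norm (1 - cis t))\<^sup>2 = (2 * sin (t / 2))\<^sup>2"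
  proof -
    have "(norm (1 - cis t))\<^sup>2 = 1 - 2 * cos t + ((cos t)\<^sup>2 + (sin t)\<^sup>2)"
      by (simp only: cmod_power2) (simp add: power2_eq_square algebra_simps)
    also have "\<dots> = 2 - 2 * cos (2 * (t / 2))" by simp
    also have "\<dots> = (2 * sin (t / 2))\<^sup>2" unfolding cos_double_sin by (simp add: power2_eq_square)
    finally show ?thesis .
  qed
  moreover have "t / 2 \<le> 2" using t pi_less_4 by simp
  hence s: "t / 6 \<le> sin (t / 2)" using sin_ge_third[of "t / 2"] t by simp
  moreover have "0 \<le> 2 * sin (t / 2)" using s t by simp
  ultimately have "norm (1 - cis t) = 2 * sin (t / 2)"
    by (intro power2_eq_imp_eq[OF _ norm_ge_zero])
  hence "t / 3 \<le> norm (1 - cis t)" using s by simp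
  also have "1 - cis t = (1 - complex_of_real R * cis t) - of_real (1 - R) * cis t" by (simp add: algebra_simps)
  also have "norm \<dots> \<le> norm (1 - complex_of_real R * cis t) + norm (of_real (1 - R) * cis t)"
    by (rule norm_triangle_ineq4)
  also have "norm (of_real (1 - R) * cis t) = 1 - R" using R y by (intro norm_scaled_cis) simp
  also have "1 - R \<le> norm (1 - complex_of_real R * cis t)" by (rule norm_one_minus_cis_ge[OF R(1)])
  finally have "t / 3 \<le> 2 * norm (1 - complex_of_real R * cis t)" by simp
  moreover have "y \<le> norm (1 - complex_of_real R * cis t)"
    using norm_one_minus_cis_ge[OF R(1), of t] R by simp
  ultimately show ?thesis using y by argo
qed

lemma norm_one_minus_cis_reflect:
  "norm (1 - complex_of_real R * cis (2 * pi - t)) = norm (1 - complex_of_real R * cis t)"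
proof -
  have "cis (2 * pi - t) = cis (2 * pi) * cis (- t)" by (simp only: cis_mult) simp
  hence "cis (2 * pi - t) = cnj (cis t)" by (simp add: cis_cnj)
  hence "1 - complex_of_real R * cis (2 * pi - t) = cnj (1 - complex_of_real R * cis t)" by simp
  thus ?thesis by (simp only: complex_mod_cnj)
qed

definition cauchy_abs :: "real \<Rightarrow> real \<Rightarrow> real" where
  "cauchy_abs R t = 1 / norm (1 - complex_of_real R * cis t)"

lemma cauchy_abs_nonneg: "0 \<le> cauchy_abs R t" by (simp add: cauchy_abs_def)

lemma cauchy_abs_measurable [measurable (raw)]:
  assumes "f \<in> borel_measurable M" "g \<in> borel_measurable M"
  shows "(\<lambda>x. cauchy_abs (f x) (g x)) \<in> borel_measurable M"
  unfolding cauchy_abs_def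
  by (intro borel_measurable_divide borel_measurable_const
      borel_measurable_continuous_Pair[where H="\<lambda>R t. norm (1 - complex_of_real R * cis t)"] assms)
     (auto intro!: continuous_intros)

text \<open>For \<open>\<sigma> = 1\<close> the integral would grow like \<open>- ln y\<close>; an exponent above one gives the exact scaling.\<close>

lemma nn_integral_cauchy_abs_powr:
  assumes R: "0 \<le> R" "R \<le> 1 - y" and y: "0 < y" and \<sigma>: "1 < \<sigma>"
  shows "(\<integral>\<^sup>+t. cauchy_abs R t powr \<sigma> \<partial>circ) \<le> ennreal (12 powr \<sigma> / (\<sigma> - 1) * y powr (1 - \<sigma>))"
proof -
  define g where "g = (\<lambda>t. ennreal ((12 powr \<sigma>) * (y + t) powr (- \<sigma>)) * indicator {0..} t)"
  have [measurable]: "g \<in> borel_measurable borel" unfolding g_def by measurable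
  have half: "ennreal (cauchy_abs R t powr \<sigma>) \<le> g t" if t: "0 \<le> t" "t \<le> pi" for t
  proof -
    have "cauchy_abs R t \<le> 1 / ((y + t) / 12)"
      unfolding cauchy_abs_def
      using norm_one_minus_cis_lower[OF R y t] y t by (intro divide_left_mono mult_pos_pos) auto
    hence "cauchy_abs R t powr \<sigma> \<le> (12 / (y + t)) powr \<sigma>"
      using \<sigma> cauchy_abs_nonneg by (intro powr_mono2) auto
    also have "\<dots> = 12 powr \<sigma> * (y + t) powr (- \<sigma>)"
      using y t by (simp add: powr_divide powr_minus_divide)
    finally show ?thesis using t by (simp add: g_def ennreal_leI)
  qed
  have "(\<integral>\<^sup>+t. ennreal (cauchy_abs R t powr \<sigma>) * indicator {0..2 * pi} t \<partial>lborel) \<le> (\<integral>\<^sup>+t. g t + g (2 * pi - t) \<partial>lborel)"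
  proof (rule nn_integral_mono)
    fix t
    show "ennreal (cauchy_abs R t powr \<sigma>) * indicator {0..2 * pi} t \<le> g t + g (2 * pi - t)"
    proof (cases "0 \<le> t \<and> t \<le> 2 * pi")
      case True
      show ?thesis
      proof (cases "t \<le> pi")
        case True
        with half[of t] \<open>0 \<le> t \<and> t \<le> 2 * pi\<close> show ?thesis by (simp add: add_increasing2)
      next
        case False
        with half[of "2 * pi - t"] True show ?thesis
          by (simp add: add_increasing cauchy_abs_def norm_one_minus_cis_reflect)
      qed
    next
      case False
      hence "t \<notin> {0..2 * pi}" by auto
      hence ind: "indicator {0..2 * pi} t = (0::ennreal)" by (rule indicator_simps(2))
      show ?thesis unfolding ind by simp
    qed
  qed
  also have "\<dots> = (\<integral>\<^sup>+t. g t \<partial>lborel) + (\<integral>\<^sup>+t. g (2 * pi - t) \<partial>lborel)" by (rule nn_integral_add) measurable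
  also have "(\<integral>\<^sup>+t. g (2 * pi - t) \<partial>lborel) = (\<integral>\<^sup>+t. g t \<partial>lborel)"
    using nn_integral_real_affine[of g "-1" "2 * pi"] by simp
  also have "(\<integral>\<^sup>+t. g t \<partial>lborel) = (\<integral>\<^sup>+t. ennreal (12 powr \<sigma>) * (ennreal ((t + y) powr (- \<sigma>)) * indicator {y..} (t + y)) \<partial>lborel)"
    by (intro nn_integral_cong) (auto simp: g_def ennreal_mult' indicator_def add.commute)
  also have "\<dots> = ennreal (12 powr \<sigma>) * (\<integral>\<^sup>+t. ennreal ((t + y) powr (- \<sigma>)) * indicator {y..} (t + y) \<partial>lborel)"
    by (rule nn_integral_cmult) measurable
  also have "(\<integral>\<^sup>+t. ennreal ((t + y) powr (- \<sigma>)) * indicator {y..} (t + y) \<partial>lborel)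
     = (\<integral>\<^sup>+t. ennreal (t powr (- \<sigma>)) * indicator {y..} t \<partial>lborel)"
    by (rule nn_integral_shift[where g="\<lambda>t. ennreal (t powr (- \<sigma>)) * indicator {y..} t"]) measurable
  also have "\<dots> = ennreal (- (y powr (- \<sigma> + 1)) / (- \<sigma> + 1))"
    using \<sigma> y by (intro nn_integral_has_integral_lebesgue' has_integral_powr_to_inf) auto
  also have "- (y powr (- \<sigma> + 1)) / (- \<sigma> + 1) = y powr (1 - \<sigma>) / (\<sigma> - 1)"
    using \<sigma> by (simp add: field_simps)
  also have "ennreal (12 powr \<sigma>) * ennreal (y powr (1 - \<sigma>) / (\<sigma> - 1)) = ennreal (12 powr \<sigma> / (\<sigma> - 1) * y powr (1 - \<sigma>))"
    using \<sigma> by (simp add: ennreal_mult'[symmetric])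
  finally have le: "(\<integral>\<^sup>+t. ennreal (cauchy_abs R t powr \<sigma>) * indicator {0..2 * pi} t \<partial>lborel)
      \<le> 2 * ennreal (12 powr \<sigma> / (\<sigma> - 1) * y powr (1 - \<sigma>))" by (simp only: mult_2)
  have "(\<integral>\<^sup>+t. cauchy_abs R t powr \<sigma> \<partial>circ) = (\<integral>\<^sup>+t. ennreal (cauchy_abs R t powr \<sigma>) * indicator {0..2 * pi} t \<partial>lborel) / ennreal (2 * pi)"
    by (rule nn_integral_circ) measurable
  also have "\<dots> \<le> 2 * ennreal (12 powr \<sigma> / (\<sigma> - 1) * y powr (1 - \<sigma>)) / ennreal (2 * pi)"
    by (intro divide_right_mono_ennreal le)
  also have "2 * ennreal (12 powr \<sigma> / (\<sigma> - 1) * y powr (1 - \<sigma>)) = ennreal (2 * (12 powr \<sigma> / (\<sigma> - 1) * y powr (1 - \<sigma>)))"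
    by (subst ennreal_mult') simp_all
  also have "\<dots> / ennreal (2 * pi) = ennreal (2 * (12 powr \<sigma> / (\<sigma> - 1) * y powr (1 - \<sigma>)) / (2 * pi))"
    using \<sigma> by (intro divide_ennreal) auto
  also have "\<dots> \<le> ennreal (12 powr \<sigma> / (\<sigma> - 1) * y powr (1 - \<sigma>))"
  proof (rule ennreal_leI)
    have "12 powr \<sigma> / (\<sigma> - 1) * y powr (1 - \<sigma>) / pi \<le> 12 powr \<sigma> / (\<sigma> - 1) * y powr (1 - \<sigma>) / 1"
      using \<sigma> pi_ge_two by (intro divide_left_mono mult_nonneg_nonneg) auto
    thus "2 * (12 powr \<sigma> / (\<sigma> - 1) * y powr (1 - \<sigma>)) / (2 * pi) \<le> 12 powr \<sigma> / (\<sigma> - 1) * y powr (1 - \<sigma>)"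
      by simp
  qed
  finally show ?thesis .
qed

text \<open>The numerator and the denominator of \<open>hankel_weight\<close> are values of one holomorphic function
  \<open>\<Phi>\<close> at the point \<open>\<omega> * r * cis (\<psi> - x)\<close>, and the right-hand side is the Poisson formula for \<open>\<Phi>\<close>. The powers of
  \<open>\<omega>\<close> and \<open>r\<close> are distributed so that each of the three factors stays at distance at least \<open>1 - \<omega>\<close> from
  the unit circle.\<close>

lemma hankel_weight_le:
  assumes f: "f holomorphic_on ball 0 1" and r: "0 < r" "r < 1" and \<omega>: "0 < \<omega>" "\<omega> < 1"
  shows "ennreal (norm (hankel_weight f (of_real (r\<^sup>2) * cis \<psi>) (of_real (\<omega>\<^sup>2) * cis (- x)))) \<le>
    (\<integral>\<^sup>+t. norm (f (of_real (\<omega> ^ 3 * r) * cis (t - x))) * cauchy_abs (\<omega> * r) t * poisson (\<omega> * r) (x + t - \<psi>) \<partial>circ)"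
proof -
  define \<Phi> where "\<Phi> = (\<lambda>\<zeta>. f (of_real (\<omega> ^ 3 * r) * cis (- x) * \<zeta>) / (1 - of_real (\<omega> * r) * \<zeta>))"
  have \<omega>r: "0 \<le> \<omega> * r" "\<omega> * r < 1" using r \<omega> mult_strict_mono[of \<omega> 1 r 1] by auto
  have \<Phi>: "\<Phi> holomorphic_on ball 0 (1 / r)"
    unfolding \<Phi>_def
  proof (intro holomorphic_intros)
    have "\<omega> ^ 3 \<le> \<omega> ^ 1" using \<omega> by (intro power_decreasing) auto
    hence "\<omega> ^ 3 < 1" using \<omega> by simp
    hence "norm (of_real (\<omega> ^ 3 * r) * cis (- x) * \<zeta>) < 1" if "norm \<zeta> < 1 / r" for \<zeta>
    proof -
      have "norm (of_real (\<omega> ^ 3 * r) * cis (- x) * \<zeta>) = \<omega> ^ 3 * (r * norm \<zeta>)"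
        using r \<omega> by (simp add: norm_mult norm_power)
      also have "\<dots> \<le> \<omega> ^ 3 * 1" using that r \<omega> by (intro mult_left_mono) (auto simp: field_simps)
      finally show ?thesis using \<open>\<omega> ^ 3 < 1\<close> by simp
    qed
    thus "(\<lambda>\<zeta>. f (of_real (\<omega> ^ 3 * r) * cis (- x) * \<zeta>)) holomorphic_on ball 0 (1 / r)"
      by (intro holomorphic_on_compose_gen[OF _ f, unfolded o_def]) (auto intro!: holomorphic_intros)
    fix \<zeta> :: complex assume \<zeta>: "\<zeta> \<in> ball 0 (1 / r)"
    have "norm (of_real (\<omega> * r) * \<zeta>) = \<omega> * (r * norm \<zeta>)" using r \<omega> by (simp add: norm_mult)
    also have "\<dots> \<le> \<omega> * 1" using \<zeta> r \<omega> by (intro mult_left_mono) (auto simp: field_simps)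
    finally have "norm (of_real (\<omega> * r) * \<zeta>) < 1" using \<omega> by simp
    thus "1 - of_real (\<omega> * r) * \<zeta> \<noteq> 0" by auto
  qed
  have "hankel_weight f (of_real (r\<^sup>2) * cis \<psi>) (of_real (\<omega>\<^sup>2) * cis (- x)) = \<Phi> (of_real (\<omega> * r) * cis (\<psi> - x))"
  proof -
    have 1: "of_real (r\<^sup>2) * cis \<psi> * (of_real (\<omega>\<^sup>2) * cis (- x))\<^sup>2 = of_real (\<omega> ^ 3 * r) * cis (- x) * (of_real (\<omega> * r) * cis (\<psi> - x))"
    proof -
      have c: "cis (\<psi> - x) = cis \<psi> * cis (- x)" by (simp add: cis_mult)
      show ?thesis unfolding c by (simp add: power2_eq_square power3_eq_cube)
    qed
    have 2: "of_real (r\<^sup>2) * cis \<psi> * (of_real (\<omega>\<^sup>2) * cis (- x)) = of_real (\<omega> * r) * (of_real (\<omega> * r) * cis (\<psi> - x))"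
    proof -
      have c: "cis (\<psi> - x) = cis \<psi> * cis (- x)" by (simp add: cis_mult)
      show ?thesis unfolding c by (simp add: power2_eq_square)
    qed
    show ?thesis unfolding hankel_weight_def \<Phi>_def 1 2 ..
  qed
  also have "\<dots> = (LINT t|circ. poisson (\<omega> * r) (t - (\<psi> - x)) *\<^sub>R \<Phi> (cis t))"
    using r by (intro Poisson_formula[symmetric, OF \<Phi> _ \<omega>r]) simp
  finally have eq: "hankel_weight f (of_real (r\<^sup>2) * cis \<psi>) (of_real (\<omega>\<^sup>2) * cis (- x)) =
     (LINT t|circ. poisson (\<omega> * r) (t - (\<psi> - x)) *\<^sub>R \<Phi> (cis t))" .
  have "ennreal (norm (LINT t|circ. poisson (\<omega> * r) (t - (\<psi> - x)) *\<^sub>R \<Phi> (cis t)))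
     \<le> (\<integral>\<^sup>+t. norm (poisson (\<omega> * r) (t - (\<psi> - x)) *\<^sub>R \<Phi> (cis t)) \<partial>circ)"
  proof (cases "integrable circ (\<lambda>t. poisson (\<omega> * r) (t - (\<psi> - x)) *\<^sub>R \<Phi> (cis t))")
    case True thus ?thesis by (rule integral_norm_bound_ennreal)
  qed (simp add: not_integrable_integral_eq)
  also have "\<dots> = (\<integral>\<^sup>+t. norm (f (of_real (\<omega> ^ 3 * r) * cis (t - x))) * cauchy_abs (\<omega> * r) t * poisson (\<omega> * r) (x + t - \<psi>) \<partial>circ)"
  proof (rule nn_integral_cong)
    fix t
    have 1: "of_real (\<omega> ^ 3 * r) * cis (- x) * cis t = of_real (\<omega> ^ 3 * r) * cis (t - x)" by (simp add: mult.assoc cis_mult)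
    have 2: "t - (\<psi> - x) = x + t - \<psi>" by simp
    have "norm (poisson (\<omega> * r) (t - (\<psi> - x)) *\<^sub>R \<Phi> (cis t)) =
        poisson (\<omega> * r) (x + t - \<psi>) * (norm (f (of_real (\<omega> ^ 3 * r) * cis (t - x))) * cauchy_abs (\<omega> * r) t)"
      unfolding \<Phi>_def 1 2 cauchy_abs_def norm_scaleR using poisson_nonneg[OF \<omega>r] by (simp add: norm_divide)
    thus "ennreal (norm (poisson (\<omega> * r) (t - (\<psi> - x)) *\<^sub>R \<Phi> (cis t))) =
       ennreal (norm (f (of_real (\<omega> ^ 3 * r) * cis (t - x))) * cauchy_abs (\<omega> * r) t * poisson (\<omega> * r) (x + t - \<psi>))"
      by (simp only: mult_ac)
  qed
  finally show ?thesis unfolding eq .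
qed

lemma nn_integral_shear_minus:
  fixes F H :: "real \<Rightarrow> ennreal"
  assumes [measurable]: "F \<in> borel_measurable borel" "H \<in> borel_measurable borel"
    and F: "\<And>x. F (x + 2 * pi) = F x"
  shows "(\<integral>\<^sup>+x. \<integral>\<^sup>+t. F (x + c * t) * H t \<partial>circ \<partial>circ) = (\<integral>\<^sup>+x. F x \<partial>circ) * (\<integral>\<^sup>+t. H t \<partial>circ)"
proof -
  have "(\<integral>\<^sup>+x. \<integral>\<^sup>+t. F (x + c * t) * H t \<partial>circ \<partial>circ) = (\<integral>\<^sup>+t. \<integral>\<^sup>+x. F (x + c * t) * H t \<partial>circ \<partial>circ)"
    by (rule circ2.Fubini') measurable
  also have "\<dots> = (\<integral>\<^sup>+t. (\<integral>\<^sup>+x. F x \<partial>circ) * H t \<partial>circ)"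
    by (simp add: nn_integral_multc nn_integral_circ_translate F)
  also have "\<dots> = (\<integral>\<^sup>+x. F x \<partial>circ) * (\<integral>\<^sup>+t. H t \<partial>circ)" by (rule nn_integral_cmult) measurable
  finally show ?thesis .
qed

text \<open>After a translation in \<open>x\<close> the arguments are \<open>x\<close> and \<open>x + 2 * t\<close>; doubling and translating \<open>t\<close> separates
  the variables.\<close>

lemma nn_integral_shear_both:
  fixes F H :: "real \<Rightarrow> ennreal"
  assumes [measurable]: "F \<in> borel_measurable borel" "H \<in> borel_measurable borel"
    and F: "\<And>x. F (x + 2 * pi) = F x" and H: "\<And>x. H (x + 2 * pi) = H x"
  shows "(\<integral>\<^sup>+x. \<integral>\<^sup>+t. F (x - t) * H (x + t) \<partial>circ \<partial>circ) = (\<integral>\<^sup>+x. F x \<partial>circ) * (\<integral>\<^sup>+t. H t \<partial>circ)"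
proof -
  have per: "F (x + 2 * pi - t) = F (x - t)" "H (x + 2 * pi + t) = H (x + t)" for x t
    using F[of "x - t"] H[of "x + t"] by (simp_all add: algebra_simps)
  have "(\<integral>\<^sup>+x. \<integral>\<^sup>+t. F (x - t) * H (x + t) \<partial>circ \<partial>circ) = (\<integral>\<^sup>+t. \<integral>\<^sup>+x. F (x - t) * H (x + t) \<partial>circ \<partial>circ)"
    by (rule circ2.Fubini') measurable
  also have "\<dots> = (\<integral>\<^sup>+t. \<integral>\<^sup>+x. F x * H (x + 2 * t) \<partial>circ \<partial>circ)"
  proof (rule nn_integral_cong)
    fix t
    have "(\<integral>\<^sup>+x. F (x - t) * H (x + t) \<partial>circ) = (\<integral>\<^sup>+x. F ((x + t) - t) * H ((x + t) + t) \<partial>circ)"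
      by (rule nn_integral_circ_translate[symmetric, where g="\<lambda>x. F (x - t) * H (x + t)"]) (auto simp: per)
    thus "(\<integral>\<^sup>+x. F (x - t) * H (x + t) \<partial>circ) = (\<integral>\<^sup>+x. F x * H (x + 2 * t) \<partial>circ)"
      by (simp add: add.assoc)
  qed
  also have "\<dots> = (\<integral>\<^sup>+x. \<integral>\<^sup>+t. F x * H (x + 2 * t) \<partial>circ \<partial>circ)"
    by (rule circ2.Fubini') measurable
  also have "\<dots> = (\<integral>\<^sup>+x. F x * (\<integral>\<^sup>+t. H t \<partial>circ) \<partial>circ)"
  proof (rule nn_integral_cong)
    fix x
    have "(\<integral>\<^sup>+t. F x * H (x + 2 * t) \<partial>circ) = F x * (\<integral>\<^sup>+t. H (x + 2 * t) \<partial>circ)"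
      by (rule nn_integral_cmult) measurable
    also have "(\<integral>\<^sup>+t. H (x + 2 * t) \<partial>circ) = (\<integral>\<^sup>+t. H (x + t) \<partial>circ)"
      by (rule nn_integral_circ_double[where g="\<lambda>t. H (x + t)"]) (auto simp: H add.assoc[symmetric])
    also have "\<dots> = (\<integral>\<^sup>+t. H t \<partial>circ)"
      using nn_integral_circ_translate[of H x] H by (simp add: add.commute)
    finally show "(\<integral>\<^sup>+t. F x * H (x + 2 * t) \<partial>circ) = F x * (\<integral>\<^sup>+t. H t \<partial>circ)" .
  qed
  also have "\<dots> = (\<integral>\<^sup>+x. F x \<partial>circ) * (\<integral>\<^sup>+t. H t \<partial>circ)" by (rule nn_integral_multc) measurable
  finally show ?thesis .
qed

text \<open>Each factor is at most the maximum of the three, and the exponents add up to one.\<close>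

lemma weighted_product_le_sum:
  fixes X Y Z :: real
  assumes "0 \<le> X" "0 \<le> Y" "0 \<le> Z" "0 \<le> a" "0 \<le> b" "0 \<le> c" "a + b + c = 1"
  shows "X powr a * Y powr b * Z powr c \<le> X + Y + Z"
proof -
  define M where "M = max X (max Y Z)"
  have M: "X \<le> M" "Y \<le> M" "Z \<le> M" "0 \<le> M" using assms by (auto simp: M_def)
  have "X powr a * Y powr b * Z powr c \<le> M powr a * M powr b * M powr c"
    using assms M by (intro mult_mono powr_mono2) auto
  also have "\<dots> = M powr (a + b + c)" by (simp only: powr_add)
  also have "\<dots> = M" using M assms by simp
  also have "M \<le> X + Y + Z" using assms by (auto simp: M_def)
  finally show ?thesis .
qed

section \<open>The trilinear estimate\<close>

lemma nn_integral_swap_weighted: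
  assumes "sigma_finite_measure A" "sigma_finite_measure B"
    and [measurable]: "G \<in> borel_measurable A" "W \<in> borel_measurable B" "(\<lambda>(a, b). J a b) \<in> borel_measurable (A \<Otimes>\<^sub>M B)"
  shows "(\<integral>\<^sup>+a. G a * (\<integral>\<^sup>+b. W b * J a b \<partial>B) \<partial>A) = (\<integral>\<^sup>+b. W b * (\<integral>\<^sup>+a. G a * J a b \<partial>A) \<partial>B)"
proof -
  interpret A: sigma_finite_measure A by fact
  interpret B: sigma_finite_measure B by fact
  interpret pair_sigma_finite A B ..
  have "(\<integral>\<^sup>+a. G a * (\<integral>\<^sup>+b. W b * J a b \<partial>B) \<partial>A) = (\<integral>\<^sup>+a. \<integral>\<^sup>+b. G a * (W b * J a b) \<partial>B \<partial>A)"
    by (intro nn_integral_cong nn_integral_cmult[symmetric]) measurable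
  also have "\<dots> = (\<integral>\<^sup>+b. \<integral>\<^sup>+a. W b * (G a * J a b) \<partial>A \<partial>B)"
    by (subst Fubini'[symmetric]) (auto simp: mult.left_commute)
  also have "\<dots> = (\<integral>\<^sup>+b. W b * (\<integral>\<^sup>+a. G a * J a b \<partial>A) \<partial>B)"
    by (intro nn_integral_cong nn_integral_cmult) measurable
  finally show ?thesis .
qed

lemma averaging_kernel_poisson:
  assumes "0 \<le> R" "R \<le> 1 - y" "0 < y"
  shows "averaging_kernel (\<lambda>x t. poisson R (x - t)) (2 / y)"
    and "averaging_kernel (\<lambda>x t. poisson R (x + t)) (2 / y)"
proof -
  have R: "R < 1" using assms by simp
  have le: "poisson R x \<le> 2 / y" for x
  proof -
    have "poisson R x \<le> 2 / (1 - R)" by (rule poisson_le[OF assms(1) R])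
    also have "\<dots> \<le> 2 / y" using assms R by (intro divide_left_mono) auto
    finally show ?thesis .
  qed
  note P = nn_integral_poisson[OF assms(1) R] poisson_nonneg[OF assms(1) R]
  show "averaging_kernel (\<lambda>x t. poisson R (x - t)) (2 / y)"
    by unfold_locales (use P le in auto)
  show "averaging_kernel (\<lambda>x t. poisson R (x + t)) (2 / y)"
    by unfold_locales (use P(1)[of "- _"] P le in \<open>auto simp: add.commute\<close>)
qed

text \<open>The exponent \<open>q / 2\<close> makes the boundary function square integrable, so that the estimates for
  averaging kernels with \<open>l = 2\<close> apply for every \<open>q > 0\<close>.\<close>

lemma hardy_kernel_majorant:
  assumes f: "f holomorphic_on ball 0 1" and q: "0 < q"
    and norm: "\<forall>s\<in>{0<..<1}. (\<integral>\<^sup>+t. norm (f (of_real s * cis t)) powr q \<partial>circ) \<le> 1"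
    and r: "0 < r" "r < 1"
  obtains K \<phi> B where "\<And>y. \<lbrakk>0 < y; y < 1\<rbrakk> \<Longrightarrow> averaging_kernel (K y) (2 / y)"
    "\<phi> \<in> borel_measurable borel" "\<And>t. 0 \<le> \<phi> t" "\<And>t. \<phi> t \<le> B" "(\<integral>\<^sup>+t. \<phi> t powr 2 \<partial>circ) \<le> 1"
    "\<And>y u. \<lbrakk>0 < y; y < 1\<rbrakk> \<Longrightarrow> norm (f (of_real ((1 - y) ^ 3 * r) * cis (- u))) powr (q / 2) \<le> kernel_avg (K y) \<phi> u"
proof -
  obtain r' where r': "r \<le> r'" "r' < 1" and maj:
    "\<And>R u c. \<lbrakk>0 \<le> R; R < r'; 0 < c\<rbrakk> \<Longrightarrow> norm (f (of_real R * cis u)) powr c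
        \<le> (LINT t|circ. poisson (R / r') (t - u) * norm (f (of_real r' * cis t)) powr c)"
    by (rule Poisson_majorant_disc[OF f r]) (rule that)
  have r'0: "0 < r'" using r r' by simp
  define \<phi> where "\<phi> = (\<lambda>t. norm (f (of_real r' * cis t)) powr (q / 2))"
  have cont: "continuous_on (cball 0 r') f"
    by (rule continuous_on_subset[OF holomorphic_on_imp_continuous_on[OF f]]) (use r' in auto)
  have "continuous_on UNIV (\<lambda>t. f (of_real r' * cis t))"
    by (rule continuous_on_compose2[OF cont]) (use r'0 in \<open>auto intro!: continuous_intros simp: norm_scaled_cis\<close>)
  hence [measurable]: "(\<lambda>t. f (of_real r' * cis t)) \<in> borel_measurable borel"
    by (rule borel_measurable_continuous_onI)
  have "bounded (f ` cball 0 r')"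
    by (intro compact_imp_bounded compact_continuous_image cont compact_cball)
  then obtain B where "\<forall>x\<in>f ` cball 0 r'. norm x \<le> B" unfolding bounded_iff by blast
  hence B: "norm (f (of_real r' * cis t)) \<le> B" for t using r'0 by (simp add: norm_scaled_cis)
  show ?thesis
  proof (rule that[of "\<lambda>y x t. poisson ((1 - y) ^ 3 * r / r') (x + t)" \<phi> "B powr (q / 2)"])
    fix y u :: real assume y: "0 < y" "y < 1"
    have y3: "0 < (1 - y) ^ 3" "(1 - y) ^ 3 \<le> (1 - y) ^ 1" "(1 - y) ^ 3 < 1"
    proof -
      show "0 < (1 - y) ^ 3" using y by simp
      show *: "(1 - y) ^ 3 \<le> (1 - y) ^ 1" using y by (intro power_decreasing) auto
      show "(1 - y) ^ 3 < 1" using * y by simp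
    qed
    have "(1 - y) ^ 3 * r / r' \<le> (1 - y) ^ 3 * 1"
      using r r' r'0 y3 by (simp add: field_simps)
    hence R: "0 \<le> (1 - y) ^ 3 * r / r'" "(1 - y) ^ 3 * r / r' \<le> 1 - y"
      using y3 r r'0 by auto
    show "averaging_kernel (\<lambda>x t. poisson ((1 - y) ^ 3 * r / r') (x + t)) (2 / y)"
      by (rule averaging_kernel_poisson(2)[OF R y(1)])
    have "(1 - y) ^ 3 * r < 1 * r" using y3 r by (intro mult_strict_right_mono) auto
    hence "(1 - y) ^ 3 * r < r'" using r'(1) by simp
    hence "norm (f (of_real ((1 - y) ^ 3 * r) * cis (- u))) powr (q / 2) \<le>
       (LINT t|circ. poisson ((1 - y) ^ 3 * r / r') (t - (- u)) * norm (f (of_real r' * cis t)) powr (q / 2))"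
      using r r' y3 q by (intro maj) auto
    thus "norm (f (of_real ((1 - y) ^ 3 * r) * cis (- u))) powr (q / 2) \<le> kernel_avg (\<lambda>x t. poisson ((1 - y) ^ 3 * r / r') (x + t)) \<phi> u"
      by (simp add: kernel_avg_def \<phi>_def add.commute)
  next
    show "\<phi> \<in> borel_measurable borel" unfolding \<phi>_def by measurable
    show "0 \<le> \<phi> t" "\<phi> t \<le> B powr (q / 2)" for t
      using B[of t] q by (auto simp: \<phi>_def intro!: powr_mono2)
    show "(\<integral>\<^sup>+t. \<phi> t powr 2 \<partial>circ) \<le> 1"
      using bspec[OF norm, of r'] r'0 r'(2) by (simp add: \<phi>_def powr_powr)
  qed
qed

text \<open>Duality form of the theorem. The trilinear integrand \<open>F * k * U\<close>, with \<open>F\<close> from \<open>f\<close>, the Cauchy kernel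
  \<open>k\<close> and the Poisson extension \<open>U\<close> of \<open>G\<close>, is bounded pointwise by a sum of three terms, each of which
  omits one of the factors. Each term is integrated on circles first; the powers of \<open>y\<close> are the ones
  for which the remaining integrals over \<open>y\<close> are those of \<open>nn_integral_kernel_avg_scales\<close>.\<close>

lemma trilinear_bound:
  fixes p q :: real
  assumes p: "1 < p" and q: "0 < q" "q < p"
  obtains C where "0 \<le> C" "\<And>f r G B. \<lbrakk>f holomorphic_on ball 0 1;
      \<forall>s\<in>{0<..<1}. (\<integral>\<^sup>+t. norm (f (of_real s * cis t)) powr q \<partial>circ) \<le> 1;
      0 < r; r < 1; G \<in> borel_measurable borel; \<forall>t. 0 \<le> G t \<and> G t \<le> B;
      (\<integral>\<^sup>+t. G t powr (p / (p - 1)) \<partial>circ) \<le> 1\<rbrakk> \<Longrightarrow>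
    (\<integral>\<^sup>+\<psi>. ennreal (G \<psi>) * hankel_mass (1 / q - 1 / p - 1) f (of_real (r\<^sup>2) * cis \<psi>) \<partial>circ)
     \<le> ennreal C"
proof -
  define p' where "p' = p / (p - 1)"
  \<comment> \<open>the embeddings require \<open>q < s\<close> and \<open>t < p\<close>, and Young's inequality requires \<open>1 < s < t\<close>\<close>
  define s where "s = (2 * max q 1 + p) / 3"
  define t where "t = (max q 1 + 2 * p) / 3"
  define t' where "t' = t / (t - 1)"
  have mq: "max q 1 < p" "q \<le> max q 1" "1 \<le> max q 1" using p q by auto
  have st: "q < s" "1 < s" "s < t" "t < p" using mq unfolding s_def t_def by argo+
  have ip: "1 / p' = 1 - 1 / p" "1 / t' = 1 - 1 / t" using p st by (auto simp: p'_def t'_def field_simps)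
  have p': "1 < p'" "p' < t'"
    using p st by (auto simp: p'_def t'_def field_simps)
  \<comment> \<open>the exponent of the Cauchy kernel in Young's inequality\<close>
  define \<sigma> where "\<sigma> = 1 / (1 - 1 / s + 1 / t)"
  have "0 < 1 - 1 / s" "1 / t < 1 / s" "0 < 1 / t" using st by (auto simp: field_simps)
  hence D: "0 < 1 - 1 / s + 1 / t" "1 - 1 / s + 1 / t < 1" by argo+
  hence \<sigma>: "1 < \<sigma>" "0 < \<sigma>" unfolding \<sigma>_def by (simp_all only: less_divide_eq_1_pos zero_less_divide_1_iff)
  have i\<sigma>: "\<sigma> * (1 - 1 / s + 1 / t) = 1" unfolding \<sigma>_def by (rule divide_self[unfolded divide_inverse, OF less_imp_neq[OF D(1), symmetric], THEN trans[rotated]]) (simp add: divide_inverse mult.commute)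
  define \<theta>1 \<theta>2 \<theta>3 where "\<theta>1 = 1 / s - 1 / t" "\<theta>2 = 1 / t" "\<theta>3 = 1 - 1 / s"
  have \<theta>: "0 \<le> \<theta>1" "0 \<le> \<theta>2" "0 \<le> \<theta>3" "\<theta>1 + \<theta>2 + \<theta>3 = 1"
    using \<open>0 < 1 - 1 / s\<close> \<open>1 / t < 1 / s\<close> \<open>0 < 1 / t\<close> by (auto simp: \<theta>1_\<theta>2_\<theta>3_def)
  \<comment> \<open>the powers of \<open>y\<close> are chosen to match the weights in the embeddings; \<open>e4\<close> is the resulting scaling identity\<close>
  define a1 b1 c1 where "a1 = s / q + t' / p' - 3" "b1 = s / q + \<sigma> - 3" "c1 = t' / p' + \<sigma> - 3"
  have e1: "s * \<theta>1 + s * \<theta>2 = 1" using st by (simp add: \<theta>1_\<theta>2_\<theta>3_def field_simps)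
  have e2: "t' * \<theta>1 + t' * \<theta>3 = 1"
  proof -
    have "t' * \<theta>1 + t' * \<theta>3 = t' * (1 - 1 / t)" by (simp add: \<theta>1_\<theta>2_\<theta>3_def algebra_simps)
    also have "\<dots> = 1" unfolding ip(2)[symmetric] using p' by simp
    finally show ?thesis .
  qed
  have e3: "\<sigma> * \<theta>2 + \<sigma> * \<theta>3 = 1" using i\<sigma> by (simp add: \<theta>1_\<theta>2_\<theta>3_def algebra_simps)
  have e4: "a1 * \<theta>1 + b1 * \<theta>2 + c1 * \<theta>3 = 1 / q - 1 / p - 1"
  proof -
    have "a1 * \<theta>1 + b1 * \<theta>2 + c1 * \<theta>3 = (s * \<theta>1 + s * \<theta>2) * (1 / q) + (t' * \<theta>1 + t' * \<theta>3) * (1 / p') + (\<sigma> * \<theta>2 + \<sigma> * \<theta>3) - 3 * (\<theta>1 + \<theta>2 + \<theta>3)"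
      by (simp add: a1_b1_c1_def algebra_simps)
    also have "\<dots> = 1 / q + 1 / p' + 1 - 3" unfolding e1 e2 e3 \<theta>(4) by simp
    also have "\<dots> = 1 / q - 1 / p - 1" unfolding ip by simp
    finally show ?thesis .
  qed
  have pointwise: "y powr (1 / q - 1 / p - 1) * (F * k * U) \<le>
      y powr a1 * (F powr s * U powr t') + y powr b1 * (F powr s * k powr \<sigma>) + y powr c1 * (U powr t' * k powr \<sigma>)"
    if "0 < y" "0 \<le> F" "0 \<le> k" "0 \<le> U" for y F k U :: real
  proof -
    have "(y powr a1 * (F powr s * U powr t')) powr \<theta>1 * (y powr b1 * (F powr s * k powr \<sigma>)) powr \<theta>2 * (y powr c1 * (U powr t' * k powr \<sigma>)) powr \<theta>3
      = y powr (a1 * \<theta>1 + b1 * \<theta>2 + c1 * \<theta>3) * (F powr (s * \<theta>1 + s * \<theta>2) * k powr (\<sigma> * \<theta>2 + \<sigma> * \<theta>3) * U powr (t' * \<theta>1 + t' * \<theta>3))"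
      by (simp add: powr_mult powr_powr powr_add mult_ac)
    also have "\<dots> = y powr (1 / q - 1 / p - 1) * (F * k * U)"
      unfolding e1 e2 e3 e4 using that by simp
    finally show ?thesis
      using weighted_product_le_sum[OF _ _ _ \<theta>, of "y powr a1 * (F powr s * U powr t')" "y powr b1 * (F powr s * k powr \<sigma>)" "y powr c1 * (U powr t' * k powr \<sigma>)"]
      by simp
  qed
  define cF where "cF = 3 powr (2 * s / q - 2)"
  define ck where "ck = 12 powr \<sigma> / (\<sigma> - 1)"
  define DU where "DU = 2 powr t' * (1 / (t' / p' - 1) + 2 powr (t' - 1) / (1 - 1 / p'))"
  define DF where "DF = 2 powr (2 * s / q) * (1 / (2 * s / q / 2 - 1) + 2 powr (2 * s / q - 1) / (1 - 1 / 2))"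
  have c0: "0 \<le> cF" "0 \<le> ck" using \<sigma> by (auto simp: cF_def ck_def)
  have "2 < 2 * s / q" using st q by (simp add: field_simps)
  hence D0: "0 \<le> DU" "0 \<le> DF" using p' by (auto simp: DU_def DF_def intro!: mult_nonneg_nonneg add_nonneg_nonneg)
  show ?thesis
  proof (rule that[of "cF * DU + ck * DF + ck * DU"])
    show "0 \<le> cF * DU + ck * DF + ck * DU" using c0 D0 by simp
  next
    fix f :: "complex \<Rightarrow> complex" and r B :: real and G :: "real \<Rightarrow> real"
    assume f: "f holomorphic_on ball 0 1"
      and norm: "\<forall>s\<in>{0<..<1}. (\<integral>\<^sup>+t. norm (f (of_real s * cis t)) powr q \<partial>circ) \<le> 1"
      and r: "0 < r" "r < 1" and [measurable]: "G \<in> borel_measurable borel"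
      and GB: "\<forall>t. 0 \<le> G t \<and> G t \<le> B" and G1: "(\<integral>\<^sup>+t. G t powr (p / (p - 1)) \<partial>circ) \<le> 1"
    have G: "\<And>t. 0 \<le> G t" "\<And>t. G t \<le> B" using GB by auto
    obtain K \<phi> B' where K: "\<And>y. \<lbrakk>0 < y; y < 1\<rbrakk> \<Longrightarrow> averaging_kernel (K y) (2 / y)"
      and \<phi>: "\<phi> \<in> borel_measurable borel" "\<And>t. 0 \<le> \<phi> t" "\<And>t. \<phi> t \<le> B'" "(\<integral>\<^sup>+t. \<phi> t powr 2 \<partial>circ) \<le> 1"
      and maj: "\<And>y u. \<lbrakk>0 < y; y < 1\<rbrakk> \<Longrightarrow> norm (f (of_real ((1 - y) ^ 3 * r) * cis (- u))) powr (q / 2) \<le> kernel_avg (K y) \<phi> u"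
      by (rule hardy_kernel_majorant[OF f q(1) norm r]) (rule that)
    have [measurable]: "zero_ext f \<in> borel_measurable borel" by (rule zero_ext_measurable[OF f])
    define F where "F = (\<lambda>y u. norm (zero_ext f (of_real ((1 - y) ^ 3 * r) * cis (- u))))"
    define k where "k = (\<lambda>y u. cauchy_abs ((1 - y) * r) u)"
    define P where "P = (\<lambda>y u. poisson ((1 - y) * r) u)"
    define U where "U = (\<lambda>y. kernel_avg (\<lambda>x t. P y (x - t)) G)"
    have F_meas [measurable (raw)]: "(\<lambda>x. F (g x) (h x)) \<in> borel_measurable M"
      and k_meas [measurable (raw)]: "(\<lambda>x. k (g x) (h x)) \<in> borel_measurable M"
      and P_meas [measurable (raw)]: "(\<lambda>x. P (g x) (h x)) \<in> borel_measurable M"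
      if [measurable]: "g \<in> borel_measurable M" "h \<in> borel_measurable M" for g h and M :: "'c measure"
      unfolding F_def k_def P_def by measurable
    have U_meas [measurable (raw)]: "(\<lambda>x. U (g x) (h x)) \<in> borel_measurable M"
      if [measurable]: "g \<in> borel_measurable M" "h \<in> borel_measurable M" for g h and M :: "'c measure"
      unfolding U_def kernel_avg_def by measurable
    have per: "F y (u + 2 * pi) = F y u" "k y (u + 2 * pi) = k y u" "P y (u + 2 * pi) = P y u" for y u
    proof -
      have "cis (- (u + 2 * pi)) = cis (- u) * cis (- (2 * pi))" by (simp add: cis_mult)
      also have "cis (- (2 * pi)) = 1" by (simp add: cis_cnj[symmetric])
      finally show "F y (u + 2 * pi) = F y u" by (simp add: F_def)
      show "k y (u + 2 * pi) = k y u" by (simp add: k_def cauchy_abs_def cis_mult[symmetric])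
      show "P y (u + 2 * pi) = P y u" by (simp add: P_def poisson_periodic)
    qed
    have perU: "U y (u + 2 * pi) = U y u" for y u
    proof -
      have "P y (u + 2 * pi - t) = P y (u - t)" for t using per(3)[of y "u - t"] by (simp add: algebra_simps)
      thus ?thesis by (simp add: U_def kernel_avg_def)
    qed
    have R: "0 \<le> (1 - y) * r" "(1 - y) * r \<le> 1 - y" "(1 - y) * r < 1" if "0 < y" "y < 1" for y
    proof -
      show "0 \<le> (1 - y) * r" using that r by simp
      show *: "(1 - y) * r \<le> 1 - y" using that r by (simp add: mult_left_le)
      show "(1 - y) * r < 1" using * that by linarith
    qed
    have y3: "(1 - y) ^ 3 * r < 1" if "0 < y" "y < 1" for y
    proof -
      have "(1 - y) ^ 3 \<le> 1 ^ 3" using that by (intro power_mono) auto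
      hence "(1 - y) ^ 3 * r \<le> 1 * r" using r by (intro mult_right_mono) auto
      thus ?thesis using r by linarith
    qed
    have KU: "averaging_kernel (\<lambda>x t. P y (x - t)) (2 / y)" if "0 < y" "y < 1" for y
      unfolding P_def by (rule averaging_kernel_poisson(1)[OF R(1,2)[OF that] that(1)])
    have nn: "0 \<le> F y u" "0 \<le> k y u" for y u by (auto simp: F_def k_def cauchy_abs_nonneg)
    have U0: "0 \<le> U y u" if "0 < y" "y < 1" for y u
      unfolding U_def by (rule averaging_kernel.kernel_avg_nonneg[OF KU[OF that] G(1)])
    define NF NU Nk where "NF = (\<lambda>y. \<integral>\<^sup>+u. F y u powr s \<partial>circ)"
      "NU = (\<lambda>y. \<integral>\<^sup>+u. U y u powr t' \<partial>circ)" "Nk = (\<lambda>y. \<integral>\<^sup>+u. k y u powr \<sigma> \<partial>circ)"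
    have [measurable]: "NF \<in> borel_measurable borel" "NU \<in> borel_measurable borel"
      unfolding NF_NU_Nk_def by measurable
    have F_le: "F y u powr s \<le> kernel_avg (K y) \<phi> u powr (2 * s / q)" if y: "0 < y" "y < 1" for y u
    proof -
      have "norm (complex_of_real ((1 - y) ^ 3 * r) * cis (- u)) < 1"
        using y r y3[OF y] by (subst norm_scaled_cis) auto
      hence "F y u = norm (f (of_real ((1 - y) ^ 3 * r) * cis (- u)))" by (simp only: F_def zero_ext_eq)
      hence "(F y u powr (q / 2)) powr (2 * s / q) \<le> kernel_avg (K y) \<phi> u powr (2 * s / q)"
        using maj[OF y] st q by (intro powr_mono2) auto
      thus ?thesis using q by (simp add: powr_powr)
    qed
    have sq: "2 < 2 * s / q" using st q by (simp add: field_simps)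
    have NF_le: "NF y \<le> ennreal (cF * y powr (1 - s / q))" if yy: "0 < y" "y < 1" for y
    proof -
      interpret averaging_kernel "K y" "2 / y" by (rule K[OF yy])
      interpret averaging_kernel_scale "K y" 2 y 2 \<phi> B'
        by unfold_locales (use yy \<phi> in auto)
      have "NF y \<le> (\<integral>\<^sup>+u. kernel_avg (K y) \<phi> u powr (2 * s / q) \<partial>circ)"
        unfolding NF_NU_Nk_def by (intro nn_integral_mono ennreal_leI F_le yy)
      also have "\<dots> \<le> ennreal ((2 + 1) powr (2 * s / q - 2) * y powr (1 - 2 * s / q / 2))"
        by (rule kernel_avg_norm_le[OF sq])
      finally show ?thesis by (simp add: cF_def)
    qed
    have NF_int: "(\<integral>\<^sup>+y. ennreal (y powr (s / q - 2)) * NF y \<partial>unit_interval) \<le> ennreal DF"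
    proof -
      have "(\<integral>\<^sup>+y. ennreal (y powr (s / q - 2)) * NF y \<partial>unit_interval) \<le>
         (\<integral>\<^sup>+y. ennreal (y powr (2 * s / q / 2 - 2)) * (\<integral>\<^sup>+u. kernel_avg (K y) \<phi> u powr (2 * s / q) \<partial>circ) \<partial>unit_interval)"
      proof (rule nn_integral_mono_AE, rule eventually_mono[OF AE_unit])
        fix y :: real assume y: "0 < y \<and> y < 1"
        show "ennreal (y powr (s / q - 2)) * NF y \<le> ennreal (y powr (2 * s / q / 2 - 2)) * (\<integral>\<^sup>+u. kernel_avg (K y) \<phi> u powr (2 * s / q) \<partial>circ)"
          unfolding NF_NU_Nk_def using y F_le by (auto intro!: mult_mono nn_integral_mono ennreal_leI)
      qed
      also have "\<dots> \<le> ennreal DF"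
        unfolding DF_def using sq by (intro nn_integral_kernel_avg_scales[OF K _ _ _ \<phi>]) auto
      finally show ?thesis .
    qed
    have NU_int: "(\<integral>\<^sup>+y. ennreal (y powr (t' / p' - 2)) * NU y \<partial>unit_interval) \<le> ennreal DU"
      unfolding NF_NU_Nk_def U_def DU_def using p' G G1
      by (intro nn_integral_kernel_avg_scales[OF KU, where B=B]) (auto simp: p'_def)
    have Nk_le: "Nk y \<le> ennreal (ck * y powr (1 - \<sigma>))" if y: "0 < y" "y < 1" for y
      unfolding NF_NU_Nk_def k_def ck_def by (rule nn_integral_cauchy_abs_powr[OF R(1,2)[OF y] y(1) \<sigma>(1)])
    define \<beta> where "\<beta> = 1 / q - 1 / p - 1"
    define Q where "Q = (\<lambda>y x t. ennreal (F y (x - t) * k y t))"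
    have [measurable]: "(\<lambda>x. Q (g x) (h x) (i x)) \<in> borel_measurable M"
      if [measurable]: "g \<in> borel_measurable M" "h \<in> borel_measurable M" "i \<in> borel_measurable M" for g h i and M :: "'c measure"
      unfolding Q_def by measurable
    have "(\<integral>\<^sup>+\<psi>. ennreal (G \<psi>) * (\<integral>\<^sup>+y. ennreal (y powr \<beta>) *
        (\<integral>\<^sup>+x. norm (hankel_weight f (of_real (r\<^sup>2) * cis \<psi>) (of_real ((1 - y)\<^sup>2) * cis (- x))) \<partial>circ) \<partial>unit_interval) \<partial>circ)
      \<le> (\<integral>\<^sup>+\<psi>. ennreal (G \<psi>) * (\<integral>\<^sup>+y. ennreal (y powr \<beta>) *
        (\<integral>\<^sup>+x. \<integral>\<^sup>+t. Q y x t * ennreal (P y (x + t - \<psi>)) \<partial>circ \<partial>circ) \<partial>unit_interval) \<partial>circ)"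
    proof (rule nn_integral_mono, rule mult_left_mono, rule nn_integral_mono_AE)
      fix \<psi>
      show "AE y in unit_interval. ennreal (y powr \<beta>) * (\<integral>\<^sup>+x. norm (hankel_weight f (of_real (r\<^sup>2) * cis \<psi>) (of_real ((1 - y)\<^sup>2) * cis (- x))) \<partial>circ)
         \<le> ennreal (y powr \<beta>) * (\<integral>\<^sup>+x. \<integral>\<^sup>+t. Q y x t * ennreal (P y (x + t - \<psi>)) \<partial>circ \<partial>circ)"
      proof (rule eventually_mono[OF AE_unit], rule mult_left_mono, rule nn_integral_mono)
        fix y x :: real assume y: "0 < y \<and> y < 1"
        have "ennreal (norm (hankel_weight f (of_real (r\<^sup>2) * cis \<psi>) (of_real ((1 - y)\<^sup>2) * cis (- x)))) \<le>
          (\<integral>\<^sup>+t. norm (f (of_real ((1 - y) ^ 3 * r) * cis (t - x))) * cauchy_abs ((1 - y) * r) t * poisson ((1 - y) * r) (x + t - \<psi>) \<partial>circ)"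
          using y by (intro hankel_weight_le[OF f r]) auto
        also have "\<dots> = (\<integral>\<^sup>+t. Q y x t * ennreal (P y (x + t - \<psi>)) \<partial>circ)"
        proof (rule nn_integral_cong)
          fix t
          have "norm (complex_of_real ((1 - y) ^ 3 * r) * cis (t - x)) < 1"
            using y r y3[of y] by (subst norm_scaled_cis) auto
          hence "F y (x - t) = norm (f (of_real ((1 - y) ^ 3 * r) * cis (t - x)))"
            by (simp add: F_def zero_ext_eq)
          thus "ennreal (norm (f (of_real ((1 - y) ^ 3 * r) * cis (t - x))) * cauchy_abs ((1 - y) * r) t * poisson ((1 - y) * r) (x + t - \<psi>))
             = Q y x t * ennreal (P y (x + t - \<psi>))"
            using nn unfolding Q_def k_def P_def by (simp add: ennreal_mult' cauchy_abs_nonneg)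
        qed
        finally show "ennreal (norm (hankel_weight f (of_real (r\<^sup>2) * cis \<psi>) (of_real ((1 - y)\<^sup>2) * cis (- x)))) \<le>
           (\<integral>\<^sup>+t. Q y x t * ennreal (P y (x + t - \<psi>)) \<partial>circ)" .
      qed auto
    qed auto
    also have "\<dots> = (\<integral>\<^sup>+y. ennreal (y powr \<beta>) * (\<integral>\<^sup>+\<psi>. ennreal (G \<psi>) *
        (\<integral>\<^sup>+x. \<integral>\<^sup>+t. Q y x t * ennreal (P y (x + t - \<psi>)) \<partial>circ \<partial>circ) \<partial>circ) \<partial>unit_interval)"
      by (rule nn_integral_swap_weighted[OF circ.sigma_finite_measure_axioms unit_interval.sigma_finite_measure_axioms]) measurable
    also have "\<dots> = (\<integral>\<^sup>+y. ennreal (y powr \<beta>) * (\<integral>\<^sup>+x. \<integral>\<^sup>+t. Q y x t * (\<integral>\<^sup>+\<psi>. ennreal (G \<psi>) *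
         ennreal (P y (x + t - \<psi>)) \<partial>circ) \<partial>circ \<partial>circ) \<partial>unit_interval)"
    proof (rule nn_integral_cong, rule arg_cong2[where f="(*)"], rule refl)
      fix y
      have "(\<integral>\<^sup>+\<psi>. ennreal (G \<psi>) * (\<integral>\<^sup>+x. \<integral>\<^sup>+t. Q y x t * ennreal (P y (x + t - \<psi>)) \<partial>circ \<partial>circ) \<partial>circ)
        = (\<integral>\<^sup>+x. \<integral>\<^sup>+\<psi>. ennreal (G \<psi>) * (\<integral>\<^sup>+t. Q y x t * ennreal (P y (x + t - \<psi>)) \<partial>circ) \<partial>circ \<partial>circ)"
        using nn_integral_swap_weighted[OF circ.sigma_finite_measure_axioms circ.sigma_finite_measure_axioms,
          of "\<lambda>\<psi>. ennreal (G \<psi>)" "\<lambda>x. 1" "\<lambda>\<psi> x. \<integral>\<^sup>+t. Q y x t * ennreal (P y (x + t - \<psi>)) \<partial>circ"] by simp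
      also have "\<dots> = (\<integral>\<^sup>+x. \<integral>\<^sup>+t. Q y x t * (\<integral>\<^sup>+\<psi>. ennreal (G \<psi>) * ennreal (P y (x + t - \<psi>)) \<partial>circ) \<partial>circ \<partial>circ)"
        by (intro nn_integral_cong nn_integral_swap_weighted[OF circ.sigma_finite_measure_axioms circ.sigma_finite_measure_axioms]) measurable
      finally show "(\<integral>\<^sup>+\<psi>. ennreal (G \<psi>) * (\<integral>\<^sup>+x. \<integral>\<^sup>+t. Q y x t * ennreal (P y (x + t - \<psi>)) \<partial>circ \<partial>circ) \<partial>circ)
        = (\<integral>\<^sup>+x. \<integral>\<^sup>+t. Q y x t * (\<integral>\<^sup>+\<psi>. ennreal (G \<psi>) * ennreal (P y (x + t - \<psi>)) \<partial>circ) \<partial>circ \<partial>circ)" .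
    qed
    also have "\<dots> \<le> (\<integral>\<^sup>+y. ennreal cF * (ennreal (y powr (t' / p' - 2)) * NU y)
       + ennreal ck * (ennreal (y powr (s / q - 2)) * NF y) + ennreal ck * (ennreal (y powr (t' / p' - 2)) * NU y) \<partial>unit_interval)"
    proof (rule nn_integral_mono_AE, rule eventually_mono[OF AE_unit])
      fix y :: real assume "0 < y \<and> y < 1"
      hence y: "0 < y" "y < 1" by auto
      interpret KU: averaging_kernel "\<lambda>x t. P y (x - t)" "2 / y" by (rule KU[OF y])
      \<comment> \<open>integrating out \<open>\<psi>\<close> produces the Poisson extension of \<open>G\<close>\<close>
      have U_eq: "(\<integral>\<^sup>+\<psi>. ennreal (G \<psi>) * ennreal (P y (v - \<psi>)) \<partial>circ) = ennreal (U y v)" for v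
      proof -
        have "(\<integral>\<^sup>+\<psi>. ennreal (G \<psi>) * ennreal (P y (v - \<psi>)) \<partial>circ) = (\<integral>\<^sup>+\<psi>. ennreal (P y (v - \<psi>) * G \<psi>) \<partial>circ)"
          using G KU.nonneg[of v] by (intro nn_integral_cong) (simp add: ennreal_mult mult.commute)
        also have "\<dots> = ennreal (U y v)" unfolding U_def using G by (intro KU.nn_integral_eq[where B=B]) auto
        finally show ?thesis .
      qed
      have "ennreal (y powr \<beta>) * (\<integral>\<^sup>+x. \<integral>\<^sup>+t. Q y x t * (\<integral>\<^sup>+\<psi>. ennreal (G \<psi>) * ennreal (P y (x + t - \<psi>)) \<partial>circ) \<partial>circ \<partial>circ)
        = (\<integral>\<^sup>+x. \<integral>\<^sup>+t. ennreal (y powr \<beta> * (F y (x - t) * k y t * U y (x + t))) \<partial>circ \<partial>circ)"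
        unfolding U_eq Q_def using nn U0[OF y]
        by (simp add: nn_integral_cmult[symmetric] ennreal_mult mult.assoc)
      also have "\<dots> \<le> (\<integral>\<^sup>+x. \<integral>\<^sup>+t. ennreal (y powr a1) * (ennreal (F y (x - t) powr s) * ennreal (U y (x + t) powr t'))
          + ennreal (y powr b1) * (ennreal (F y (x - t) powr s) * ennreal (k y t powr \<sigma>))
          + ennreal (y powr c1) * (ennreal (U y (x + t) powr t') * ennreal (k y t powr \<sigma>)) \<partial>circ \<partial>circ)"
      proof (intro nn_integral_mono)
        fix x t
        have "ennreal (y powr \<beta> * (F y (x - t) * k y t * U y (x + t))) \<le>
           ennreal (y powr a1 * (F y (x - t) powr s * U y (x + t) powr t') + y powr b1 * (F y (x - t) powr s * k y t powr \<sigma>)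
            + y powr c1 * (U y (x + t) powr t' * k y t powr \<sigma>))"
          unfolding \<beta>_def by (intro ennreal_leI pointwise y nn U0)
        thus "ennreal (y powr \<beta> * (F y (x - t) * k y t * U y (x + t))) \<le>
          ennreal (y powr a1) * (ennreal (F y (x - t) powr s) * ennreal (U y (x + t) powr t'))
          + ennreal (y powr b1) * (ennreal (F y (x - t) powr s) * ennreal (k y t powr \<sigma>))
          + ennreal (y powr c1) * (ennreal (U y (x + t) powr t') * ennreal (k y t powr \<sigma>))"
          by (simp add: ennreal_mult ennreal_plus)
      qed
      also have "\<dots> = ennreal (y powr a1) * (\<integral>\<^sup>+x. \<integral>\<^sup>+t. ennreal (F y (x - t) powr s) * ennreal (U y (x + t) powr t') \<partial>circ \<partial>circ)
          + ennreal (y powr b1) * (\<integral>\<^sup>+x. \<integral>\<^sup>+t. ennreal (F y (x - t) powr s) * ennreal (k y t powr \<sigma>) \<partial>circ \<partial>circ)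
          + ennreal (y powr c1) * (\<integral>\<^sup>+x. \<integral>\<^sup>+t. ennreal (U y (x + t) powr t') * ennreal (k y t powr \<sigma>) \<partial>circ \<partial>circ)"
        by (simp add: nn_integral_add nn_integral_cmult)
      also have "(\<integral>\<^sup>+x. \<integral>\<^sup>+t. ennreal (F y (x - t) powr s) * ennreal (U y (x + t) powr t') \<partial>circ \<partial>circ) = NF y * NU y"
        unfolding NF_NU_Nk_def
        by (rule nn_integral_shear_both[where F="\<lambda>u. ennreal (F y u powr s)" and H="\<lambda>u. ennreal (U y u powr t')"])
           (auto simp: per perU)
      also have "(\<integral>\<^sup>+x. \<integral>\<^sup>+t. ennreal (F y (x - t) powr s) * ennreal (k y t powr \<sigma>) \<partial>circ \<partial>circ) = NF y * Nk y"
        unfolding NF_NU_Nk_def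
        using nn_integral_shear_minus[where F="\<lambda>u. ennreal (F y u powr s)" and H="\<lambda>u. ennreal (k y u powr \<sigma>)" and c="-1"]
        by (simp add: per)
      also have "(\<integral>\<^sup>+x. \<integral>\<^sup>+t. ennreal (U y (x + t) powr t') * ennreal (k y t powr \<sigma>) \<partial>circ \<partial>circ) = NU y * Nk y"
        unfolding NF_NU_Nk_def
        using nn_integral_shear_minus[where F="\<lambda>u. ennreal (U y u powr t')" and H="\<lambda>u. ennreal (k y u powr \<sigma>)" and c=1]
        by (simp add: perU)
      also have "ennreal (y powr a1) * (NF y * NU y) + ennreal (y powr b1) * (NF y * Nk y) + ennreal (y powr c1) * (NU y * Nk y)
        \<le> ennreal (y powr a1) * (ennreal (cF * y powr (1 - s / q)) * NU y) + ennreal (y powr b1) * (NF y * ennreal (ck * y powr (1 - \<sigma>)))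
          + ennreal (y powr c1) * (NU y * ennreal (ck * y powr (1 - \<sigma>)))"
        by (intro add_mono mult_left_mono mult_right_mono NF_le Nk_le y) auto
      also have "\<dots> = ennreal cF * (ennreal (y powr a1 * y powr (1 - s / q)) * NU y)
         + ennreal ck * (ennreal (y powr b1 * y powr (1 - \<sigma>)) * NF y) + ennreal ck * (ennreal (y powr c1 * y powr (1 - \<sigma>)) * NU y)"
        using c0 by (simp add: ennreal_mult mult_ac)
      also have "y powr a1 * y powr (1 - s / q) = y powr (t' / p' - 2)"
        by (simp add: powr_add[symmetric] a1_b1_c1_def)
      also have "y powr b1 * y powr (1 - \<sigma>) = y powr (s / q - 2)"
        by (simp add: powr_add[symmetric] a1_b1_c1_def)
      also have "y powr c1 * y powr (1 - \<sigma>) = y powr (t' / p' - 2)"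
        by (simp add: powr_add[symmetric] a1_b1_c1_def)
      finally show "ennreal (y powr \<beta>) * (\<integral>\<^sup>+x. \<integral>\<^sup>+t. Q y x t * (\<integral>\<^sup>+\<psi>. ennreal (G \<psi>) * ennreal (P y (x + t - \<psi>)) \<partial>circ) \<partial>circ \<partial>circ)
        \<le> ennreal cF * (ennreal (y powr (t' / p' - 2)) * NU y)
       + ennreal ck * (ennreal (y powr (s / q - 2)) * NF y) + ennreal ck * (ennreal (y powr (t' / p' - 2)) * NU y)" .
    qed
    also have "\<dots> = ennreal cF * (\<integral>\<^sup>+y. ennreal (y powr (t' / p' - 2)) * NU y \<partial>unit_interval)
       + ennreal ck * (\<integral>\<^sup>+y. ennreal (y powr (s / q - 2)) * NF y \<partial>unit_interval)
       + ennreal ck * (\<integral>\<^sup>+y. ennreal (y powr (t' / p' - 2)) * NU y \<partial>unit_interval)"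
      by (simp add: nn_integral_add nn_integral_cmult)
    also have "\<dots> \<le> ennreal cF * ennreal DU + ennreal ck * ennreal DF + ennreal ck * ennreal DU"
      by (intro add_mono mult_left_mono NU_int NF_int) auto
    also have "\<dots> = ennreal (cF * DU + ck * DF + ck * DU)"
      using c0 D0 by (simp add: ennreal_mult ennreal_plus)
    finally show "(\<integral>\<^sup>+\<psi>. ennreal (G \<psi>) * hankel_mass (1 / q - 1 / p - 1) f (of_real (r\<^sup>2) * cis \<psi>) \<partial>circ)
     \<le> ennreal (cF * DU + ck * DF + ck * DU)" unfolding \<beta>_def hankel_mass_def .
  qed
qed

section \<open>Boundedness on Hardy spaces\<close>

definition truncated_hankel :: "(complex \<Rightarrow> complex) \<Rightarrow> (complex \<Rightarrow> complex) \<Rightarrow> complex \<Rightarrow> complex" where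
  "truncated_hankel b f z = (\<Sum>m. (\<Sum>n\<le>m. taylor_coeff b (m + n) * taylor_coeff f n) * z ^ m)"

lemma matrix_op_truncated_hankel:
  "matrix_op (truncate_1_0 (hankel_matrix b)) f = truncated_hankel b f"
  by (auto simp: fun_eq_iff matrix_op_def truncated_hankel_def sums_unique[OF truncated_row_sum, symmetric])

lemma continuous_circle:
  assumes "F holomorphic_on ball 0 1" "0 \<le> s" "s < 1"
  shows "continuous_on UNIV (\<lambda>t. F (of_real s * cis t))"
  by (rule continuous_on_compose2[OF holomorphic_on_imp_continuous_on[OF assms(1)]])
     (use assms in \<open>auto intro!: continuous_intros simp: norm_scaled_cis\<close>)

lemma continuous_circle_powr:
  assumes "F holomorphic_on ball 0 1" "0 \<le> s" "s < 1" "0 < r"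
  shows "continuous_on UNIV (\<lambda>t. norm (F (of_real s * cis t)) powr r)"
  using assms by (intro continuous_on_powr' continuous_on_norm continuous_circle continuous_on_const) auto

lemma bounded_circle:
  assumes "F holomorphic_on ball 0 1" "0 \<le> s" "s < 1"
  obtains B where "\<And>t. norm (F (of_real s * cis t)) \<le> B"
proof -
  have "continuous_on (cball 0 s) F"
    by (rule continuous_on_subset[OF holomorphic_on_imp_continuous_on[OF assms(1)]]) (use assms in auto)
  hence "bounded (F ` cball 0 s)" by (intro compact_imp_bounded compact_continuous_image compact_cball)
  then obtain B where "\<forall>x\<in>F ` cball 0 s. norm x \<le> B" unfolding bounded_iff by blast
  hence "norm (F (of_real s * cis t)) \<le> B" for t using assms by (simp add: norm_scaled_cis)
  thus ?thesis by (rule that)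
qed

lemma integrable_circle_powr:
  assumes F: "F holomorphic_on ball 0 1" "0 \<le> s" "s < 1" and r: "0 < r"
  shows "integrable circ (\<lambda>t. norm (F (of_real s * cis t)) powr r)"
proof -
  obtain B where B: "\<And>t. norm (F (of_real s * cis t)) \<le> B" by (rule bounded_circle[OF F]) (rule that)
  show ?thesis
    by (rule integrable_circ_bounded[where B="B powr r"])
       (use B r in \<open>auto intro!: powr_mono2 borel_measurable_continuous_onI[OF continuous_circle_powr[OF F r]]\<close>)
qed

lemma integral_mean_circ:
  assumes "F holomorphic_on ball 0 1" "0 \<le> s" "s < 1" "0 < r"
  shows "integral_mean r F s = (LINT t|circ. norm (F (of_real s * cis t)) powr r) powr (1 / r)"
  unfolding integral_mean_def by (subst integral_circ[OF continuous_circle_powr[OF assms]]) simp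

lemma truncated_hankel_holomorphic:
  assumes f: "f holomorphic_on ball 0 1" and B: "\<And>k. norm (taylor_coeff b k) \<le> B"
  shows "truncated_hankel b f holomorphic_on ball 0 1"
  unfolding truncated_hankel_def
proof (rule power_series_holomorphic[where a="\<lambda>m. (\<Sum>n\<le>m. taylor_coeff b (m + n) * taylor_coeff f n)"])
  fix w :: complex assume "w \<in> ball 0 1"
  thus "(\<lambda>m. (\<Sum>n\<le>m. taylor_coeff b (m + n) * taylor_coeff f n) * (w - 0) ^ m) sums
     (\<Sum>m. (\<Sum>n\<le>m. taylor_coeff b (m + n) * taylor_coeff f n) * w ^ m)"
    using summable_sums[OF hankel_series(1)[OF f _ B, of w]] by simp
qed

lemma truncated_hankel_scale:
  assumes f: "f holomorphic_on ball 0 1" and B: "\<And>k. norm (taylor_coeff b k) \<le> B" and z: "norm z < 1"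
  shows "truncated_hankel b (\<lambda>z. c * f z) z = c * truncated_hankel b f z"
proof -
  have "taylor_coeff (\<lambda>z. c * f z) n = c * taylor_coeff f n" for n
    unfolding taylor_coeff_def using higher_deriv_cmult[OF f, of 0 n c] by simp
  hence "truncated_hankel b (\<lambda>z. c * f z) z = (\<Sum>m. c * ((\<Sum>n\<le>m. taylor_coeff b (m + n) * taylor_coeff f n) * z ^ m))"
    by (simp add: truncated_hankel_def sum_distrib_left mult_ac)
  also have "\<dots> = c * truncated_hankel b f z"
    unfolding truncated_hankel_def by (rule suminf_mult[OF hankel_series(1)[OF f z B]])
  finally show ?thesis .
qed

lemma norm_at_0_le:
  assumes f: "f holomorphic_on ball 0 1" and q: "0 < q"
    and norm: "\<forall>s\<in>{0<..<1}. (\<integral>\<^sup>+t. norm (f (of_real s * cis t)) powr q \<partial>circ) \<le> 1"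
  shows "norm (f 0) \<le> 1"
proof -
  obtain r' where r': "1 / 2 \<le> r'" "r' < 1" and maj:
    "\<And>R u c. \<lbrakk>0 \<le> R; R < r'; 0 < c\<rbrakk> \<Longrightarrow> norm (f (of_real R * cis u)) powr c
        \<le> (LINT t|circ. poisson (R / r') (t - u) * norm (f (of_real r' * cis t)) powr c)"
    by (rule Poisson_majorant_disc[OF f, of "1 / 2"]) (auto intro: that)
  have int: "integrable circ (\<lambda>t. norm (f (of_real r' * cis t)) powr q)"
    using r' by (intro integrable_circle_powr[OF f _ _ q]) auto
  have "norm (f 0) powr q \<le> (LINT t|circ. norm (f (of_real r' * cis t)) powr q)"
    using maj[of 0 q 0] r' q by (simp add: poisson_def)
  also have "\<dots> \<le> 1"
  proof -
    have "ennreal (LINT t|circ. norm (f (of_real r' * cis t)) powr q) \<le> 1"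
      using bspec[OF norm, of r'] r' by (subst nn_integral_eq_integral[symmetric, OF int]) auto
    thus ?thesis by (simp add: ennreal_le_1)
  qed
  finally have "(norm (f 0) powr q) powr (1 / q) \<le> 1 powr (1 / q)" using q by (intro powr_mono2) auto
  thus ?thesis using q by (simp add: powr_powr)
qed

text \<open>With \<open>N\<close> the norm of \<open>h\<close> on the circle of radius \<open>\<rho>\<close>, the function \<open>G = (h / N) powr (p - 1)\<close> has norm one in
  the dual space and its pairing with \<open>h\<close> is \<open>N\<close>.\<close>

lemma truncated_hankel_normalised_bound:
  fixes p q \<alpha> :: real
  assumes p: "1 < p" and q: "0 < q" "q < p" and \<alpha>: "\<alpha> = 1 / q - 1 / p" and b: "b \<in> lipschitz_disc \<alpha>"
  obtains D where "0 \<le> D" "\<And>f \<rho>. \<lbrakk>f holomorphic_on ball 0 1;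
      \<forall>s\<in>{0<..<1}. (\<integral>\<^sup>+t. norm (f (of_real s * cis t)) powr q \<partial>circ) \<le> 1; 0 < \<rho>; \<rho> < 1\<rbrakk>
      \<Longrightarrow> integral_mean p (truncated_hankel b f) \<rho> \<le> D"
proof -
  have \<alpha>0: "0 < \<alpha>" using p q by (simp add: \<alpha> field_simps)
  have b_hol: "b holomorphic_on ball 0 1" using b by (simp add: lipschitz_disc_def)
  obtain B where B: "\<And>z. norm z < 1 \<Longrightarrow> norm (b z) \<le> B" by (rule lipschitz_disc_bounded[OF b]) (rule that)
  have B0: "0 \<le> B" using order_trans[OF norm_ge_zero B[of 0]] by simp
  have bk: "norm (taylor_coeff b k) \<le> B" for k
    by (rule taylor_coeff_bounded[OF b_hol B])
  obtain k C where k: "0 < (k::nat)" "\<alpha> < k" "0 < C"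
    and E: "\<And>z. norm z < 1 \<Longrightarrow> norm ((euler ^^ k) b z) \<le> C * norm z * (1 - norm z) powr (\<alpha> - k)"
    by (rule lipschitz_disc_euler_bound[OF b \<alpha>0]) (rule that)
  obtain C1 where C1: "0 < C1" and rep: "\<And>f z. \<lbrakk>f holomorphic_on ball 0 1; norm z < 1\<rbrakk> \<Longrightarrow>
     ennreal (norm (\<Sum>m. (\<Sum>n\<le>m. taylor_coeff b (m + n) * taylor_coeff f n) * z ^ m)) \<le>
       ennreal (B * norm (f 0)) + ennreal C1 * hankel_mass (\<alpha> - 1) f z"
    by (rule representation_bound[OF b_hol _ k(1) \<alpha>0 k(2,3), where B=B])
       (rule B, assumption, rule E, assumption, rule that)
  obtain C2 where C2: "0 \<le> C2" and tri: "\<And>f r G B. \<lbrakk>f holomorphic_on ball 0 1;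
      \<forall>s\<in>{0<..<1}. (\<integral>\<^sup>+t. norm (f (of_real s * cis t)) powr q \<partial>circ) \<le> 1;
      0 < r; r < 1; G \<in> borel_measurable borel; \<forall>t. 0 \<le> G t \<and> G t \<le> B;
      (\<integral>\<^sup>+t. G t powr (p / (p - 1)) \<partial>circ) \<le> 1\<rbrakk> \<Longrightarrow>
    (\<integral>\<^sup>+\<psi>. ennreal (G \<psi>) * hankel_mass (1 / q - 1 / p - 1) f (of_real (r\<^sup>2) * cis \<psi>) \<partial>circ)
     \<le> ennreal C2"
    by (rule trilinear_bound[OF p q]) (rule that)
  define D where "D = 2 * B + C1 * C2"
  have D0: "0 \<le> D" using B0 C1 C2 by (simp add: D_def)
  show ?thesis
  proof (rule that[OF D0])
    fix f :: "complex \<Rightarrow> complex" and \<rho> :: real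
    assume f: "f holomorphic_on ball 0 1"
      and norm: "\<forall>s\<in>{0<..<1}. (\<integral>\<^sup>+t. norm (f (of_real s * cis t)) powr q \<partial>circ) \<le> 1"
      and \<rho>: "0 < \<rho>" "\<rho> < 1"
    \<comment> \<open>\<open>hankel_weight_le\<close> at the point of modulus \<open>\<rho> = r\<^sup>2\<close> uses \<open>f\<close> and both kernels at radii up to \<open>r\<close> only\<close>
    define r where "r = sqrt \<rho>"
    have r: "0 < r" "r < 1" "r\<^sup>2 = \<rho>" using \<rho> by (auto simp: r_def)
    define h where "h = (\<lambda>\<psi>. norm (truncated_hankel b f (of_real \<rho> * cis \<psi>)))"
    have hol: "truncated_hankel b f holomorphic_on ball 0 1" by (rule truncated_hankel_holomorphic[OF f bk])
    have h0: "0 \<le> h \<psi>" for \<psi> by (simp add: h_def)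
    obtain Bh where "\<And>\<psi>. norm (truncated_hankel b f (of_real \<rho> * cis \<psi>)) \<le> Bh"
      by (rule bounded_circle[OF hol less_imp_le[OF \<rho>(1)] \<rho>(2)]) (rule that)
    hence Bh: "h \<psi> \<le> Bh" for \<psi> by (simp add: h_def)
    have [measurable]: "h \<in> borel_measurable borel"
      unfolding h_def using \<rho> by (intro borel_measurable_continuous_onI continuous_on_norm continuous_circle[OF hol]) auto
    have int: "integrable circ (\<lambda>\<psi>. h \<psi> powr p)"
      unfolding h_def using \<rho> p by (intro integrable_circle_powr[OF hol]) auto
    define S where "S = (LINT \<psi>|circ. h \<psi> powr p)"
    have mean: "integral_mean p (truncated_hankel b f) \<rho> = S powr (1 / p)"
      unfolding S_def h_def using \<rho> p by (intro integral_mean_circ[OF hol]) auto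
    have S0: "0 \<le> S" unfolding S_def by (intro Bochner_Integration.integral_nonneg) auto
    have nnS: "(\<integral>\<^sup>+\<psi>. h \<psi> powr p \<partial>circ) = ennreal S"
      unfolding S_def by (rule nn_integral_eq_integral[OF int]) auto
    show "integral_mean p (truncated_hankel b f) \<rho> \<le> D"
    proof (cases "S = 0")
      case True thus ?thesis using mean D0 p by simp
    next
      case False
      define N where "N = S powr (1 / p)"
      have N: "0 < N" "N powr p = S" using False S0 p by (auto simp: N_def powr_powr)
      define G where "G = (\<lambda>\<psi>. (h \<psi> / N) powr (p - 1))"
      have [measurable]: "G \<in> borel_measurable borel" unfolding G_def by measurable
      have G0: "0 \<le> G \<psi>" for \<psi> by (simp add: G_def)
      have GB: "G \<psi> \<le> (Bh / N) powr (p - 1)" for \<psi>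
        unfolding G_def using h0 Bh N p by (intro powr_mono2 divide_right_mono) auto
      have Gp: "(\<integral>\<^sup>+\<psi>. G \<psi> powr (p / (p - 1)) \<partial>circ) = 1"
      proof -
        have "G \<psi> powr (p / (p - 1)) = (1 / S) * h \<psi> powr p" for \<psi>
          using p h0[of \<psi>] N by (simp add: G_def powr_powr powr_divide)
        hence "(\<integral>\<^sup>+\<psi>. G \<psi> powr (p / (p - 1)) \<partial>circ) = (\<integral>\<^sup>+\<psi>. ennreal (1 / S) * ennreal (h \<psi> powr p) \<partial>circ)"
          using S0 by (simp add: ennreal_mult[symmetric])
        also have "\<dots> = ennreal (1 / S) * ennreal S" using nnS by (subst nn_integral_cmult) auto
        also have "\<dots> = 1" using S0 False by (simp add: ennreal_mult[symmetric])
        finally show ?thesis .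
      qed
      have G2: "(\<integral>\<^sup>+\<psi>. G \<psi> \<partial>circ) \<le> 2"
      proof -
        have "(\<integral>\<^sup>+\<psi>. G \<psi> \<partial>circ) \<le> (\<integral>\<^sup>+\<psi>. 1 + ennreal (G \<psi> powr (p / (p - 1))) \<partial>circ)"
        proof (rule nn_integral_mono)
          fix \<psi>
          have "G \<psi> \<le> 1 + G \<psi> powr (p / (p - 1))"
          proof (cases "G \<psi> \<le> 1")
            case True thus ?thesis by (simp add: add_increasing2)
          next
            case False
            hence "G \<psi> powr 1 \<le> G \<psi> powr (p / (p - 1))" using p by (intro powr_mono) auto
            thus ?thesis using False by simp
          qed
          hence "ennreal (G \<psi>) \<le> ennreal (1 + G \<psi> powr (p / (p - 1)))" by (rule ennreal_leI)
          thus "ennreal (G \<psi>) \<le> 1 + ennreal (G \<psi> powr (p / (p - 1)))" by simp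
        qed
        also have "\<dots> = (\<integral>\<^sup>+\<psi>. 1 \<partial>circ) + (\<integral>\<^sup>+\<psi>. G \<psi> powr (p / (p - 1)) \<partial>circ)"
          by (rule nn_integral_add) auto
        also have "\<dots> = 2" using Gp circ.emeasure_space_1 by simp
        finally show ?thesis .
      qed
      define J where "J = (\<lambda>g \<psi>. hankel_mass (\<alpha> - 1) g (of_real \<rho> * cis \<psi>))"
      have [measurable]: "zero_ext f \<in> borel_measurable borel" by (rule zero_ext_measurable[OF f])
      have [measurable]: "J (zero_ext f) \<in> borel_measurable borel"
        unfolding J_def hankel_mass_def hankel_weight_def by measurable
      have J_eq: "J f \<psi> = J (zero_ext f) \<psi>" for \<psi>
        unfolding J_def hankel_mass_def
      proof (rule nn_integral_cong_AE, rule eventually_mono[OF AE_unit])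
        fix y :: real assume y: "0 < y \<and> y < 1"
        have "zero_ext f (of_real \<rho> * cis \<psi> * (of_real ((1 - y)\<^sup>2) * cis (- x))\<^sup>2) = f (of_real \<rho> * cis \<psi> * (of_real ((1 - y)\<^sup>2) * cis (- x))\<^sup>2)" for x
        proof (rule zero_ext_eq)
          have "norm (of_real \<rho> * cis \<psi> * (of_real ((1 - y)\<^sup>2) * cis (- x))\<^sup>2) = \<rho> * ((1 - y)\<^sup>2)\<^sup>2"
            unfolding norm_mult[of "of_real \<rho> * cis \<psi>"] norm_power norm_scaled_cis[OF zero_le_power2] using \<rho> by (simp add: norm_scaled_cis)
          also have "\<dots> \<le> \<rho> * 1" using y \<rho> by (intro mult_left_mono power_le_one) auto
          finally show "norm (of_real \<rho> * cis \<psi> * (of_real ((1 - y)\<^sup>2) * cis (- x))\<^sup>2) < 1" using \<rho> by simp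
        qed
        thus "ennreal (y powr (\<alpha> - 1)) * (\<integral>\<^sup>+x. norm (hankel_weight f (of_real \<rho> * cis \<psi>) (of_real ((1 - y)\<^sup>2) * cis (- x))) \<partial>circ)
          = ennreal (y powr (\<alpha> - 1)) * (\<integral>\<^sup>+x. norm (hankel_weight (zero_ext f) (of_real \<rho> * cis \<psi>) (of_real ((1 - y)\<^sup>2) * cis (- x))) \<partial>circ)"
          by (simp add: hankel_weight_def)
      qed
      have h_le: "ennreal (h \<psi>) \<le> ennreal B + ennreal C1 * J (zero_ext f) \<psi>" for \<psi>
      proof -
        have "norm (complex_of_real \<rho> * cis \<psi>) < 1" using \<rho> by (subst norm_scaled_cis) auto
        from rep[OF f this] have "ennreal (h \<psi>) \<le> ennreal (B * norm (f 0)) + ennreal C1 * J f \<psi>"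
          unfolding h_def truncated_hankel_def J_def .
        also have "\<dots> \<le> ennreal B + ennreal C1 * J f \<psi>"
          using norm_at_0_le[OF f q(1) norm] B0 by (intro add_right_mono ennreal_leI) (simp add: mult_left_le)
        finally show ?thesis by (simp only: J_eq)
      qed
      have "ennreal N = (\<integral>\<^sup>+\<psi>. ennreal (G \<psi>) * ennreal (h \<psi>) \<partial>circ)"
      proof -
        have "G \<psi> * h \<psi> = (N / S) * h \<psi> powr p" for \<psi>
        proof (cases "h \<psi> = 0")
          case False
          hence hp: "h \<psi> > 0" using h0[of \<psi>] by simp
          have "h \<psi> powr (p - 1) * h \<psi> = h \<psi> powr p" using hp by (simp add: powr_diff)
          moreover have "N powr (p - 1) = S / N" using N by (simp add: powr_diff)
          ultimately show ?thesis using hp N by (simp add: G_def powr_divide)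
        qed (use p in \<open>simp add: G_def\<close>)
        hence "(\<integral>\<^sup>+\<psi>. ennreal (G \<psi>) * ennreal (h \<psi>) \<partial>circ) = (\<integral>\<^sup>+\<psi>. ennreal (N / S) * ennreal (h \<psi> powr p) \<partial>circ)"
          using S0 N G0 h0 by (simp add: ennreal_mult[symmetric])
        also have "\<dots> = ennreal (N / S) * ennreal S" using nnS by (subst nn_integral_cmult) auto
        also have "\<dots> = ennreal N" using S0 False N by (simp add: ennreal_mult[symmetric])
        finally show ?thesis ..
      qed
      also have "\<dots> \<le> (\<integral>\<^sup>+\<psi>. ennreal (G \<psi>) * (ennreal B + ennreal C1 * J (zero_ext f) \<psi>) \<partial>circ)"
        by (intro nn_integral_mono mult_left_mono h_le) auto
      also have "\<dots> = (\<integral>\<^sup>+\<psi>. ennreal B * ennreal (G \<psi>) + ennreal C1 * (ennreal (G \<psi>) * J (zero_ext f) \<psi>) \<partial>circ)"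
        by (simp add: distrib_left mult_ac)
      also have "\<dots> = ennreal B * (\<integral>\<^sup>+\<psi>. G \<psi> \<partial>circ) + ennreal C1 * (\<integral>\<^sup>+\<psi>. ennreal (G \<psi>) * J (zero_ext f) \<psi> \<partial>circ)"
        by (simp add: nn_integral_add nn_integral_cmult)
      also have "\<dots> \<le> ennreal B * 2 + ennreal C1 * ennreal C2"
      proof (intro add_mono mult_left_mono G2)
        have "(\<integral>\<^sup>+\<psi>. ennreal (G \<psi>) * J f \<psi> \<partial>circ) \<le> ennreal C2"
          using tri[OF f norm r(1,2), of G "(Bh / N) powr (p - 1)"] G0 GB Gp unfolding J_def r(3) \<alpha> by simp
        thus "(\<integral>\<^sup>+\<psi>. ennreal (G \<psi>) * J (zero_ext f) \<psi> \<partial>circ) \<le> ennreal C2" by (simp only: J_eq)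
      qed auto
      also have "\<dots> = ennreal D"
      proof -
        have "ennreal D = ennreal (B * 2) + ennreal (C1 * C2)"
          unfolding D_def using B0 C1 C2 by (subst ennreal_plus[symmetric]) (auto simp: mult.commute)
        thus ?thesis using B0 C1 C2 by (simp add: ennreal_mult)
      qed
      finally have "N \<le> D" using D0 by (simp add: ennreal_le_iff)
      thus ?thesis by (simp add: mean N_def)
    qed
  qed
qed

lemma integral_mean_nonneg: "0 \<le> integral_mean r F s"
  by (simp add: integral_mean_def)

lemma integral_mean_le_hardy_norm:
  assumes "f \<in> hardy q" "0 < s" "s < 1"
  shows "integral_mean q f s \<le> hardy_norm q f"
  unfolding hardy_norm_def using assms by (intro cSUP_upper) (auto simp: hardy_def)

theorem corollary4:
  fixes p q \<alpha> :: real and b :: "complex \<Rightarrow> complex"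
  assumes "1 < p" and "0 < q" and "q < p"
    and "\<alpha> = 1 / q - 1 / p"
    and "b \<in> lipschitz_disc \<alpha>"
  shows "bounded_matrix_op (truncate_1_0 (hankel_matrix b)) q p"
proof -
  note p = assms(1) and q = assms(2,3) and b = assms(5)
  obtain D where D: "0 \<le> D" and bound: "\<And>f \<rho>. \<lbrakk>f holomorphic_on ball 0 1;
      \<forall>s\<in>{0<..<1}. (\<integral>\<^sup>+t. norm (f (of_real s * cis t)) powr q \<partial>circ) \<le> 1; 0 < \<rho>; \<rho> < 1\<rbrakk>
      \<Longrightarrow> integral_mean p (truncated_hankel b f) \<rho> \<le> D"
    by (rule truncated_hankel_normalised_bound[OF p q assms(4) b]) (rule that)
  have b_hol: "b holomorphic_on ball 0 1" using b by (simp add: lipschitz_disc_def)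
  obtain B where B: "\<And>z. norm z < 1 \<Longrightarrow> norm (b z) \<le> B" by (rule lipschitz_disc_bounded[OF b]) (rule that)
  have bk: "norm (taylor_coeff b k) \<le> B" for k
    by (rule taylor_coeff_bounded[OF b_hol B])
  have mean_le: "integral_mean p (truncated_hankel b f) \<rho> \<le> D * hardy_norm q f"
    if f: "f \<in> hardy q" and \<rho>: "0 < \<rho>" "\<rho> < 1" for f \<rho>
  proof -
    have hol: "f holomorphic_on ball 0 1" using f by (simp add: hardy_def)
    have holH: "truncated_hankel b f holomorphic_on ball 0 1" by (rule truncated_hankel_holomorphic[OF hol bk])
    have N0: "0 \<le> hardy_norm q f"
      using order_trans[OF integral_mean_nonneg integral_mean_le_hardy_norm[OF f, of "1 / 2"]] by simp
    \<comment> \<open>dividing by any \<open>N\<close> above the norm also covers the case of norm zero\<close>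
    have scaled: "integral_mean p (truncated_hankel b f) \<rho> \<le> D * N" if N: "hardy_norm q f < N" for N
    proof -
      have N1: "0 < N" using N N0 by simp
      define c where "c = complex_of_real (1 / N)"
      have c: "norm c = 1 / N" using N1 by (simp add: c_def norm_divide)
      define f1 where "f1 = (\<lambda>z. c * f z)"
      have hol1: "f1 holomorphic_on ball 0 1" unfolding f1_def by (intro holomorphic_intros hol)
      have "(\<integral>\<^sup>+t. norm (f1 (of_real s * cis t)) powr q \<partial>circ) \<le> 1" if s: "s \<in> {0<..<1}" for s
      proof -
        define I where "I = (LINT t|circ. norm (f (of_real s * cis t)) powr q)"
        have int: "integrable circ (\<lambda>t. norm (f (of_real s * cis t)) powr q)"
          using s q by (intro integrable_circle_powr[OF hol]) auto
        have I0: "0 \<le> I" unfolding I_def by (intro Bochner_Integration.integral_nonneg) auto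
        have "I powr (1 / q) \<le> N"
          using integral_mean_le_hardy_norm[OF f, of s] integral_mean_circ[OF hol, of s q] s q N by (simp add: I_def)
        hence "(I powr (1 / q)) powr q \<le> N powr q" using q by (intro powr_mono2) auto
        hence IN: "I \<le> N powr q" using q I0 by (simp add: powr_powr)
        have "(\<integral>\<^sup>+t. norm (f1 (of_real s * cis t)) powr q \<partial>circ) = (\<integral>\<^sup>+t. ennreal (1 / N powr q) * ennreal (norm (f (of_real s * cis t)) powr q) \<partial>circ)"
          using N1 by (intro nn_integral_cong) (simp add: f1_def norm_mult c powr_mult powr_divide ennreal_mult[symmetric])
        also have "\<dots> = ennreal (1 / N powr q) * (\<integral>\<^sup>+t. ennreal (norm (f (of_real s * cis t)) powr q) \<partial>circ)"
          using int by (intro nn_integral_cmult) auto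
        also have "(\<integral>\<^sup>+t. ennreal (norm (f (of_real s * cis t)) powr q) \<partial>circ) = ennreal I"
          unfolding I_def by (rule nn_integral_eq_integral[OF int]) auto
        also have "ennreal (1 / N powr q) * ennreal I = ennreal (I / N powr q)"
          using I0 by (simp add: ennreal_mult[symmetric])
        also have "\<dots> \<le> ennreal 1" using IN N1 by (intro ennreal_leI) simp
        finally show ?thesis by simp
      qed
      hence "integral_mean p (truncated_hankel b f1) \<rho> \<le> D" by (intro bound hol1 \<rho>) auto
      moreover have "integral_mean p (truncated_hankel b f1) \<rho> = integral_mean p (truncated_hankel b f) \<rho> / N"
      proof -
        have hol1H: "truncated_hankel b f1 holomorphic_on ball 0 1" by (rule truncated_hankel_holomorphic[OF hol1 bk])
        have "truncated_hankel b f1 (of_real \<rho> * cis t) = c * truncated_hankel b f (of_real \<rho> * cis t)" for t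
          unfolding f1_def using \<rho> by (intro truncated_hankel_scale[OF hol bk]) (subst norm_scaled_cis, auto)
        hence "integral_mean p (truncated_hankel b f1) \<rho> = (LINT t|circ. (1 / N) powr p * norm (truncated_hankel b f (of_real \<rho> * cis t)) powr p) powr (1 / p)"
          using \<rho> p N1 by (subst integral_mean_circ[OF hol1H]) (auto simp: norm_mult c powr_mult powr_divide)
        also have "\<dots> = ((1 / N) powr p) powr (1 / p) * integral_mean p (truncated_hankel b f) \<rho>"
          using \<rho> p N1 by (subst integral_mean_circ[OF holH]) (auto simp: powr_mult Bochner_Integration.integral_nonneg)
        also have "((1 / N) powr p) powr (1 / p) = 1 / N" using p N1 by (simp add: powr_powr)
        finally show ?thesis by simp
      qed
      ultimately show ?thesis using N1 by (simp add: field_simps)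
    qed
    show ?thesis
    proof (rule tendsto_lowerbound)
      show "((\<lambda>N. D * N) \<longlongrightarrow> D * hardy_norm q f) (at_right (hardy_norm q f))"
        by (intro tendsto_intros)
      show "\<forall>\<^sub>F N in at_right (hardy_norm q f). integral_mean p (truncated_hankel b f) \<rho> \<le> D * N"
        using scaled by (auto simp: eventually_at_filter)
    qed simp
  qed
  show ?thesis
    unfolding bounded_matrix_op_def matrix_op_truncated_hankel
  proof (intro exI[of _ D] ballI conjI)
    fix f assume f: "f \<in> hardy q"
    have hol: "f holomorphic_on ball 0 1" using f by (simp add: hardy_def)
    show "matrix_op_defined (truncate_1_0 (hankel_matrix b)) f"
      unfolding matrix_op_defined_def
      using hankel_series(1)[OF hol _ bk] sums_summable[OF truncated_row_sum]
      by (auto simp: sums_unique[OF truncated_row_sum, symmetric])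
    show "truncated_hankel b f \<in> hardy p"
      unfolding hardy_def
      using truncated_hankel_holomorphic[OF hol bk] mean_le[OF f] by (auto intro!: bdd_aboveI)
    show "hardy_norm p (truncated_hankel b f) \<le> D * hardy_norm q f"
      unfolding hardy_norm_def[of p] by (intro cSUP_least) (use mean_le[OF f] in auto)
  qed
qed

end
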